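(* Let $G=([n],E)$ be a graph with $n\ge2$ vertices, with any fixed total ordering of the edges of each graph $G+P_j$ used to define $F_G$. Then $X_{G^\circ}(\mathbf x)=\mathrm{trace}(F_G)=\sum_{k=1}^{n-1}(F_G)_{k,k}$.
   Context: All graphs have vertex set $[n]$ for some $n$. For $G$ on $[n]$ and $H$ on $[n']$, $G+H$ is the graph on $[n+n'-1]$ with edge set $E(G)\cup\{\{i+n-1,j+n-1\}:\{i,j\}\in E(H)\}$. $P_j$ is the path on $[j]$ with edges $\{i,i+1\}$. $G^\circ$ is the multigraph on $[n-1]$ whose edge multiset consists of all $\{i,j\}\in E$ with $1\le i<j\le n-1$ together with one edge $\{i,1\}$ for each $\{i,n\}\in E$ (so multiple edges may occur). The chromatic symmetric function of a (multi)graph is $X(\mathbf x)=\sum_\kappa x_{\kappa(1)}\cdots x_{\kappa(N)}$ over proper colourings $\kappa$ (endpoints of every edge receive different positive integer colours). $e_\lambda$ are elementary symmetric functions, $e_\emptyset=1$. Forest triples: fix a total order $\lessdot$ on the edges of a graph $G$. An NBC tree is a subtree $T$ (a single vertex allowed) whose edge set contains no set $C\setminus\{\max C\}$, where $C$ is the edge set of a cycle of $G$ and the max is under $\lessdot$. A tree triple is $(T,\alpha,r)$ with $T$ an NBC tree, $\alpha$ a composition of $|V(T)|$ and $1\le r\le\alpha_1$. A forest triple is a sequence $((T_1,\alpha^{(1)},r_1),\dots,(T_m,\alpha^{(m)},r_m))$ of tree triples whose vertex sets partition $V(G)$ with $\min T_1<\dots<\min T_m$. Its type is the partition sorting $\alpha^{(1)}\cdots\alpha^{(m)}$,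 its sign is $(-1)^{\sum_i(\ell(\alpha^{(i)})-1)}$, and $\mathrm{type}'$ is the type with one instance of $\alpha^{(1)}_1$ removed. For $G$ on $[n]$ and $j\ge1$, $\mathrm{FT}^{(i)}(G+P_j)$ is the set of forest triples of $G+P_j$ such that, with $(T,\alpha,r)$ the tree triple containing vertex $1$ and $(T',\alpha',r')$ the one containing vertex $n$ (possibly equal), $\alpha_1=i$, $r=1$, $\{n,\dots,n+j-1\}\subseteq V(T')$, and the last part of $\alpha'$ is at least $j$. $F_G$ is the infinite matrix with $(F_G)_{i,j}=\sum_{\mathcal F\in\mathrm{FT}^{(i)}(G+P_j)}\mathrm{sign}(\mathcal F)e_{\mathrm{type}'(\mathcal F)}$ for positive integers $i,j$. *)

theory Defs
  imports
    "HOL-Library.Multiset"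
    "HOL-Library.FuncSet"
    "HOL-Library.Disjoint_Sets"
begin

section \<open>Formal power series in countably many commuting variables\<close>

text \<open>
  A monomial is a finite multiset of variable indices, and a power series is an arbitrary
  family of integer coefficients indexed by monomials. The variables of the symmetric functions
  are $x_1, x_2, \dots$; the type also has a variable $x_0$, which none of the series below
  involves.
\<close>

typedef pseries = "UNIV :: (nat multiset \<Rightarrow> int) set"
  morphisms coeff Abs_pseries by simp

lemma coeff_Abs_pseries [simp]: "coeff (Abs_pseries f) = f"
  by (simp add: Abs_pseries_inverse)

lemma pseries_eqI: "(\<And>m. coeff f m = coeff g m) \<Longrightarrow> f = g"
  by (simp add: coeff_inject [symmetric] fun_eq_iff)

lemma finite_submultisets [simp]: "finite {a. a \<subseteq># (m :: 'a multiset)}"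
proof (induction m)
  case (add x m)
  have "{a. a \<subseteq># add_mset x m} \<subseteq> {a. a \<subseteq># m} \<union> add_mset x ` {a. a \<subseteq># m}"
  proof
    fix a assume a: "a \<in> {a. a \<subseteq># add_mset x m}"
    show "a \<in> {a. a \<subseteq># m} \<union> add_mset x ` {a. a \<subseteq># m}"
    proof (cases "x \<in># a")
      case True
      then obtain b where "a = add_mset x b" by (metis insert_DiffM)
      then show ?thesis using a by auto
    next
      case False
      then have "a \<subseteq># m" using a
        by (metis Diff_eq_empty_iff_mset add_mset_remove_trivial diff_single_trivial
            mem_Collect_eq subset_eq_diff_conv add_mset_add_single)
      then show ?thesis by simp
    qed
  qed
  then show ?case by (rule finite_subset) (use add in auto)
qed simp

instantiation pseries :: comm_ring_1
begin

definition "0 = Abs_pseries (\<lambda>_. 0)"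
definition "1 = Abs_pseries (\<lambda>m. if m = {#} then 1 else 0)"
definition "f + g = Abs_pseries (\<lambda>m. coeff f m + coeff g m)"
definition "f - g = Abs_pseries (\<lambda>m. coeff f m - coeff g m)"
definition "- f = Abs_pseries (\<lambda>m. - coeff f m)"
definition "f * g = Abs_pseries (\<lambda>m. \<Sum>a | a \<subseteq># m. coeff f a * coeff g (m - a))"

lemmas pseries_defs = zero_pseries_def one_pseries_def plus_pseries_def minus_pseries_def
  uminus_pseries_def times_pseries_def

instance
proof
  fix f g h :: pseries
  show "f * g * h = f * (g * h)"
  proof (rule pseries_eqI)
    fix m
    have "coeff (f * g * h) m =
        (\<Sum>(a, b) \<in> (SIGMA a:{a. a \<subseteq># m}. {b. b \<subseteq># a}).
          coeff f b * coeff g (a - b) * coeff h (m - a))"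
      by (simp add: times_pseries_def sum_distrib_right sum.Sigma)
    also have "\<dots> = (\<Sum>(b, c) \<in> (SIGMA b:{b. b \<subseteq># m}. {c. c \<subseteq># m - b}).
          coeff f b * (coeff g c * coeff h (m - b - c)))"
      by (rule sum.reindex_bij_witness
            [where i = "\<lambda>(b, c). (b + c, b)" and j = "\<lambda>(a, b). (b, a - b)"])
         (auto simp: subset_eq_diff_conv subset_mset.le_diff_conv2 mult.assoc ac_simps
           dest: subset_mset.order_trans intro: subset_mset.order_trans)
    also have "\<dots> = coeff (f * (g * h)) m"
      by (simp add: times_pseries_def sum_distrib_left sum.Sigma)
    finally show "coeff (f * g * h) m = coeff (f * (g * h)) m" .
  qed
  show "f * g = g * f"
  proof (rule pseries_eqI)
    fix m
    show "coeff (f * g) m = coeff (g * f) m"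
      unfolding times_pseries_def coeff_Abs_pseries
      by (rule sum.reindex_bij_witness [where i = "\<lambda>a. m - a" and j = "\<lambda>a. m - a"])
         (auto simp: mult.commute subset_mset.diff_diff_right)
  qed
  show "1 * f = f"
  proof (rule pseries_eqI)
    fix m
    have "coeff (1 * f) m = (\<Sum>a | a \<subseteq># m. if a = {#} then coeff f m else 0)"
      unfolding times_pseries_def one_pseries_def coeff_Abs_pseries
      by (rule sum.cong) auto
    then show "coeff (1 * f) m = coeff f m" by simp
  qed
  show "(f + g) * h = f * h + g * h"
    by (rule pseries_eqI)
       (simp add: times_pseries_def plus_pseries_def distrib_right sum.distrib)
  have "coeff 0 {#} \<noteq> coeff 1 {#}" by (simp add: zero_pseries_def one_pseries_def)
  then show "(0 :: pseries) \<noteq> 1" by metis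
qed (auto intro!: pseries_eqI simp: pseries_defs)

end

text \<open>
  The elementary symmetric function $e_k$ is the sum of the squarefree monomials of degree $k$ in
  $x_1, x_2, \dots$. A partition is encoded as the multiset of its parts.
\<close>

definition elem :: "nat \<Rightarrow> pseries" where
  "elem k = Abs_pseries (\<lambda>m. if \<exists>S. finite S \<and> S \<subseteq> {1..} \<and> card S = k \<and> m = mset_set S
                             then 1 else 0)"

definition elem_part :: "nat multiset \<Rightarrow> pseries" where
  "elem_part p = (\<Prod>k\<in>#p. elem k)"


section \<open>Graphs and chromatic symmetric functions\<close>

text \<open>
  A graph on $\{1,\dots,n\}$ is given by $n$ and its set of edges, a multigraph by $n$ and its
  multiset of edges. An edge is its set of endpoints; in a multigraph a singleton \<open>{v}\<close> is a loop.
\<close>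

definition graph_on :: "nat \<Rightarrow> nat set set \<Rightarrow> bool" where
  "graph_on n E \<longleftrightarrow> E \<subseteq> {{i, j} | i j. 1 \<le> i \<and> i < j \<and> j \<le> n}"

text \<open>The edge set of $G + H$, where $n$ is the number of vertices of $G$.\<close>

definition plus_edges :: "nat \<Rightarrow> nat set set \<Rightarrow> nat set set \<Rightarrow> nat set set" where
  "plus_edges n E E' = E \<union> {{i + n - 1, j + n - 1} | i j. {i, j} \<in> E'}"

definition path_edges :: "nat \<Rightarrow> nat set set" where
  "path_edges j = {{i, i + 1} | i. 1 \<le> i \<and> i < j}"

text \<open>The edge multiset of $G^\circ$; an edge $\{1,n\}$ of $G$ becomes a loop at $1$.\<close>

definition circ_edges :: "nat \<Rightarrow> nat set set \<Rightarrow> nat set multiset" where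
  "circ_edges n E =
     mset_set {e. e \<in> E \<and> (\<exists>i j. e = {i, j} \<and> 1 \<le> i \<and> i < j \<and> j \<le> n - 1)}
     + image_mset (\<lambda>i. {i, 1}) (mset_set {i. {i, n} \<in> E})"

definition proper_colourings :: "nat \<Rightarrow> nat set multiset \<Rightarrow> (nat \<Rightarrow> nat) set" where
  "proper_colourings N M =
     {\<kappa> \<in> {1..N} \<rightarrow>\<^sub>E {1..}. \<forall>u v. {u, v} \<in># M \<longrightarrow> \<kappa> u \<noteq> \<kappa> v}"

text \<open>
  The coefficient of a monomial in $\sum_\kappa x_{\kappa(1)} \cdots x_{\kappa(N)}$ is the
  (finite) number of proper colourings $\kappa$ contributing that monomial.
\<close>

definition chrom_sym :: "nat \<Rightarrow> nat set multiset \<Rightarrow> pseries" where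
  "chrom_sym N M = Abs_pseries (\<lambda>m.
     int (card {\<kappa> \<in> proper_colourings N M. image_mset \<kappa> (mset_set {1..N}) = m}))"


section \<open>Forest triples\<close>

definition cycle_edges :: "nat set set \<Rightarrow> nat set set \<Rightarrow> bool" where
  "cycle_edges E C \<longleftrightarrow> C \<subseteq> E \<and>
     (\<exists>vs. 3 \<le> length vs \<and> distinct vs \<and>
           C = {{vs ! i, vs ! (Suc i mod length vs)} | i. i < length vs})"

definition subtree :: "nat \<Rightarrow> nat set set \<Rightarrow> nat set \<Rightarrow> nat set set \<Rightarrow> bool" where
  "subtree N E V F \<longleftrightarrow>
     V \<noteq> {} \<and> V \<subseteq> {1..N} \<and> F \<subseteq> E \<and> (\<forall>e\<in>F. e \<subseteq> V) \<and>
     (\<forall>u\<in>V. \<forall>v\<in>V. (u, v) \<in> {(a, b). {a, b} \<in> F}\<^sup>*) \<and>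
     (\<nexists>C. cycle_edges F C)"

text \<open>The order \<open>r\<close> is reflexive: \<open>(e, f) \<in> r\<close> means that \<open>e\<close> is smaller than or equal to \<open>f\<close>.\<close>

definition nbc_tree ::
    "nat \<Rightarrow> nat set set \<Rightarrow> nat set rel \<Rightarrow> nat set \<Rightarrow> nat set set \<Rightarrow> bool" where
  "nbc_tree N E r V F \<longleftrightarrow> subtree N E V F \<and>
     \<not> (\<exists>C c. cycle_edges E C \<and> c \<in> C \<and> (\<forall>e\<in>C. (e, c) \<in> r) \<and> C - {c} \<subseteq> F)"

definition composition :: "nat \<Rightarrow> nat list \<Rightarrow> bool" where
  "composition k \<alpha> \<longleftrightarrow> (\<forall>a\<in>set \<alpha>. 1 \<le> a) \<and> sum_list \<alpha> = k"

record tree_triple =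
  verts :: "nat set"
  edges :: "nat set set"
  parts :: "nat list"
  mark :: nat

definition is_tree_triple :: "nat \<Rightarrow> nat set set \<Rightarrow> nat set rel \<Rightarrow> tree_triple \<Rightarrow> bool" where
  "is_tree_triple N E r t \<longleftrightarrow>
     nbc_tree N E r (verts t) (edges t) \<and> composition (card (verts t)) (parts t) \<and>
     1 \<le> mark t \<and> mark t \<le> hd (parts t)"

definition is_forest_triple ::
    "nat \<Rightarrow> nat set set \<Rightarrow> nat set rel \<Rightarrow> tree_triple list \<Rightarrow> bool" where
  "is_forest_triple N E r ts \<longleftrightarrow>
     (\<forall>t\<in>set ts. is_tree_triple N E r t) \<and>
     partition_on {1..N} (set (map verts ts)) \<and>
     sorted_wrt (\<lambda>t t'. Min (verts t) < Min (verts t')) ts"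

definition ft_type :: "tree_triple list \<Rightarrow> nat multiset" where
  "ft_type ts = mset (concat (map parts ts))"

definition ft_type' :: "tree_triple list \<Rightarrow> nat multiset" where
  "ft_type' ts = ft_type ts - {#hd (parts (hd ts))#}"

definition ft_sign :: "tree_triple list \<Rightarrow> pseries" where
  "ft_sign ts = (- 1) ^ (\<Sum>t\<leftarrow>ts. length (parts t) - 1)"

lemma finite_forest_triples: "finite {ts. is_forest_triple N E r ts}"
proof -
  define A where "A = (\<lambda>(V, F, \<alpha>, k). \<lparr>verts = V, edges = F, parts = \<alpha>, mark = k\<rparr>) `
    (Pow {1..N} \<times> Pow (Pow {1..N}) \<times> {\<alpha>. set \<alpha> \<subseteq> {..N} \<and> length \<alpha> \<le> N} \<times> {..N})"
  have "finite A"
    unfolding A_def by (intro finite_imageI finite_cartesian_product finite_lists_length_le) auto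
  have len: "length \<alpha> \<le> sum_list \<alpha>" if "\<forall>a\<in>set \<alpha>. 1 \<le> a" for \<alpha> :: "nat list"
    using that by (induction \<alpha>) auto
  have in_A: "t \<in> A" if t: "is_tree_triple N E r t" for t
  proof -
    have V: "verts t \<noteq> {}" "verts t \<subseteq> {1..N}" "edges t \<subseteq> Pow {1..N}"
      using t by (auto simp: is_tree_triple_def nbc_tree_def subtree_def)
    have c: "\<forall>a\<in>set (parts t). 1 \<le> a" "sum_list (parts t) = card (verts t)"
      and m: "mark t \<le> hd (parts t)"
      using t by (auto simp: is_tree_triple_def composition_def)
    have cV: "card (verts t) \<le> N" "card (verts t) > 0"
      using V card_mono [of "{1..N}" "verts t"] finite_subset [of "verts t" "{1..N}"]
      by (auto simp: card_gt_0_iff)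
    have el: "a \<le> N" if "a \<in> set (parts t)" for a
      using member_le_sum_list [OF that] c(2) cV(1) by linarith
    have "parts t \<noteq> []" using c(2) cV(2) by auto
    then have "mark t \<le> N" using el m hd_in_set le_trans by blast
    moreover have "length (parts t) \<le> N" using len [OF c(1)] c(2) cV(1) by linarith
    ultimately have "(verts t, edges t, parts t, mark t) \<in>
        Pow {1..N} \<times> Pow (Pow {1..N}) \<times> {\<alpha>. set \<alpha> \<subseteq> {..N} \<and> length \<alpha> \<le> N} \<times> {..N}"
      using V el by auto
    then show ?thesis unfolding A_def by (rule rev_image_eqI) simp
  qed
  have dist: "distinct ts"
    if "sorted_wrt (\<lambda>t t'. Min (verts t) < Min (verts t')) ts" for ts :: "tree_triple list"
    using that by (induction ts) auto
  have "{ts. is_forest_triple N E r ts} \<subseteq> {ts. set ts \<subseteq> A \<and> distinct ts}"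
    using in_A dist by (auto simp: is_forest_triple_def)
  then show ?thesis
    by (rule finite_subset) (rule finite_subset_distinct [OF \<open>finite A\<close>])
qed

text \<open>
  The set $\mathrm{FT}^{(i)}(G + P_j)$ for $G = (\{1,\dots,n\}, E)$, where \<open>r\<close> is the total order on
  the edges of $G + P_j$.
\<close>

definition FT :: "nat \<Rightarrow> nat set set \<Rightarrow> nat set rel \<Rightarrow> nat \<Rightarrow> nat \<Rightarrow> tree_triple list set" where
  "FT n E r i j =
     {ts. is_forest_triple (n + j - 1) (plus_edges n E (path_edges j)) r ts \<and>
          (\<exists>t\<in>set ts. 1 \<in> verts t \<and> hd (parts t) = i \<and> mark t = 1) \<and>
          (\<exists>t'\<in>set ts. n \<in> verts t' \<and> {n..n + j - 1} \<subseteq> verts t' \<and> j \<le> last (parts t'))}"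

text \<open>
  Infinite matrices are indexed by the positive integers. \<open>ord j\<close> is the total order on the edges
  of $G + P_j$.
\<close>

definition F_mat ::
    "nat \<Rightarrow> nat set set \<Rightarrow> (nat \<Rightarrow> nat set rel) \<Rightarrow> nat \<Rightarrow> nat \<Rightarrow> pseries" where
  "F_mat n E ord i j = (\<Sum>ts\<in>FT n E (ord j) i j. ft_sign ts * elem_part (ft_type' ts))"

text \<open>
  The trace is meaningful only for a matrix with finitely many nonzero diagonal entries.
\<close>

definition trace_defined :: "(nat \<Rightarrow> nat \<Rightarrow> pseries) \<Rightarrow> bool" where
  "trace_defined A \<longleftrightarrow> finite {k. 1 \<le> k \<and> A k k \<noteq> 0}"

definition inf_trace :: "(nat \<Rightarrow> nat \<Rightarrow> pseries) \<Rightarrow> pseries" where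
  "inf_trace A = (\<Sum>k | 1 \<le> k \<and> A k k \<noteq> 0. A k k)"

end

theory Submission
  imports "HOL-Computational_Algebra.Formal_Power_Series" Defs
begin

text \<open>
  Write $P_k = (-1)^{k-1} p_k$ and let $C_k$ be the coefficients of $1 / \sum_i e_i z^i$, that is, the
  sum of $(-1)^{\ell(\alpha)} e_\alpha$ over the compositions of $k$. Choosing the composition and
  the mark of each tree separately turns $F_{k,k}$ into a sum over NBC sets of a product over
  connected components, and by Whitney's broken circuit argument such a sum is the sum over all edge
  sets $A$ with sign $(-1)^{|A|}$, whatever the order of the edges. An edge set missing part of the
  path contributes zero, so only edge sets $A$ of $G$ remain.

  A component that avoids $1$ and $n$ contributes its power sum. Newton's identities in the form
  $z E'(z) = E(z) P(z)$, together with $E(z) C(z) = 1$, evaluate the remaining components summed over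
  $k$: components of sizes $a$ and $b$ that contain $1$ and $n$ respectively give $P_{a+b-1}$, and a
  component of size $c$ that contains both gives $-P_{c-1}$. In either case the result is, up to sign,
  the power sum of the block that arises when $1$ and $n$ are identified. Hence the trace is the
  expansion of $X_{G^\circ}$ obtained by inclusion-exclusion over the monochromatic edges.
\<close>

section \<open>Truncation of power series to finitely many variables\<close>

text \<open>Whitney's involution preserves nothing but the connectivity relation, so the weight of a
  forest must be a function of the vertex sets of its trees. It is one: the conditions on the trees
  of 1 and n involve only vertex sets and compositions, and the sign (-1)^|F| can be distributed
  over the components because an NBC set F has as many edges as the sum of all |B| - 1. Passing to
  arbitrary edge sets is what makes the trace computable. The NBC sets of G + P_k vary with k, but
  the path edges are bridges, and once they are forced into the edge set, the index set is the power
  set of E for every k. The sums over k and over edge sets can then be exchanged, and for fixed A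
  only the one or two components at 1 and n depend on k. The tree at n has k - 1 more vertices than
  its part in [n], which explains the sizes b + k - 1 and c + k - 1 in the composition sums.
  Identities between series are checked after restriction to finitely many variables, where the
  infinite sums become polynomials.\<close>

definition truncate :: "nat set \<Rightarrow> pseries \<Rightarrow> pseries" where
  "truncate D f = Abs_pseries (\<lambda>m. if set_mset m \<subseteq> D then coeff f m else 0)"

lemma coeff_truncate [simp]:
  "coeff (truncate D f) m = (if set_mset m \<subseteq> D then coeff f m else 0)"
  by (simp add: truncate_def)

lemma coeff_add [simp]: "coeff (f + g) m = coeff f m + coeff g m"
  by (simp add: plus_pseries_def)

lemma coeff_zero [simp]: "coeff 0 m = 0"
  by (simp add: zero_pseries_def)

lemma coeff_minus [simp]: "coeff (- f) m = - coeff f m"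
  by (simp add: uminus_pseries_def)

lemma coeff_mult: "coeff (f * g) m = (\<Sum>a | a \<subseteq># m. coeff f a * coeff g (m - a))"
  by (simp add: times_pseries_def)

lemma coeff_one: "coeff 1 m = (if m = {#} then 1 else 0)"
  by (simp add: one_pseries_def)

lemma coeff_sum: "coeff (sum f A) m = (\<Sum>x\<in>A. coeff (f x) m)"
  by (induction A rule: infinite_finite_induct) auto

lemma truncate_add [simp]: "truncate D (f + g) = truncate D f + truncate D g"
  by (rule pseries_eqI) simp

lemma truncate_zero [simp]: "truncate D 0 = 0"
  by (rule pseries_eqI) simp

lemma truncate_one [simp]: "truncate D 1 = 1"
  by (rule pseries_eqI) (auto simp: coeff_one)

lemma truncate_minus [simp]: "truncate D (- f) = - truncate D f"
  by (rule pseries_eqI) simp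

lemma truncate_mult [simp]: "truncate D (f * g) = truncate D f * truncate D g"
proof (rule pseries_eqI)
  fix m
  show "coeff (truncate D (f * g)) m = coeff (truncate D f * truncate D g) m"
  proof (cases "set_mset m \<subseteq> D")
    case True
    then have "set_mset a \<subseteq> D" "set_mset (m - a) \<subseteq> D" if "a \<subseteq># m" for a
      using that by (meson in_diffD mset_subset_eqD subset_iff)+
    with True show ?thesis by (auto simp: coeff_mult intro!: sum.cong)
  next
    case False
    then have "\<not> set_mset a \<subseteq> D \<or> \<not> set_mset (m - a) \<subseteq> D" if "a \<subseteq># m" for a
      using that by (metis Un_subset_iff set_mset_union subset_mset.add_diff_inverse)
    then have "coeff (truncate D f * truncate D g) m = 0"
      unfolding coeff_mult by (intro sum.neutral) auto
    with False show ?thesis by simp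
  qed
qed

lemma truncate_sum: "truncate D (sum f A) = (\<Sum>x\<in>A. truncate D (f x))"
  by (induction A rule: infinite_finite_induct) auto

lemma truncate_prod: "truncate D (prod f A) = (\<Prod>x\<in>A. truncate D (f x))"
  by (induction A rule: infinite_finite_induct) auto

lemma truncate_power: "truncate D (f ^ k) = truncate D f ^ k"
  by (induction k) auto

lemma truncate_of_nat [simp]: "truncate D (of_nat k) = of_nat k"
  by (induction k) auto

lemma pseries_eqI_truncate:
  assumes "\<And>D. finite D \<Longrightarrow> truncate D f = truncate D g"
  shows "f = g"
proof (rule pseries_eqI)
  fix m
  show "coeff f m = coeff g m"
    using arg_cong[OF assms[of "set_mset m"], of "\<lambda>h. coeff h m"] by simp
qed

section \<open>Monomials, power sums and elementary functions in finitely many variables\<close>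

definition monomial :: "nat multiset \<Rightarrow> pseries" where
  "monomial a = Abs_pseries (\<lambda>m. if m = a then 1 else 0)"

lemma coeff_monomial: "coeff (monomial a) m = (if m = a then 1 else 0)"
  by (simp add: monomial_def)

lemma monomial_empty [simp]: "monomial {#} = 1"
  by (rule pseries_eqI) (simp add: coeff_monomial coeff_one)

lemma monomial_mult: "monomial a * monomial b = monomial (a + b)"
proof (rule pseries_eqI)
  fix m
  have "coeff (monomial a * monomial b) m =
      (\<Sum>c | c \<subseteq># m. if c = a then (if m - a = b then 1 else 0) else 0)"
    unfolding coeff_mult by (rule sum.cong) (auto simp: coeff_monomial)
  also have "\<dots> = (if a \<subseteq># m \<and> m - a = b then 1 else 0)"
    by (simp add: sum.delta)
  also have "\<dots> = coeff (monomial (a + b)) m"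
    by (auto simp: coeff_monomial)
  finally show "coeff (monomial a * monomial b) m = coeff (monomial (a + b)) m" .
qed

lemma prod_monomial:
  "(\<Prod>v\<in>V. monomial {#\<kappa> v#}) = monomial (image_mset \<kappa> (mset_set V))" if "finite V"
  using that by (induction V) (auto simp: monomial_mult)

lemma monomial_power: "monomial {#c#} ^ k = monomial (replicate_mset k c)"
  by (induction k) (auto simp: monomial_mult)

lemma coeff_sum_monomial:
  assumes "finite A"
  shows "coeff (\<Sum>x\<in>A. monomial (f x)) m = int (card {x \<in> A. f x = m})"
proof -
  have "coeff (\<Sum>x\<in>A. monomial (f x)) m = (\<Sum>x\<in>A. if f x = m then 1 else 0)"
    unfolding coeff_sum by (rule sum.cong) (auto simp: coeff_monomial)
  also have "\<dots> = int (card {x \<in> A. f x = m})"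
    using assms by (simp add: sum.If_cases Int_def)
  finally show ?thesis .
qed

definition power_sum :: "nat \<Rightarrow> pseries" where
  "power_sum k = Abs_pseries (\<lambda>m. if \<exists>c\<ge>1. m = replicate_mset k c then 1 else 0)"

lemma coeff_sum_monomial_inj:
  assumes "finite A" "inj_on f A"
  shows "coeff (\<Sum>x\<in>A. monomial (f x)) m = (if m \<in> f ` A then 1 else 0)"
proof -
  have "(\<Sum>x\<in>A. monomial (f x)) = (\<Sum>a\<in>f ` A. monomial a)"
    by (simp add: sum.reindex[OF assms(2)])
  then show ?thesis
    using assms(1) by (simp add: coeff_sum coeff_monomial)
qed

text \<open>The variable 0 takes no part in the symmetric functions, hence \<open>D - {0}\<close>.
  At \<open>k = 0\<close> the claim fails in general: the monomials all coincide,
  \<open>power_sum 0\<close> is 1, and the sum counts variables.\<close>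

lemma truncate_power_sum:
  assumes "finite D" "k \<ge> 1"
  shows "truncate D (power_sum k) = (\<Sum>c\<in>D - {0}. monomial {#c#} ^ k)"
proof (rule pseries_eqI)
  fix m
  have set_rep: "set_mset (replicate_mset k c) = {c}" for c :: nat
    using assms(2) by simp
  have "inj_on (\<lambda>c. replicate_mset k c) (D - {0})"
    by (rule inj_onI) (metis set_rep singleton_inject)
  then have "coeff (\<Sum>c\<in>D - {0}. monomial {#c#} ^ k) m =
      (if m \<in> replicate_mset k ` (D - {0}) then 1 else 0)"
    using assms(1) by (simp add: monomial_power coeff_sum_monomial_inj)
  moreover have "m \<in> replicate_mset k ` (D - {0}) \<longleftrightarrow>
      set_mset m \<subseteq> D \<and> (\<exists>c\<ge>1. m = replicate_mset k c)"
  proof safe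
    fix c assume "c \<in> D" "c > 0"
    then show "\<exists>d\<ge>1. replicate_mset k c = replicate_mset k d"
      by (intro exI[of _ c]) simp
  next
    fix c assume "set_mset (replicate_mset k c) \<subseteq> D" "1 \<le> c"
    then show "replicate_mset k c \<in> replicate_mset k ` (D - {0})"
      unfolding set_rep by (intro imageI) simp
  next
    fix c x assume "x \<in># replicate_mset k c" "c \<in> D"
    then show "x \<in> D" unfolding set_rep by simp
  qed
  ultimately show "coeff (truncate D (power_sum k)) m = coeff (\<Sum>c\<in>D - {0}. monomial {#c#} ^ k) m"
    unfolding coeff_truncate power_sum_def coeff_Abs_pseries by argo
qed

lemma truncate_elem:
  assumes "finite D"
  shows "truncate D (elem k) =
    (\<Sum>S | S \<subseteq> D - {0} \<and> card S = k. \<Prod>c\<in>S. monomial {#c#})"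
proof (rule pseries_eqI)
  fix m
  let ?A = "{S. S \<subseteq> D - {0} \<and> card S = k}"
  have fin: "finite ?A"
    by (rule finite_subset[of _ "Pow (D - {0})"]) (use assms in auto)
  have S_fin: "finite S" if "S \<in> ?A" for S
    using that assms by (metis (no_types, lifting) finite_Diff finite_subset mem_Collect_eq)
  have "(\<Sum>S\<in>?A. \<Prod>c\<in>S. monomial {#c#}) = (\<Sum>S\<in>?A. monomial (mset_set S))"
    by (rule sum.cong[OF refl]) (simp only: prod_monomial[OF S_fin] multiset.map_ident)
  moreover have "inj_on mset_set ?A"
    by (rule inj_onI) (metis S_fin finite_set_mset_mset_set)
  ultimately have "coeff (\<Sum>S\<in>?A. \<Prod>c\<in>S. monomial {#c#}) m = (if m \<in> mset_set ` ?A then 1 else 0)"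
    using fin by (simp add: coeff_sum_monomial_inj)
  moreover have "m \<in> mset_set ` ?A \<longleftrightarrow>
      set_mset m \<subseteq> D \<and> (\<exists>S. finite S \<and> S \<subseteq> {1..} \<and> card S = k \<and> m = mset_set S)"
  proof safe
    fix S assume S: "S \<subseteq> D - {0}" "k = card S"
    then have "finite S" using assms by (meson finite_Diff finite_subset)
    moreover have "S \<subseteq> {1..}" using S by (auto simp: Suc_le_eq intro: gr0I)
    ultimately show "\<exists>S'. finite S' \<and> S' \<subseteq> {1..} \<and> card S' = card S \<and> mset_set S = mset_set S'"
      by blast
  next
    fix S x assume "S \<subseteq> D - {0}" "x \<in># mset_set S"
    then show "x \<in> D" using assms by (metis DiffD1 elem_mset_set finite_Diff finite_subset in_mono)
  next
    fix S :: "nat set" assume "set_mset (mset_set S) \<subseteq> D" "finite S" "S \<subseteq> {1..}" "k = card S"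
    then show "mset_set S \<in> mset_set ` {S'. S' \<subseteq> D - {0} \<and> card S' = card S}"
      by (intro imageI) auto
  qed
  ultimately show "coeff (truncate D (elem k)) m = coeff (\<Sum>S\<in>?A. \<Prod>c\<in>S. monomial {#c#}) m"
    unfolding coeff_truncate elem_def coeff_Abs_pseries by argo
qed

lemma elem_0: "elem 0 = 1"
proof (rule pseries_eqI)
  fix m show "coeff (elem 0) m = coeff 1 m"
    by (auto simp: elem_def coeff_one intro: exI[of _ "{}"])
qed

text \<open>The P_k of the overview. The value 0 at \<open>k = 0\<close> is the constant term of z
  E'(z) / E(z), so that Newton's identity may run up to the index k.\<close>

definition signed_power_sum :: "nat \<Rightarrow> pseries" where
  "signed_power_sum k = (if k = 0 then 0 else (- 1) ^ (k - 1) * power_sum k)"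

text \<open>A factor 1 + x z contributes x z / (1 + x z), the sum of (-1)^(k-1) x^k z^k over k >= 1,
  to z times the logarithmic derivative. With denominators cleared, the identity holds over every
  commutative ring.\<close>

lemma log_deriv_prod:
  fixes x :: "'i \<Rightarrow> 'a::comm_ring_1"
  assumes "finite D"
  shows "fps_X * fps_deriv (\<Prod>c\<in>D. 1 + fps_const (x c) * fps_X) =
    (\<Prod>c\<in>D. 1 + fps_const (x c) * fps_X) *
    (\<Sum>c\<in>D. Abs_fps (\<lambda>k. if k = 0 then 0 else (- 1) ^ (k - 1) * x c ^ k))"
  using assms
proof (induction D)
  case (insert d D)
  let ?P = "\<Prod>c\<in>D. 1 + fps_const (x c) * fps_X"
  let ?g = "\<lambda>c. Abs_fps (\<lambda>k. if k = 0 then 0 else (- 1) ^ (k - 1) * x c ^ k)"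
  let ?l = "1 + fps_const (x d) * fps_X"
  have geo: "?l * ?g d = fps_const (x d) * fps_X"
  proof (rule fps_ext)
    fix k show "fps_nth (?l * ?g d) k = fps_nth (fps_const (x d) * fps_X) k"
    proof (cases k)
      case (Suc j)
      have "fps_nth (?l * ?g d) k = fps_nth (?g d) k + x d * fps_nth (?g d) j"
        by (simp add: distrib_right mult.assoc Suc)
      then show ?thesis using Suc by (cases j) auto
    qed simp
  qed
  have "fps_X * fps_deriv (\<Prod>c\<in>insert d D. 1 + fps_const (x c) * fps_X) =
     fps_const (x d) * fps_X * ?P + ?l * (fps_X * fps_deriv ?P)"
    using insert.hyps by (simp add: distrib_left mult.left_commute mult.commute)
  also have "\<dots> = ?l * ?g d * ?P + ?l * (?P * (\<Sum>c\<in>D. ?g c))"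
    unfolding insert.IH geo ..
  also have "\<dots> = ?l * ?P * (?g d + (\<Sum>c\<in>D. ?g c))"
    by (simp only: distrib_left mult.assoc mult.left_commute mult.commute)
  finally show ?case using insert.hyps by simp
qed simp

lemma prod_one_plus_nth:
  fixes x :: "'i \<Rightarrow> 'a::comm_ring_1"
  assumes "finite D"
  shows "fps_nth (\<Prod>c\<in>D. 1 + fps_const (x c) * fps_X) k =
    (\<Sum>S | S \<subseteq> D \<and> card S = k. \<Prod>c\<in>S. x c)"
proof -
  have "(\<Prod>c\<in>D. fps_const (x c) * fps_X + 1) =
      (\<Sum>S\<in>Pow D. (\<Prod>c\<in>S. fps_const (x c) * fps_X) * (\<Prod>c\<in>D - S. 1))"
    using assms by (rule prod_add)
  also have "\<dots> = (\<Sum>S\<in>Pow D. fps_const (\<Prod>c\<in>S. x c) * fps_X ^ card S)"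
  proof (rule sum.cong)
    fix S
    have "(\<Prod>c\<in>S. fps_const (x c)) = fps_const (\<Prod>c\<in>S. x c)"
      by (induction S rule: infinite_finite_induct) auto
    then show "(\<Prod>c\<in>S. fps_const (x c) * fps_X) * (\<Prod>c\<in>D - S. 1) =
        fps_const (\<Prod>c\<in>S. x c) * fps_X ^ card S"
      by (simp add: prod.distrib)
  qed simp
  finally have "fps_nth (\<Prod>c\<in>D. 1 + fps_const (x c) * fps_X) k =
      (\<Sum>S\<in>Pow D. if card S = k then \<Prod>c\<in>S. x c else 0)"
    by (simp add: add.commute fps_sum_nth fps_X_power_nth if_distrib eq_commute cong: if_cong)
  also have "\<dots> = (\<Sum>S | S \<subseteq> D \<and> card S = k. \<Prod>c\<in>S. x c)"
    using assms by (subst sum.inter_filter[symmetric]) auto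
  finally show ?thesis .
qed

lemma truncate_signed_power_sum:
  assumes "finite D"
  shows "truncate D (signed_power_sum k) = (\<Sum>c\<in>D - {0}. if k = 0 then 0 else (- 1) ^ (k - 1) * monomial {#c#} ^ k)"
  using assms truncate_power_sum[OF assms, of k]
  by (simp add: signed_power_sum_def truncate_power sum_distrib_left)

text \<open>The coefficient of z^k in z E'(z) = E(z) P(z); truncation to \<open>D\<close> makes E(z)
  a finite product of factors 1 + x_c z.\<close>

lemma newton_identity:
  "of_nat k * elem k = (\<Sum>i=0..k. elem i * signed_power_sum (k - i))"
proof (rule pseries_eqI_truncate)
  fix D :: "nat set" assume D: "finite D"
  let ?x = "\<lambda>c. monomial {#c#}"
  let ?E = "\<Prod>c\<in>D - {0}. 1 + fps_const (?x c) * fps_X"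
  let ?P = "\<Sum>c\<in>D - {0}. Abs_fps (\<lambda>k. if k = 0 then 0 else (- 1) ^ (k - 1) * ?x c ^ k)"
  have E: "fps_nth ?E i = truncate D (elem i)" for i
    using D by (simp add: prod_one_plus_nth truncate_elem)
  have P: "fps_nth ?P i = truncate D (signed_power_sum i)" for i
    using D by (simp add: truncate_signed_power_sum fps_sum_nth)
  have deriv: "fps_nth (fps_X * fps_deriv f) k = of_nat k * fps_nth f k" for f :: "pseries fps"
    by (cases k) auto
  have "fps_X * fps_deriv ?E = ?E * ?P"
    by (rule log_deriv_prod) (use D in simp)
  from arg_cong[OF this, of "\<lambda>f. fps_nth f k"]
  have "of_nat k * fps_nth ?E k = (\<Sum>i=0..k. fps_nth ?E i * fps_nth ?P (k - i))"
    unfolding deriv unfolding fps_mult_nth .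
  then show "truncate D (of_nat k * elem k) =
      truncate D (\<Sum>i=0..k. elem i * signed_power_sum (k - i))"
    unfolding E P truncate_sum truncate_mult truncate_of_nat .
qed

section \<open>Sums over compositions\<close>

lemma composition_Nil [simp]: "composition k [] \<longleftrightarrow> k = 0"
  by (auto simp: composition_def)

lemma composition_0 [simp]: "composition 0 \<alpha> \<longleftrightarrow> \<alpha> = []"
  by (cases \<alpha>) (auto simp: composition_def)

lemma composition_Cons: "composition k (m # \<beta>) \<longleftrightarrow> m \<in> {1..k} \<and> composition (k - m) \<beta>"
  by (auto simp: composition_def)

lemma composition_snoc: "composition k (\<beta> @ [m]) \<longleftrightarrow> m \<in> {1..k} \<and> composition (k - m) \<beta>"
  by (auto simp: composition_def)

lemma finite_compositions [simp]: "finite {\<alpha>. composition k \<alpha>}"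
proof (rule finite_subset)
  have "length \<alpha> \<le> sum_list \<alpha>" if "\<forall>a\<in>set \<alpha>. 1 \<le> a" for \<alpha> :: "nat list"
    using that by (induction \<alpha>) auto
  then show "{\<alpha>. composition k \<alpha>} \<subseteq> {\<alpha>. set \<alpha> \<subseteq> {..k} \<and> length \<alpha> \<le> k}"
    using member_le_sum_list by (fastforce simp: composition_def)
qed (simp add: finite_lists_length_le)

lemma sum_compositions_Cons:
  assumes "k \<ge> 1"
  shows "(\<Sum>\<alpha> | composition k \<alpha>. f \<alpha>) = (\<Sum>m=1..k. \<Sum>\<beta> | composition (k - m) \<beta>. f (m # \<beta>))"
proof -
  have "(\<Sum>m=1..k. \<Sum>\<beta> | composition (k - m) \<beta>. f (m # \<beta>)) =
      (\<Sum>(m, \<beta>)\<in>(SIGMA m:{1..k}. {\<beta>. composition (k - m) \<beta>}). f (m # \<beta>))"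
    by (rule sum.Sigma) auto
  also have "\<dots> = (\<Sum>\<alpha> | composition k \<alpha>. f \<alpha>)"
  proof (rule sum.reindex_bij_witness[where i = "\<lambda>\<alpha>. (hd \<alpha>, tl \<alpha>)" and j = "\<lambda>(m, \<beta>). m # \<beta>"])
    fix \<alpha> assume \<alpha>: "\<alpha> \<in> {\<alpha>. composition k \<alpha>}"
    then obtain m \<beta> where "\<alpha> = m # \<beta>" using assms by (cases \<alpha>) auto
    with \<alpha> show "(hd \<alpha>, tl \<alpha>) \<in> (SIGMA m:{1..k}. {\<beta>. composition (k - m) \<beta>})"
      "(case (hd \<alpha>, tl \<alpha>) of (m, \<beta>) \<Rightarrow> m # \<beta>) = \<alpha>"
      by (auto simp: composition_Cons)
  qed (auto simp: composition_Cons)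
  finally show ?thesis ..
qed

lemma sum_compositions_snoc:
  assumes "k \<ge> 1"
  shows "(\<Sum>\<alpha> | composition k \<alpha>. f \<alpha>) = (\<Sum>m=1..k. \<Sum>\<beta> | composition (k - m) \<beta>. f (\<beta> @ [m]))"
proof -
  have "(\<Sum>m=1..k. \<Sum>\<beta> | composition (k - m) \<beta>. f (\<beta> @ [m])) =
      (\<Sum>(m, \<beta>)\<in>(SIGMA m:{1..k}. {\<beta>. composition (k - m) \<beta>}). f (\<beta> @ [m]))"
    by (rule sum.Sigma) auto
  also have "\<dots> = (\<Sum>\<alpha> | composition k \<alpha>. f \<alpha>)"
  proof (rule sum.reindex_bij_witness[where i = "\<lambda>\<alpha>. (last \<alpha>, butlast \<alpha>)" and j = "\<lambda>(m, \<beta>). \<beta> @ [m]"])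
    fix \<alpha> assume \<alpha>: "\<alpha> \<in> {\<alpha>. composition k \<alpha>}"
    then obtain m \<beta> where "\<alpha> = \<beta> @ [m]" using assms by (cases \<alpha> rule: rev_cases) auto
    with \<alpha> show "(last \<alpha>, butlast \<alpha>) \<in> (SIGMA m:{1..k}. {\<beta>. composition (k - m) \<beta>})"
      "(case (last \<alpha>, butlast \<alpha>) of (m, \<beta>) \<Rightarrow> \<beta> @ [m]) = \<alpha>"
      by (auto simp: composition_snoc)
  qed (auto simp: composition_snoc)
  finally show ?thesis ..
qed

lemma elem_part_empty [simp]: "elem_part {#} = 1"
  by (simp add: elem_part_def)

lemma elem_part_add_mset [simp]: "elem_part (add_mset k p) = elem k * elem_part p"
  by (simp add: elem_part_def)

lemma elem_part_plus: "elem_part (p + q) = elem_part p * elem_part q"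
  by (simp add: elem_part_def)

text \<open>The C_k of the overview. The exponent is the full length because it will be applied to
  the parts left after one part has been removed, where (-1)^(l-1) becomes (-1)^l.\<close>

definition composition_sum :: "nat \<Rightarrow> pseries" where
  "composition_sum k = (\<Sum>\<alpha> | composition k \<alpha>. (- 1) ^ length \<alpha> * elem_part (mset \<alpha>))"

lemma composition_sum_0: "composition_sum 0 = 1"
  by (simp add: composition_sum_def)

lemma composition_sum_rec:
  assumes "k \<ge> 1"
  shows "composition_sum k = - (\<Sum>m=1..k. elem m * composition_sum (k - m))"
  unfolding composition_sum_def sum_compositions_Cons[OF assms]
  by (simp add: sum_distrib_left sum_negf mult.left_commute)

lemma elem_composition_sum: "Abs_fps elem * Abs_fps composition_sum = 1"
proof (rule fps_ext)
  fix k
  show "fps_nth (Abs_fps elem * Abs_fps composition_sum) k = fps_nth 1 k"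
  proof (cases "k = 0")
    case False
    have "fps_nth (Abs_fps elem * Abs_fps composition_sum) k =
        elem 0 * composition_sum k + (\<Sum>m=1..k. elem m * composition_sum (k - m))"
      by (simp add: fps_mult_nth sum.atLeast_Suc_atMost)
    then show ?thesis using False composition_sum_rec[of k] by (simp add: elem_0)
  qed (simp add: elem_0 composition_sum_0)
qed

lemma elem_signed_power_sum:
  "Abs_fps (\<lambda>k. of_nat k * elem k) = Abs_fps elem * Abs_fps signed_power_sum"
  by (rule fps_ext) (simp add: newton_identity fps_mult_nth)

text \<open>From z E' = E P and E C = 1 follows P = (z E') C; the factor m comes from the
  derivative.\<close>

lemma signed_power_sum_eq_sum:
  "signed_power_sum k = (\<Sum>m=0..k. of_nat m * elem m * composition_sum (k - m))"
proof -
  have "Abs_fps signed_power_sum = Abs_fps (\<lambda>k. of_nat k * elem k) * Abs_fps composition_sum"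
    unfolding elem_signed_power_sum using elem_composition_sum
    by (metis mult.commute mult.left_commute mult_1_right)
  then show ?thesis by (metis (no_types, lifting) fps_mult_nth fps_nth_Abs_fps sum.cong)
qed

text \<open>The weight of a tree that meets neither 1 nor n, where \<open>hd \<alpha>\<close> counts
  the marks. Splitting off the first part m leaves m e_m C_(k-m), the summand of the preceding
  formula.\<close>

lemma sum_hd_compositions:
  assumes "k \<ge> 1"
  shows "(\<Sum>\<alpha> | composition k \<alpha>. of_nat (hd \<alpha>) * ((- 1) ^ (length \<alpha> - 1) * elem_part (mset \<alpha>))) =
    signed_power_sum k"
  unfolding sum_compositions_Cons[OF assms] signed_power_sum_eq_sum
  by (simp add: sum.atLeast_Suc_atMost composition_sum_def sum_distrib_left mult.assoc mult.left_commute)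

text \<open>For a tree with 1 but not n: the first part has to be \<open>k\<close> and its factor
  e_k is discarded, so only the tail survives.\<close>

lemma sum_compositions_hd_eq:
  assumes "k \<ge> 1" "a \<ge> 1"
  shows "(\<Sum>\<alpha> | composition a \<alpha>. if hd \<alpha> = k then (- 1) ^ (length \<alpha> - 1) * elem_part (mset (tl \<alpha>)) else 0) =
    (if k \<le> a then composition_sum (a - k) else 0)"
proof -
  have "(\<Sum>m=1..a. \<Sum>\<beta> | composition (a - m) \<beta>.
        if m = k then (- 1) ^ length \<beta> * elem_part (mset \<beta>) else 0) =
      (\<Sum>m=1..a. if m = k then composition_sum (a - m) else 0)"
    by (rule sum.cong) (auto simp: composition_sum_def)
  also have "\<dots> = (if k \<le> a then composition_sum (a - k) else 0)"
    using assms by simp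
  finally show ?thesis
    unfolding sum_compositions_Cons[OF assms(2)] by (simp cong: if_cong)
qed

text \<open>For a tree with n but not 1. Splitting off the last part gives a sum over
  \<open>m >= k\<close>; Newton's identity trades it for the complementary sum over
  \<open>m < k\<close>, which will become a convolution with E(z).\<close>

lemma sum_compositions_last_ge:
  assumes "k \<ge> 1" "b \<ge> 1"
  shows "(\<Sum>\<alpha> | composition (b + k - 1) \<alpha>. if k \<le> last \<alpha>
            then of_nat (hd \<alpha>) * ((- 1) ^ (length \<alpha> - 1) * elem_part (mset \<alpha>)) else 0) =
    (\<Sum>m<k. elem m * signed_power_sum (b + k - 1 - m))"
proof -
  define N where "N = b + k - 1"
  have N: "N \<ge> 1" "k \<le> N" using assms by (auto simp: N_def)
  \<comment> \<open>Removing the last part flips the sign and keeps the first part, except at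
    \<open>m = N\<close>: nothing remains there and m is itself the first part, which produces
    \<open>of_nat N * elem N\<close>.\<close>
  have inner: "(\<Sum>\<beta> | composition (N - m) \<beta>. if k \<le> last (\<beta> @ [m])
        then of_nat (hd (\<beta> @ [m])) * ((- 1) ^ (length (\<beta> @ [m]) - 1) * elem_part (mset (\<beta> @ [m]))) else 0) =
      (if k \<le> m then (if m = N then of_nat N * elem N else 0) - elem m * signed_power_sum (N - m) else 0)"
    if "m \<in> {1..N}" for m
  proof (cases "m = N")
    case True
    then show ?thesis by (simp add: signed_power_sum_def)
  next
    case False
    then have m: "N - m \<ge> 1" using that by auto
    have "(\<Sum>\<beta> | composition (N - m) \<beta>.
          of_nat (hd (\<beta> @ [m])) * ((- 1) ^ length \<beta> * (elem m * elem_part (mset \<beta>)))) =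
        - (elem m * (\<Sum>\<beta> | composition (N - m) \<beta>.
            of_nat (hd \<beta>) * ((- 1) ^ (length \<beta> - 1) * elem_part (mset \<beta>))))"
      unfolding sum_distrib_left sum_negf[symmetric]
    proof (rule sum.cong)
      fix \<beta> assume "\<beta> \<in> {\<beta>. composition (N - m) \<beta>}"
      then obtain x \<gamma> where "\<beta> = x # \<gamma>" using m by (cases \<beta>) auto
      then show "of_nat (hd (\<beta> @ [m])) * ((- 1) ^ length \<beta> * (elem m * elem_part (mset \<beta>))) =
          - (elem m * (of_nat (hd \<beta>) * ((- 1) ^ (length \<beta> - 1) * elem_part (mset \<beta>))))"
        by (simp add: mult.left_commute)
    qed simp
    then show ?thesis
      unfolding sum_hd_compositions[OF m] using False by (simp cong: if_cong)
  qed
  have "(\<Sum>\<alpha> | composition N \<alpha>. if k \<le> last \<alpha>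
            then of_nat (hd \<alpha>) * ((- 1) ^ (length \<alpha> - 1) * elem_part (mset \<alpha>)) else 0) =
      (\<Sum>m=1..N. if k \<le> m then (if m = N then of_nat N * elem N else 0) - elem m * signed_power_sum (N - m) else 0)"
    unfolding sum_compositions_snoc[OF N(1)] by (rule sum.cong[OF refl inner])
  also have "\<dots> = (\<Sum>m=k..N. (if m = N then of_nat N * elem N else 0) - elem m * signed_power_sum (N - m))"
    using assms by (intro sum.mono_neutral_cong_right) auto
  also have "\<dots> = of_nat N * elem N - (\<Sum>m=k..N. elem m * signed_power_sum (N - m))"
    using N by (simp add: sum_subtractf)
  also have "\<dots> = (\<Sum>m<k. elem m * signed_power_sum (N - m))"
  proof -
    have "{0..N} = {..<k} \<union> {k..N}" using N by auto
    then have "(\<Sum>m=0..N. elem m * signed_power_sum (N - m)) =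
        (\<Sum>m<k. elem m * signed_power_sum (N - m)) + (\<Sum>m=k..N. elem m * signed_power_sum (N - m))"
      by (simp add: sum.union_disjoint ivl_disj_int)
    then show ?thesis unfolding newton_identity by simp
  qed
  finally show ?thesis by (simp add: N_def)
qed

text \<open>For a tree with both 1 and n. As \<open>c >= 2\<close>, the size exceeds
  \<open>k\<close>, so the last part is not the first one. Splitting off both leaves a composition
  whose length differs from the sign exponent by one, hence the minus sign.\<close>

lemma sum_compositions_hd_eq_last_ge:
  assumes "k \<ge> 1" "c \<ge> 2"
  shows "(\<Sum>\<alpha> | composition (c + k - 1) \<alpha>. if hd \<alpha> = k \<and> k \<le> last \<alpha>
            then (- 1) ^ (length \<alpha> - 1) * elem_part (mset (tl \<alpha>)) else 0) =
    - (\<Sum>m=k..c-1. elem m * composition_sum (c - 1 - m))"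
proof -
  have c: "c - 1 \<ge> 1" "c + k - 1 \<ge> 1" using assms by auto
  have "(\<Sum>\<alpha> | composition (c + k - 1) \<alpha>. if hd \<alpha> = k \<and> k \<le> last \<alpha>
            then (- 1) ^ (length \<alpha> - 1) * elem_part (mset (tl \<alpha>)) else 0) =
     (\<Sum>h=1..c+k-1. if h = k then \<Sum>\<beta> | composition (c + k - 1 - h) \<beta>. if k \<le> last (h # \<beta>)
            then (- 1) ^ length \<beta> * elem_part (mset \<beta>) else 0 else 0)"
    unfolding sum_compositions_Cons[OF c(2)] by (rule sum.cong) (auto cong: if_cong)
  also have "\<dots> = (\<Sum>\<beta> | composition (c - 1) \<beta>. if k \<le> last (k # \<beta>)
            then (- 1) ^ length \<beta> * elem_part (mset \<beta>) else 0)"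
    using assms by simp
  also have "\<dots> = (\<Sum>m=1..c-1. if k \<le> m then - (elem m * composition_sum (c - 1 - m)) else 0)"
    unfolding sum_compositions_snoc[OF c(1)] composition_sum_def
    by (rule sum.cong) (auto simp: sum_distrib_left sum_negf mult.left_commute)
  also have "\<dots> = (\<Sum>m=k..c-1. - (elem m * composition_sum (c - 1 - m)))"
    using assms by (intro sum.mono_neutral_cong_right) auto
  finally show ?thesis by (simp add: sum_negf)
qed

text \<open>With k shifted by one, the double sum is the coefficient of z^(a-1) in E(z) Q(z) C(z),
  where Q(z) is the sum of P_(b+s) z^s. Since E C = 1, this is P_(b+a-1). Terms with
  \<open>k > a\<close> vanish, so every \<open>M >= a\<close> gives the same value.\<close>

lemma trace_sum_distinct:
  assumes "1 \<le> a" "a \<le> M" "1 \<le> b"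
  shows "(\<Sum>k=1..M. (if k \<le> a then composition_sum (a - k) else 0) *
            (\<Sum>m<k. elem m * signed_power_sum (b + k - 1 - m))) = signed_power_sum (a + b - 1)"
proof -
  obtain a' where a': "a = Suc a'" using assms by (cases a) auto
  let ?P = "Abs_fps (\<lambda>s. signed_power_sum (b + s))"
  have "(\<Sum>k=1..M. (if k \<le> a then composition_sum (a - k) else 0) *
            (\<Sum>m<k. elem m * signed_power_sum (b + k - 1 - m))) =
      (\<Sum>k=1..a. composition_sum (a - k) * (\<Sum>m<k. elem m * signed_power_sum (b + k - 1 - m)))"
    using assms by (intro sum.mono_neutral_cong_right) auto
  also have "\<dots> = (\<Sum>k=0..a'. composition_sum (a' - k) * (\<Sum>m=0..k. elem m * signed_power_sum (b + (k - m))))"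
  proof -
    have "(\<Sum>k=1..a. composition_sum (a - k) * (\<Sum>m<k. elem m * signed_power_sum (b + k - 1 - m))) =
      (\<Sum>k=0..a'. composition_sum (a' - k) * (\<Sum>m<Suc k. elem m * signed_power_sum (b + k - m)))"
      unfolding a' One_nat_def sum.atLeast_Suc_atMost_Suc_shift by simp
    then show ?thesis
      by (simp add: lessThan_Suc_atMost atMost_atLeast0)
  qed
  also have "\<dots> = fps_nth (Abs_fps elem * ?P * Abs_fps composition_sum) a'"
    by (simp add: fps_mult_nth mult.commute[of "composition_sum _"])
  also have "Abs_fps elem * ?P * Abs_fps composition_sum = ?P"
    using elem_composition_sum by (metis mult.commute mult.left_commute mult_1_right)
  finally show ?thesis by (simp add: a' add.commute)
qed

text \<open>After exchanging the sums, each m occurs once for every k in \<open>{1..m}\<close> and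
  acquires the factor m of \<open>signed_power_sum_eq_sum\<close>; \<open>c <= Suc M\<close> ensures
  that none of these k is cut off.\<close>

lemma trace_sum_same:
  assumes "c \<le> Suc M"
  shows "(\<Sum>k=1..M. - (\<Sum>m=k..c-1. elem m * composition_sum (c - 1 - m))) = - signed_power_sum (c - 1)"
proof -
  define N where "N = c - 1"
  have N: "N \<le> M" using assms by (simp add: N_def)
  have "(\<Sum>k=1..M. \<Sum>m=k..N. elem m * composition_sum (N - m)) =
      (\<Sum>k=1..M. \<Sum>m=0..N. if k \<le> m then elem m * composition_sum (N - m) else 0)"
    by (intro sum.cong refl sum.mono_neutral_cong_left) auto
  also have "\<dots> = (\<Sum>m=0..N. \<Sum>k=1..M. if k \<le> m then elem m * composition_sum (N - m) else 0)"
    by (rule sum.swap)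
  also have "\<dots> = (\<Sum>m=0..N. of_nat m * elem m * composition_sum (N - m))"
  proof (rule sum.cong)
    fix m assume "m \<in> {0..N}"
    then have "{k \<in> {1..M}. k \<le> m} = {1..m}" using N by auto
    then show "(\<Sum>k=1..M. if k \<le> m then elem m * composition_sum (N - m) else 0) =
        of_nat m * elem m * composition_sum (N - m)"
      by (simp add: sum.inter_filter[symmetric] mult.assoc)
  qed simp
  finally show ?thesis
    by (simp add: N_def signed_power_sum_eq_sum sum_negf)
qed

section \<open>Connectivity and components\<close>

text \<open>A relation on the whole type, independent of a vertex set, so that two edge sets can be
  compared by an equation between relations.\<close>

definition connectivity :: "'a set set \<Rightarrow> 'a rel" where
  "connectivity A = {(a, b). {a, b} \<in> A}\<^sup>*"

definition components :: "'a set \<Rightarrow> 'a set set \<Rightarrow> 'a set set" where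
  "components V A = (\<lambda>v. connectivity A `` {v}) ` V"

definition simple_edges :: "'a set \<Rightarrow> 'a set set \<Rightarrow> bool" where
  "simple_edges V E \<longleftrightarrow> (\<forall>e\<in>E. \<exists>u v. u \<in> V \<and> v \<in> V \<and> u \<noteq> v \<and> e = {u, v})"

lemma simple_edges_subset: "simple_edges V A \<Longrightarrow> e \<in> A \<Longrightarrow> e \<subseteq> V"
  by (auto simp: simple_edges_def)

lemma connectivity_refl [simp]: "(u, u) \<in> connectivity A"
  by (simp add: connectivity_def)

lemma connectivity_trans: "(u, v) \<in> connectivity A \<Longrightarrow> (v, w) \<in> connectivity A \<Longrightarrow> (u, w) \<in> connectivity A"
  unfolding connectivity_def by (rule rtrancl_trans)

lemma connectivity_edge: "{u, v} \<in> A \<Longrightarrow> (u, v) \<in> connectivity A"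
  unfolding connectivity_def by (rule r_into_rtrancl) simp

lemma connectivity_sym: "(u, v) \<in> connectivity A \<Longrightarrow> (v, u) \<in> connectivity A"
  unfolding connectivity_def
  by (rule symD[OF sym_rtrancl]) (auto simp: sym_def insert_commute)

lemma connectivity_mono: "A \<subseteq> B \<Longrightarrow> connectivity A \<subseteq> connectivity B"
  unfolding connectivity_def by (rule rtrancl_mono) auto

text \<open>Used below with \<open>g\<close> a membership test, a threshold, a component or a
  colouring.\<close>

lemma connectivity_invariant:
  assumes "(u, v) \<in> connectivity A" "\<And>a b. {a, b} \<in> A \<Longrightarrow> g a = g b"
  shows "g u = g v"
  using assms(1) unfolding connectivity_def
  by (induction rule: rtrancl_induct) (use assms(2) in auto)

lemma connectivity_class_eq_iff:
  "connectivity A `` {u} = connectivity A `` {v} \<longleftrightarrow> (u, v) \<in> connectivity A"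
proof
  assume "connectivity A `` {u} = connectivity A `` {v}"
  then show "(u, v) \<in> connectivity A" by (metis Image_singleton_iff connectivity_refl)
next
  assume uv: "(u, v) \<in> connectivity A"
  have "(u, x) \<in> connectivity A \<longleftrightarrow> (v, x) \<in> connectivity A" for x
    using connectivity_trans[OF uv, of x] connectivity_trans[OF connectivity_sym[OF uv], of x] by blast
  then show "connectivity A `` {u} = connectivity A `` {v}" by blast
qed

lemma components_eq_class:
  assumes "B \<in> components V A" "x \<in> B"
  shows "B = connectivity A `` {x}"
proof -
  obtain v where v: "B = connectivity A `` {v}" using assms(1) by (auto simp: components_def)
  then have "(v, x) \<in> connectivity A" using assms(2) by simp
  then show ?thesis unfolding v connectivity_class_eq_iff .
qed

lemma connectivity_subset:
  assumes "\<And>a b. {a, b} \<in> A \<Longrightarrow> (a, b) \<in> connectivity B"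
  shows "connectivity A \<subseteq> connectivity B"
proof safe
  fix u v assume "(u, v) \<in> connectivity A"
  then have "connectivity B `` {u} = connectivity B `` {v}"
    by (rule connectivity_invariant) (simp only: assms connectivity_class_eq_iff)
  then show "(u, v) \<in> connectivity B" by (simp only: connectivity_class_eq_iff)
qed

lemma connectivity_insert:
  assumes "(u, v) \<in> connectivity A"
  shows "connectivity (insert {u, v} A) = connectivity A"
proof
  show "connectivity (insert {u, v} A) \<subseteq> connectivity A"
    by (rule connectivity_subset)
       (use assms in \<open>auto simp: doubleton_eq_iff intro: connectivity_edge connectivity_sym\<close>)
qed (simp add: connectivity_mono subset_insertI)

text \<open>\<open>T\<close> joins the ends of the edge inside both sets without using the edge, so
  the presence of the edge does not matter.\<close>

lemma connectivity_toggle: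
  assumes "(u, v) \<in> connectivity T" "T \<subseteq> S - {{u, v}}" "S - {{u, v}} = S' - {{u, v}}"
  shows "connectivity S = connectivity S'"
proof -
  have *: "connectivity R = connectivity (R - {{u, v}})" if "T \<subseteq> R - {{u, v}}" for R
  proof (cases "{u, v} \<in> R")
    case True
    have "(u, v) \<in> connectivity (R - {{u, v}})"
      using assms(1) connectivity_mono[OF that] by auto
    from connectivity_insert[OF this] True show ?thesis by (simp add: insert_absorb)
  qed simp
  show ?thesis using *[of S] *[of S'] assms(2,3) by simp
qed

lemma connectivity_in_set:
  assumes "(u, v) \<in> connectivity A" "u \<in> V" "\<And>e. e \<in> A \<Longrightarrow> e \<subseteq> V"
  shows "v \<in> V"
  using connectivity_invariant[OF assms(1), of "\<lambda>x. x \<in> V"] assms(2,3) by blast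

lemma partition_on_components:
  assumes "\<And>e. e \<in> A \<Longrightarrow> e \<subseteq> V"
  shows "partition_on V (components V A)"
proof (rule partition_onI)
  have sub: "connectivity A `` {v} \<subseteq> V" if "v \<in> V" for v
    using connectivity_in_set[OF _ that assms] by blast
  show "\<Union> (components V A) = V"
  proof
    show "\<Union> (components V A) \<subseteq> V" using sub by (auto simp: components_def)
    show "V \<subseteq> \<Union> (components V A)"
    proof
      fix v assume "v \<in> V"
      then have "connectivity A `` {v} \<in> components V A" by (simp add: components_def)
      moreover have "v \<in> connectivity A `` {v}" by simp
      ultimately show "v \<in> \<Union> (components V A)" by (rule UnionI)
    qed
  qed
  fix p q assume pq: "p \<in> components V A" "q \<in> components V A" "p \<noteq> q"
  show "disjnt p q"
    unfolding disjnt_iff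
  proof (intro allI notI)
    fix x assume "x \<in> p \<and> x \<in> q"
    then have "p = connectivity A `` {x}" "q = connectivity A `` {x}"
      using pq by (simp_all only: components_eq_class)
    then show False using pq(3) by simp
  qed
next
  show "{} \<notin> components V A"
  proof
    assume "{} \<in> components V A"
    then obtain v where "{} = connectivity A `` {v}" by (auto simp: components_def)
    moreover have "v \<in> connectivity A `` {v}" by simp
    ultimately show False by simp
  qed
qed

lemma partition_on_unique:
  assumes "partition_on V P" "B \<in> P" "B' \<in> P" "v \<in> B" "v \<in> B'"
  shows "B = B'"
  using assms partition_onD2 by (metis disjnt_iff pairwiseD)

lemma components_eqI:
  assumes P: "partition_on V P"
    and edges: "\<And>e. e \<in> A \<Longrightarrow> \<exists>B\<in>P. e \<subseteq> B"
    and conn: "\<And>B u v. B \<in> P \<Longrightarrow> u \<in> B \<Longrightarrow> v \<in> B \<Longrightarrow> (u, v) \<in> connectivity A"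
  shows "components V A = P"
proof -
  have closed: "connectivity A `` {v} = B" if "B \<in> P" "v \<in> B" for B v
  proof (intro equalityI subsetI)
    fix u assume "u \<in> connectivity A `` {v}"
    then have "(v, u) \<in> connectivity A" by simp
    moreover have "a \<in> B \<longleftrightarrow> b \<in> B" if ab: "{a, b} \<in> A" for a b
      using edges[OF ab] partition_on_unique[OF P \<open>B \<in> P\<close>] by auto
    ultimately show "u \<in> B"
      using connectivity_invariant[of v u A "\<lambda>x. x \<in> B"] that(2) by blast
  qed (use conn that in auto)
  show ?thesis
  proof (intro equalityI subsetI)
    fix C assume "C \<in> components V A"
    then obtain v where "v \<in> V" "C = connectivity A `` {v}" by (auto simp: components_def)
    moreover from this obtain B where "B \<in> P" "v \<in> B" using P by (auto simp: partition_on_def)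
    ultimately show "C \<in> P" using closed by auto
  next
    fix B assume B: "B \<in> P"
    then obtain v where "v \<in> B" using P by (metis equals0I partition_onD3)
    moreover have "v \<in> V" using B \<open>v \<in> B\<close> P by (auto simp: partition_on_def)
    ultimately show "B \<in> components V A" using closed[OF B] unfolding components_def by blast
  qed
qed

lemma components_empty: "components V {} = (\<lambda>v. {v}) ` V"
  by (simp add: components_def connectivity_def)

lemma edge_in_component:
  assumes "simple_edges V A" "e \<in> A"
  shows "\<exists>B\<in>components V A. e \<subseteq> B"
proof -
  obtain a b where ab: "a \<in> V" "e = {a, b}" using assms unfolding simple_edges_def by blast
  then have "(a, b) \<in> connectivity A" using assms(2) by (simp add: connectivity_edge)
  then have "e \<subseteq> connectivity A `` {a}" using ab(2) by simp
  moreover have "connectivity A `` {a} \<in> components V A" using ab(1) by (simp add: components_def)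
  ultimately show ?thesis by blast
qed

text \<open>If both ends lie in the same component, then \<open>U = W\<close> and the right-hand
  side is \<open>components V A\<close> again; one formula covers both cases.\<close>

lemma components_insert:
  assumes "u \<in> V" "v \<in> V" "simple_edges V A"
  defines "U \<equiv> connectivity A `` {u}" and "W \<equiv> connectivity A `` {v}"
  shows "components V (insert {u, v} A) = insert (U \<union> W) (components V A - {U, W})"
proof (rule components_eqI)
  note P = partition_on_components[OF simple_edges_subset[OF assms(3)]]
  have UW: "U \<in> components V A" "W \<in> components V A"
    using assms(1,2) by (auto simp: components_def U_def W_def)
  have disj: "B \<inter> B' = {}" if "B \<in> components V A" "B' \<in> components V A" "B \<noteq> B'" for B B'
    using that P by (auto simp: partition_on_def disjoint_def)
  show "partition_on V (insert (U \<union> W) (components V A - {U, W}))"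
  proof (rule partition_onI)
    have "\<Union> (components V A) = V" using P by (simp add: partition_on_def)
    then show "\<Union> (insert (U \<union> W) (components V A - {U, W})) = V" using UW by blast
    show "{} \<notin> insert (U \<union> W) (components V A - {U, W})"
      using P UW by (auto simp: partition_on_def)
    fix p q assume "p \<in> insert (U \<union> W) (components V A - {U, W})"
      "q \<in> insert (U \<union> W) (components V A - {U, W})" "p \<noteq> q"
    then consider "p \<in> components V A" "q \<in> components V A"
      | "p = U \<union> W" "q \<in> components V A" "q \<noteq> U" "q \<noteq> W"
      | "q = U \<union> W" "p \<in> components V A" "p \<noteq> U" "p \<noteq> W"
      by auto
    then show "disjnt p q"
    proof cases
      case 1
      then show ?thesis using \<open>p \<noteq> q\<close> disj by (simp add: disjnt_def)
    next
      case 2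
      then show ?thesis using disj UW by (simp add: disjnt_def Int_Un_distrib2)
    next
      case 3
      then show ?thesis using disj UW by (simp add: disjnt_def Int_Un_distrib)
    qed
  qed
  have incl: "\<exists>B'\<in>insert (U \<union> W) (components V A - {U, W}). B \<subseteq> B'" if "B \<in> components V A" for B
  proof (cases "B = U \<or> B = W")
    case True
    then show ?thesis by auto
  next
    case False
    with that have "B \<in> components V A - {U, W}" by simp
    then show ?thesis by blast
  qed
  show "\<exists>B\<in>insert (U \<union> W) (components V A - {U, W}). e \<subseteq> B" if "e \<in> insert {u, v} A" for e
  proof (cases "e = {u, v}")
    case True
    then show ?thesis by (auto simp: U_def W_def)
  next
    case False
    then have "e \<in> A" using that by simp
    then obtain B where "B \<in> components V A" "e \<subseteq> B" using edge_in_component[OF assms(3)] by blast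
    then show ?thesis using incl by (meson order_trans)
  qed
  let ?c = "connectivity (insert {u, v} A)"
  have sub: "connectivity A \<subseteq> ?c" by (simp add: connectivity_mono subset_insertI)
  show "(x, y) \<in> ?c" if "B \<in> insert (U \<union> W) (components V A - {U, W})" "x \<in> B" "y \<in> B" for B x y
  proof (cases "B \<in> components V A")
    case True
    with that(2,3) have "(x, y) \<in> connectivity A"
      using components_eq_class[OF True that(2)] by blast
    then show ?thesis using sub by blast
  next
    case False
    then have B: "B = U \<union> W" using that(1) by simp
    have to_u: "(u, z) \<in> ?c" if "z \<in> U \<union> W" for z
    proof -
      have "(u, z) \<in> connectivity A \<or> (v, z) \<in> connectivity A"
        using that by (auto simp: U_def W_def)
      then have "(u, z) \<in> ?c \<or> (v, z) \<in> ?c" using sub by blast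
      moreover have "(u, v) \<in> ?c" by (rule connectivity_edge) simp
      ultimately show ?thesis using connectivity_trans[of u v _ z] by blast
    qed
    show ?thesis
      using connectivity_trans[OF connectivity_sym[OF to_u] to_u] that(2,3) B by simp
  qed
qed

section \<open>NBC sets\<close>

text \<open>The path is built from its end. If the new start \<open>u\<close> already lies on it,
  everything before \<open>u\<close> is dropped, which keeps the vertices distinct.\<close>

lemma distinct_path:
  assumes "(u, v) \<in> R\<^sup>*"
  shows "\<exists>xs. xs \<noteq> [] \<and> hd xs = u \<and> last xs = v \<and> distinct xs \<and> successively (\<lambda>a b. (a, b) \<in> R) xs"
  using assms
proof (induction rule: converse_rtrancl_induct)
  case base
  show ?case by (rule exI[of _ "[v]"]) simp
next
  case (step u w)
  then obtain xs where xs: "xs \<noteq> []" "hd xs = w" "last xs = v" "distinct xs"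
    "successively (\<lambda>a b. (a, b) \<in> R) xs" by blast
  show ?case
  proof (cases "u \<in> set xs")
    case True
    then obtain ys zs where "xs = ys @ u # zs" by (meson split_list)
    with xs show ?thesis by (intro exI[of _ "u # zs"]) (auto simp: successively_append_iff)
  next
    case False
    with xs step(1) show ?thesis
      by (intro exI[of _ "u # xs"]) (auto simp: successively_Cons)
  qed
qed

text \<open>A cycle without one of its edges is still a path through all of its vertices.\<close>

lemma cycle_invariant:
  assumes C: "cycle_edges E C" "c \<in> C"
    and g: "\<And>u v. {u, v} \<in> C - {c} \<Longrightarrow> g u = g v"
    and uv: "u \<in> \<Union>C" "v \<in> \<Union>C"
  shows "g u = g v"
proof -
  obtain vs where vs: "3 \<le> length vs" "distinct vs"
    "C = {{vs ! i, vs ! (Suc i mod length vs)} | i. i < length vs}"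
    using C(1) by (auto simp: cycle_edges_def)
  define L where "L = length vs"
  have L: "L \<ge> 3" using vs by (simp add: L_def)
  define edge where "edge i = {vs ! i, vs ! (Suc i mod L)}" for i
  obtain i where i: "i < L" "c = edge i" using C(2) vs(3) by (auto simp: edge_def L_def)
  \<comment> \<open>From length three on, different positions give different edges; in length two
    they would coincide.\<close>
  have edge_neq: "edge j \<noteq> c" if "j < L" "j \<noteq> i" for j
  proof
    assume "edge j = c"
    moreover have "Suc i mod L < L" "Suc j mod L < L" using L by simp_all
    ultimately have "j = Suc i mod L" "Suc j mod L = i"
      using that i nth_eq_iff_index_eq[OF vs(2)]
      by (auto simp: edge_def doubleton_eq_iff L_def)
    then show False using L i that by (cases "Suc i = L"; cases "Suc j = L") auto
  qed
  \<comment> \<open>The walk starts just after the removed edge. It reaches every vertex within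
    \<open>L - 1\<close> steps and would traverse that edge only in step \<open>L\<close>.\<close>
  define s where "s = Suc i mod L"
  have step: "g (vs ! ((s + t) mod L)) = g (vs ! s)" if "t < L" for t
    using that
  proof (induction t)
    case 0
    then show ?case by (simp add: s_def)
  next
    case (Suc t)
    let ?j = "(s + t) mod L"
    have "?j \<noteq> i"
    proof
      assume "?j = i"
      then have "(Suc i + t) mod L = i mod L" using i by (simp add: s_def mod_simps)
      then have "L dvd Suc t" by (metis (no_types, lifting) add.commute add_Suc_right add_diff_cancel_left' add_Suc mod_eq_dvd_iff_nat le_add1)
      then show False using Suc.prems by (meson dvd_imp_le leD zero_less_Suc)
    qed
    moreover have "?j < L" using L by simp
    ultimately have "edge ?j \<in> C - {c}" using edge_neq vs(3) by (auto simp: edge_def L_def)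
    then have "g (vs ! ?j) = g (vs ! (Suc ?j mod L))" unfolding edge_def by (rule g)
    then show ?case using Suc by (simp add: mod_simps)
  qed
  have all: "g (vs ! q) = g (vs ! s)" if "q < L" for q
  proof -
    have s: "s < L" using L by (simp add: s_def)
    show ?thesis
    proof (cases "s \<le> q")
      case True
      then show ?thesis using step[of "q - s"] that by simp
    next
      case False
      then have "(s + (L + q - s)) mod L = q" "L + q - s < L" using s that by auto
      then show ?thesis using step[of "L + q - s"] by simp
    qed
  qed
  have "\<exists>q<L. x = vs ! q" if x: "x \<in> \<Union>C" for x
  proof -
    obtain i where "i < L" "x \<in> {vs ! i, vs ! (Suc i mod L)}"
      using x unfolding vs(3) L_def[symmetric] by auto
    moreover have "Suc i mod L < L" using L by simp
    ultimately show ?thesis by blast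
  qed
  then show ?thesis using uv all by metis
qed

text \<open>
  Describing broken circuits by connectivity through smaller edges avoids the exchange property of
  cycles in Whitney's argument.
\<close>

definition closes_cycle :: "'a set rel \<Rightarrow> 'a set set \<Rightarrow> 'a set \<Rightarrow> bool" where
  "closes_cycle r A e \<longleftrightarrow> (\<exists>u v. e = {u, v} \<and> (u, v) \<in> connectivity {a \<in> A. a \<noteq> e \<and> (a, e) \<in> r})"

definition nbc_set :: "nat set set \<Rightarrow> nat set rel \<Rightarrow> nat set set \<Rightarrow> bool" where
  "nbc_set E r F \<longleftrightarrow> F \<subseteq> E \<and>
     \<not> (\<exists>C c. cycle_edges E C \<and> c \<in> C \<and> (\<forall>e\<in>C. (e, c) \<in> r) \<and> C - {c} \<subseteq> F)"

text \<open>A broken circuit is a path of smaller edges between the ends of its missing edge.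
  Conversely, a connection through smaller edges shortens to a path with distinct vertices, which
  closes up with \<open>e\<close> to a cycle whose largest edge is \<open>e\<close>.\<close>

lemma nbc_set_iff:
  assumes "simple_edges V E" "linear_order_on E r"
  shows "nbc_set E r F \<longleftrightarrow> F \<subseteq> E \<and> \<not> (\<exists>e\<in>E. closes_cycle r F e)"
proof -
  have "(\<exists>C c. cycle_edges E C \<and> c \<in> C \<and> (\<forall>e\<in>C. (e, c) \<in> r) \<and> C - {c} \<subseteq> F) \<longleftrightarrow>
      (\<exists>e\<in>E. closes_cycle r F e)" (is "?L \<longleftrightarrow> ?R")
  proof
    assume ?L
    then obtain C c where C: "cycle_edges E C" "c \<in> C" "\<forall>e\<in>C. (e, c) \<in> r" "C - {c} \<subseteq> F" by blast
    have cE: "c \<in> E" using C by (auto simp: cycle_edges_def)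
    then obtain u v where uv: "c = {u, v}" using assms(1) unfolding simple_edges_def by blast
    let ?A = "{a \<in> F. a \<noteq> c \<and> (a, c) \<in> r}"
    have "connectivity ?A `` {u} = connectivity ?A `` {v}"
    proof (rule cycle_invariant[OF C(1,2)])
      fix a b assume "{a, b} \<in> C - {c}"
      then have "(a, b) \<in> connectivity ?A" using C by (intro connectivity_edge) auto
      then show "connectivity ?A `` {a} = connectivity ?A `` {b}"
        by (simp only: connectivity_class_eq_iff)
    qed (use uv C in auto)
    then have "(u, v) \<in> connectivity ?A" by (simp only: connectivity_class_eq_iff)
    then show ?R using uv cE unfolding closes_cycle_def by blast
  next
    assume ?R
    then obtain e u v where e: "e \<in> E" "e = {u, v}"
      "(u, v) \<in> connectivity {a \<in> F. a \<noteq> e \<and> (a, e) \<in> r}" unfolding closes_cycle_def by blast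
    let ?A = "{a \<in> F. a \<noteq> e \<and> (a, e) \<in> r}"
    obtain xs where xs: "xs \<noteq> []" "hd xs = u" "last xs = v" "distinct xs"
      "successively (\<lambda>a b. (a, b) \<in> {(a, b). {a, b} \<in> ?A}) xs"
      using distinct_path[OF e(3)[unfolded connectivity_def]] by blast
    have "card e = 2" using assms(1) e(1) unfolding simple_edges_def by (metis card_2_iff)
    then have uv: "u \<noteq> v" using e(2) by auto
    have step: "{xs ! i, xs ! Suc i} \<in> ?A" if "Suc i < length xs" for i
      using xs(5) that by (simp add: successively_conv_nth)
    have ends: "xs ! 0 = u" "xs ! (length xs - 1) = v"
      using xs by (auto simp: hd_conv_nth last_conv_nth)
    \<comment> \<open>One vertex is impossible because the ends differ, and a path with two vertices
      would be the edge \<open>e\<close>, which \<open>?A\<close> excludes.\<close>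
    have len: "length xs \<ge> 3"
    proof (rule ccontr)
      assume "\<not> length xs \<ge> 3"
      then have "length xs = 1 \<or> length xs = 2" using xs(1) by (cases "length xs") auto
      then show False
      proof
        assume "length xs = 1"
        then show False using ends uv by simp
      next
        assume len: "length xs = 2"
        then have "{u, v} \<in> ?A" using step[of 0] ends by simp
        then show False using e(2) by simp
      qed
    qed
    define C where "C = {{xs ! i, xs ! (Suc i mod length xs)} | i. i < length xs}"
    have C_mem: "x = e \<or> x \<in> ?A" if x: "x \<in> C" for x
    proof -
      obtain i where i: "i < length xs" "x = {xs ! i, xs ! (Suc i mod length xs)}"
        using x unfolding C_def by blast
      show ?thesis
      proof (cases "Suc i < length xs")
        case True
        then show ?thesis using step[OF True] i by simp
      next
        case False
        then have "Suc i = length xs" using i by simp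
        then have "xs ! i = v" "Suc i mod length xs = 0" using ends(2) by (metis diff_Suc_1, simp)
        then have "x = {v, u}" using i(2) ends(1) by simp
        then show ?thesis using e(2) by (simp add: insert_commute)
      qed
    qed
    have rE: "r \<subseteq> E \<times> E" "(e, e) \<in> r"
      using assms(2) e(1) by (auto simp: order_on_defs refl_on_def)
    have "e = {xs ! (length xs - 1), xs ! (Suc (length xs - 1) mod length xs)}"
    proof -
      have "Suc (length xs - 1) = length xs" using len by simp
      then have "Suc (length xs - 1) mod length xs = 0" by simp
      then show ?thesis unfolding e(2) using ends by (metis insert_commute)
    qed
    moreover have "length xs - 1 < length xs" using len by simp
    ultimately have "e \<in> C" unfolding C_def by blast
    moreover have CE: "C \<subseteq> E" using C_mem e(1) rE(1) by blast
    have "cycle_edges E C"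
      unfolding cycle_edges_def by (intro conjI exI[of _ xs] CE len xs(4)) (rule C_def)
    moreover have "\<forall>a\<in>C. (a, e) \<in> r" "C - {e} \<subseteq> F" using C_mem rE(2) by blast+
    ultimately show ?L by metis
  qed
  then show ?thesis unfolding nbc_set_def by simp
qed

section \<open>Largest edges and the acyclicity of NBC sets\<close>

lemma linear_order_on_Max:
  assumes "linear_order_on E r" "finite C" "C \<noteq> {}" "C \<subseteq> E"
  shows "\<exists>c\<in>C. \<forall>e\<in>C. (e, c) \<in> r"
  using assms(2-4)
proof (induction C rule: finite_ne_induct)
  case (singleton x)
  then show ?case using assms(1) by (auto simp: order_on_defs refl_on_def)
next
  case (insert x C)
  then obtain c where c: "c \<in> C" "\<forall>e\<in>C. (e, c) \<in> r" by auto
  have refl: "(x, x) \<in> r" and tot: "(x, c) \<in> r \<or> (c, x) \<in> r" and tr: "trans r"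
    using assms(1) insert.prems c(1) insert.hyps by (auto simp: order_on_defs refl_on_def total_on_def)
  from tot show ?case
  proof
    assume "(x, c) \<in> r"
    then show ?thesis using c by blast
  next
    assume "(c, x) \<in> r"
    then show ?thesis using c refl tr by (metis insert_iff transD)
  qed
qed

lemma finite_cycle:
  assumes "cycle_edges E C"
  shows "finite C" "C \<noteq> {}"
proof -
  obtain vs where vs: "3 \<le> length vs" "C = {{vs ! i, vs ! (Suc i mod length vs)} | i. i < length vs}"
    using assms by (auto simp: cycle_edges_def)
  then have "C = (\<lambda>i. {vs ! i, vs ! (Suc i mod length vs)}) ` {..<length vs}" by auto
  moreover have "{..<length vs} \<noteq> {}" using vs(1) by (auto simp: lessThan_empty_iff)
  ultimately show "finite C" "C \<noteq> {}" by simp_all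
qed

text \<open>A cycle within \<open>F\<close> would contain its own broken circuit.\<close>

lemma nbc_set_acyclic:
  assumes "linear_order_on E r" "nbc_set E r F"
  shows "\<not> cycle_edges F C"
proof
  assume C: "cycle_edges F C"
  have "F \<subseteq> E" using assms(2) by (simp add: nbc_set_def)
  then have CE: "cycle_edges E C" "C \<subseteq> F" using C by (auto simp: cycle_edges_def)
  then obtain c where "c \<in> C" "\<forall>e\<in>C. (e, c) \<in> r"
    using linear_order_on_Max[OF assms(1), of C] finite_cycle[OF C] \<open>F \<subseteq> E\<close> by auto
  then show False using assms(2) CE unfolding nbc_set_def by blast
qed

text \<open>If \<open>e\<close> lies strictly below \<open>f\<close>, so does the connection that
  bypasses \<open>e\<close>, and connectivity below \<open>f\<close> is the same with and without
  \<open>e\<close>. Otherwise \<open>e\<close> is not among the edges compared with \<open>f\<close>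
  at all.\<close>

lemma closes_cycle_toggle:
  assumes "closes_cycle r A e" "A - {e} = A' - {e}" "antisym r" "trans r"
  shows "closes_cycle r A' f \<longleftrightarrow> closes_cycle r A f"
    and "connectivity A' = connectivity A"
proof -
  obtain u v where uv: "e = {u, v}" "(u, v) \<in> connectivity {a \<in> A. a \<noteq> e \<and> (a, e) \<in> r}"
    using assms(1) unfolding closes_cycle_def by blast
  have toggle: "connectivity S = connectivity S'"
    if "{a \<in> A. a \<noteq> e \<and> (a, e) \<in> r} \<subseteq> S" "S - {e} = S' - {e}" for S S'
  proof (rule connectivity_toggle[OF uv(2)])
    show "{a \<in> A. a \<noteq> e \<and> (a, e) \<in> r} \<subseteq> S - {{u, v}}"
      using that(1) unfolding uv(1)[symmetric] by blast
    show "S - {{u, v}} = S' - {{u, v}}"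
      using that(2) unfolding uv(1)[symmetric] .
  qed
  have "connectivity A = connectivity A'"
    by (rule toggle) (use assms(2) in auto)
  then show "connectivity A' = connectivity A" ..
  have "connectivity {a \<in> A. a \<noteq> f \<and> (a, f) \<in> r} = connectivity {a \<in> A'. a \<noteq> f \<and> (a, f) \<in> r}"
  proof (cases "e \<noteq> f \<and> (e, f) \<in> r")
    case True
    have below: "a \<noteq> f \<and> (a, f) \<in> r" if "a \<noteq> e" "(a, e) \<in> r" for a
      using that True transD[OF assms(4), of a e f] antisymD[OF assms(3), of a e] by blast
    show ?thesis
      by (rule toggle) (use below assms(2) in blast)+
  next
    case False
    then have "{a \<in> A. a \<noteq> f \<and> (a, f) \<in> r} = {a \<in> A'. a \<noteq> f \<and> (a, f) \<in> r}"
      using assms(2) by blast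
    then show ?thesis by simp
  qed
  then show "closes_cycle r A' f \<longleftrightarrow> closes_cycle r A f" unfolding closes_cycle_def by simp
qed

text \<open>The weight enters only through \<open>connectivity A\<close>, since this is what pairs
  of edge sets of opposite sign have in common.\<close>

lemma sum_nbc_sets:
  fixes f :: "nat rel \<Rightarrow> 'b::comm_ring_1"
  assumes "finite E" "simple_edges V E" and r: "linear_order_on E r"
  shows "(\<Sum>A | nbc_set E r A. (- 1) ^ card A * f (connectivity A)) =
    (\<Sum>A\<in>Pow E. (- 1) ^ card A * f (connectivity A))"
proof -
  \<comment> \<open>Toggling the largest bad edge is a sign-reversing involution, as it preserves the bad edges.\<close>
  define bad where "bad A = {e \<in> E. closes_cycle r A e}" for A
  define m where "m A = (SOME c. c \<in> bad A \<and> (\<forall>e\<in>bad A. (e, c) \<in> r))" for A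
  let ?h = "\<lambda>A. (- 1) ^ card A * f (connectivity A)"
  have m: "m A \<in> bad A" if "bad A \<noteq> {}" for A
  proof -
    have "\<exists>c. c \<in> bad A \<and> (\<forall>e\<in>bad A. (e, c) \<in> r)"
      using linear_order_on_Max[OF r, of "bad A"] that \<open>finite E\<close> by (auto simp: bad_def)
    then show ?thesis unfolding m_def by (rule someI2_ex) simp
  qed
  have toggle: "bad A' = bad A \<and> connectivity A' = connectivity A"
    if "bad A \<noteq> {}" "A - {m A} = A' - {m A}" for A A'
  proof -
    have "closes_cycle r A (m A)" using m[OF that(1)] by (simp add: bad_def)
    moreover have "antisym r" "trans r" using r by (simp_all add: order_on_defs)
    ultimately show ?thesis
      using closes_cycle_toggle[of r A "m A" A'] that(2) by (simp add: bad_def)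
  qed
  \<comment> \<open>The chosen edge is a function of \<open>bad A\<close> alone; both members of a
    pair therefore select the same edge, and the toggle undoes itself.\<close>
  have m_cong: "m A' = m A" if "bad A' = bad A" for A A'
    using that by (simp add: m_def)
  let ?S1 = "{A \<in> Pow E. bad A \<noteq> {} \<and> m A \<notin> A}" and ?S2 = "{A \<in> Pow E. bad A \<noteq> {} \<and> m A \<in> A}"
  have mE: "m A \<in> E" if "bad A \<noteq> {}" for A using m[OF that] by (simp add: bad_def)
  have "sum ?h ?S1 = (\<Sum>A\<in>?S2. - ?h A)"
  proof (rule sum.reindex_bij_witness[where i = "\<lambda>A. A - {m A}" and j = "\<lambda>A. insert (m A) A"])
    fix A assume "A \<in> ?S1"
    then have A: "A \<subseteq> E" "bad A \<noteq> {}" "m A \<notin> A" by auto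
    have t: "bad (insert (m A) A) = bad A" "connectivity (insert (m A) A) = connectivity A"
      using toggle[OF A(2), of "insert (m A) A"] by auto
    show "insert (m A) A \<in> ?S2" "insert (m A) A - {m (insert (m A) A)} = A"
      using A t mE m_cong[OF t(1)] by auto
    have "finite A" using A(1) \<open>finite E\<close> by (rule finite_subset)
    then show "- ?h (insert (m A) A) = ?h A" using A(3) t by simp
  next
    fix A assume "A \<in> ?S2"
    then have A: "A \<subseteq> E" "bad A \<noteq> {}" "m A \<in> A" by auto
    have t: "bad (A - {m A}) = bad A" using toggle[OF A(2), of "A - {m A}"] by auto
    show "A - {m A} \<in> ?S1" "insert (m (A - {m A})) (A - {m A}) = A"
      using A t m_cong[OF t] by auto
  qed
  then have zero: "sum ?h ?S1 + sum ?h ?S2 = 0" by (simp add: sum_negf)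
  have Pow_eq: "Pow E = {A. nbc_set E r A} \<union> (?S1 \<union> ?S2)"
    by (auto simp: nbc_set_iff[OF assms(2) r] bad_def)
  have disj: "{A. nbc_set E r A} \<inter> (?S1 \<union> ?S2) = {}"
    by (auto simp: nbc_set_iff[OF assms(2) r] bad_def)
  have fin: "finite {A. nbc_set E r A}"
    by (rule finite_subset[of _ "Pow E"]) (auto simp: nbc_set_def \<open>finite E\<close>)
  have "finite (?S1 \<union> ?S2)" using \<open>finite E\<close> by simp
  from sum.union_disjoint[OF fin this disj, of ?h]
  have "sum ?h (Pow E) = sum ?h {A. nbc_set E r A} + sum ?h (?S1 \<union> ?S2)"
    unfolding Pow_eq[symmetric] .
  also have "sum ?h (?S1 \<union> ?S2) = sum ?h ?S1 + sum ?h ?S2"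
    using \<open>finite E\<close> by (intro sum.union_disjoint) auto
  finally show ?thesis using zero by simp
qed

text \<open>Induction by removing the largest edge: in an NBC set the smaller edges do not connect
  its ends, so restoring it merges exactly two components.\<close>

lemma card_components_nbc_set:
  assumes "simple_edges V E" "finite V" "linear_order_on E r" "nbc_set E r A" "finite A"
  shows "card (components V A) + card A = card V"
  using assms(5,4)
proof (induction "card A" arbitrary: A)
  case 0
  then show ?case by (simp add: components_empty card_image)
next
  case (Suc k)
  have AE: "A \<subseteq> E" using Suc.prems by (simp add: nbc_set_def)
  have "A \<noteq> {}" using Suc.hyps by auto
  then obtain e where e: "e \<in> A" "\<forall>a\<in>A. (a, e) \<in> r"
    using linear_order_on_Max[OF assms(3)] Suc.prems AE by blast
  define B where "B = A - {e}"
  have A: "A = insert e B" "e \<notin> B" using e by (auto simp: B_def)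
  have "e \<in> E" using e(1) AE by blast
  then obtain u v where uv: "u \<in> V" "v \<in> V" "e = {u, v}"
    using assms(1) unfolding simple_edges_def by blast
  have B: "nbc_set E r B" using Suc.prems A unfolding nbc_set_def by blast
  have BV: "simple_edges V B"
    using assms(1) AE A by (auto simp: simple_edges_def)
  have "\<not> closes_cycle r A e"
    using Suc.prems e AE by (auto simp: nbc_set_iff[OF assms(1,3)])
  moreover have "{a \<in> A. a \<noteq> e \<and> (a, e) \<in> r} = B" using e by (auto simp: B_def)
  ultimately have nc: "(u, v) \<notin> connectivity B" using uv(3) unfolding closes_cycle_def by auto
  let ?U = "connectivity B `` {u}" and ?W = "connectivity B `` {v}"
  have UW: "?U \<in> components V B" "?W \<in> components V B" "?U \<noteq> ?W"
    using uv(1,2) nc by (auto simp only: components_def connectivity_class_eq_iff)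
  have fin: "finite (components V B)" using assms(2) by (simp add: components_def)
  have "?U \<union> ?W \<notin> components V B"
  proof
    assume "?U \<union> ?W \<in> components V B"
    then have "?U \<union> ?W = ?U" "?U \<union> ?W = ?W"
      by (rule components_eq_class; simp)+
    then show False using UW(3) by simp
  qed
  then have "card (components V A) = Suc (card (components V B) - 2)"
    unfolding A(1) uv(3) components_insert[OF uv(1,2) BV]
    using fin UW by (simp add: card_Diff_subset)
  moreover have "card (components V B) \<ge> 2"
    using card_mono[OF fin, of "{?U, ?W}"] UW by simp
  moreover have "card (components V B) + card B = card V"
    using Suc A B by auto
  moreover have "card A = Suc (card B)" using A Suc.prems by auto
  ultimately show ?case by simp
qed

section \<open>Forest triples\<close>

text \<open>With the next lemma, this allows a forest triple, a list ordered by smallest vertices,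
  to be handled as the set of its tree triples.\<close>

lemma strict_sorted_key_unique:
  fixes f :: "'a \<Rightarrow> nat"
  assumes "sorted_wrt (\<lambda>a b. f a < f b) xs" "sorted_wrt (\<lambda>a b. f a < f b) ys" "set xs = set ys"
  shows "xs = ys"
proof -
  have srt: "sorted_wrt (<) (map f xs)" "sorted_wrt (<) (map f ys)"
    using assms by (simp_all add: sorted_wrt_map)
  then have "map f xs = map f ys"
    using assms(3) by (intro strict_sorted_equal) auto
  moreover have "inj_on f (set xs)"
    using srt(1) by (simp add: strict_sorted_iff distinct_map)
  ultimately show ?thesis using assms(3) by (intro map_inj_on[of f]) auto
qed

lemma strict_sorted_key_exists:
  fixes f :: "'a \<Rightarrow> nat"
  assumes "finite S" "inj_on f S"
  obtains xs where "set xs = S" "sorted_wrt (\<lambda>a b. f a < f b) xs"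
proof
  let ?xs = "map (inv_into S f) (sorted_list_of_set (f ` S))"
  show "set ?xs = S" using assms by (simp add: inv_into_image_cancel image_comp)
  have "sorted_wrt (<) (sorted_list_of_set (f ` S))" by simp
  then show "sorted_wrt (\<lambda>a b. f a < f b) ?xs"
    unfolding sorted_wrt_map
    by (rule sorted_wrt_mono_rel[rotated]) (use assms(1) in \<open>simp add: f_inv_into_f\<close>)
qed

text \<open>Once the forest \<open>F\<close> and the block \<open>B\<close> are given, the tree is
  determined and only the composition and the mark remain free. \<open>P\<close> stands for the
  conditions of FT.\<close>

definition block_triples ::
    "(tree_triple \<Rightarrow> bool) \<Rightarrow> nat set set \<Rightarrow> nat set \<Rightarrow> tree_triple set" where
  "block_triples P F B = {t. verts t = B \<and> edges t = {e \<in> F. e \<subseteq> B} \<and>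
     composition (card B) (parts t) \<and> 1 \<le> mark t \<and> mark t \<le> hd (parts t) \<and> P t}"

lemma nbc_tree_component:
  assumes E: "simple_edges {1..N} E" and r: "linear_order_on E r"
    and F: "nbc_set E r F" and B: "B \<in> components {1..N} F"
  shows "nbc_tree N E r B {e \<in> F. e \<subseteq> B}"
proof -
  have FE: "F \<subseteq> E" using F by (simp add: nbc_set_def)
  then have FV: "simple_edges {1..N} F" using E by (auto simp: simple_edges_def)
  have part: "partition_on {1..N} (components {1..N} F)"
    by (rule partition_on_components) (rule simple_edges_subset[OF FV])
  let ?F = "{e \<in> F. e \<subseteq> B}"
  have "(u, v) \<in> {(a, b). {a, b} \<in> ?F}\<^sup>*" if "u \<in> B" "v \<in> B" for u v
  proof -
    have Bu: "B = connectivity F `` {u}" by (rule components_eq_class[OF B that(1)])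
    then have "(u, v) \<in> {(a, b). {a, b} \<in> F}\<^sup>*"
      using that(2) by (auto simp: connectivity_def)
    \<comment> \<open>Connectivity in \<open>F\<close> is carried along so that every intermediate
      vertex is known to lie in \<open>B\<close>, which puts each edge of the walk inside the
      block.\<close>
    then have "(u, v) \<in> {(a, b). {a, b} \<in> ?F}\<^sup>* \<and> (u, v) \<in> connectivity F"
    proof (induction rule: rtrancl_induct)
      case base
      then show ?case by simp
    next
      case (step y z)
      have "(y, z) \<in> connectivity F" using step(2) by (intro connectivity_edge) simp
      then have uz: "(u, z) \<in> connectivity F" using step.IH connectivity_trans by metis
      then have "y \<in> B" "z \<in> B" using Bu step.IH by auto
      then have "(y, z) \<in> {(a, b). {a, b} \<in> ?F}" using step(2) by simp
      then show ?case using step.IH uz by (meson rtrancl.rtrancl_into_rtrancl)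
    qed
    then show ?thesis by simp
  qed
  moreover have "\<nexists>C. cycle_edges ?F C"
  proof
    assume "\<exists>C. cycle_edges ?F C"
    then obtain C where "cycle_edges F C" by (auto simp: cycle_edges_def)
    then show False using nbc_set_acyclic[OF r F] by simp
  qed
  moreover have "B \<noteq> {}" "B \<subseteq> {1..N}" using part B unfolding partition_on_def by blast+
  ultimately have "subtree N E B ?F" using FE unfolding subtree_def by blast
  moreover have "?F \<subseteq> F" by blast
  ultimately show ?thesis using F unfolding nbc_tree_def nbc_set_def by (meson order_trans)
qed

lemma forest_triple_distinct:
  assumes "is_forest_triple N E r ts"
  shows "distinct ts" "inj_on verts (set ts)"
proof -
  have "sorted_wrt (<) (map (\<lambda>t. Min (verts t)) ts)"
    using assms by (simp add: is_forest_triple_def sorted_wrt_map)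
  then have "distinct (map (\<lambda>t. Min (verts t)) ts)"
    by (simp add: strict_sorted_iff)
  then have "distinct ts \<and> inj_on (\<lambda>t. Min (verts t)) (set ts)"
    by (simp only: distinct_map)
  then show "distinct ts" and "inj_on verts (set ts)"
    by (rule conjunct1, intro inj_onI) (erule conjE, erule inj_onD, simp_all)
qed

lemma forest_triple_tree:
  assumes "is_forest_triple N E r ts" "t \<in> set ts"
  shows "nbc_tree N E r (verts t) (edges t)" "subtree N E (verts t) (edges t)"
    "is_tree_triple N E r t"
  using assms by (auto simp: is_forest_triple_def is_tree_triple_def nbc_tree_def)

context
  fixes N :: nat and E :: "nat set set" and r :: "nat set rel"
  assumes E: "simple_edges {1..N} E" and r: "linear_order_on E r"
begin

text \<open>The third claim has to exclude broken circuits spread over several trees. A cycle minus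
  an edge is connected, so by \<open>cycle_invariant\<close> all its vertices lie in one tree, whose
  own NBC condition applies.\<close>

lemma forest_triple_edges:
  assumes ts: "is_forest_triple N E r ts"
  defines "F \<equiv> \<Union> (edges ` set ts)"
  shows "components {1..N} F = verts ` set ts"
    and "\<And>t. t \<in> set ts \<Longrightarrow> edges t = {e \<in> F. e \<subseteq> verts t}"
    and "nbc_set E r F"
proof -
  have part: "partition_on {1..N} (verts ` set ts)"
    using ts by (simp add: is_forest_triple_def)
  have edges_sub: "edges t \<subseteq> E" and edge_verts: "\<And>e. e \<in> edges t \<Longrightarrow> e \<subseteq> verts t"
    and conn: "\<And>u v. u \<in> verts t \<Longrightarrow> v \<in> verts t \<Longrightarrow> (u, v) \<in> connectivity (edges t)"
    if "t \<in> set ts" for t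
    using forest_triple_tree(2)[OF ts that] by (simp_all add: subtree_def connectivity_def)
  have FE: "F \<subseteq> E" using edges_sub unfolding F_def by blast
  show comps: "components {1..N} F = verts ` set ts"
  proof (rule components_eqI[OF part])
    fix e assume "e \<in> F"
    then obtain t where "t \<in> set ts" "e \<in> edges t" unfolding F_def by blast
    then show "\<exists>B\<in>verts ` set ts. e \<subseteq> B" using edge_verts by blast
  next
    fix B u v assume "B \<in> verts ` set ts" "u \<in> B" "v \<in> B"
    then obtain t where t: "t \<in> set ts" "u \<in> verts t" "v \<in> verts t" by blast
    then have "(u, v) \<in> connectivity (edges t)" by (intro conn)
    moreover have "edges t \<subseteq> F" using t(1) unfolding F_def by blast
    ultimately show "(u, v) \<in> connectivity F" using connectivity_mono by blast
  qed
  show edges: "edges t = {e \<in> F. e \<subseteq> verts t}" if t: "t \<in> set ts" for t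
  proof (intro equalityI subsetI)
    fix e assume "e \<in> edges t"
    then show "e \<in> {e \<in> F. e \<subseteq> verts t}" using t edge_verts[OF t] unfolding F_def by blast
  next
    fix e assume e: "e \<in> {e \<in> F. e \<subseteq> verts t}"
    then obtain t' where t': "t' \<in> set ts" "e \<in> edges t'" unfolding F_def by blast
    have "e \<in> E" using e FE by blast
    then obtain x where "x \<in> e" using E unfolding simple_edges_def by blast
    then have "x \<in> verts t" "x \<in> verts t'" using e t' edge_verts[OF t'] by blast+
    then have "verts t = verts t'"
      using partition_on_unique[OF part] t t'(1) by blast
    then have "t = t'" using inj_onD[OF forest_triple_distinct(2)[OF ts]] t t'(1) by blast
    then show "e \<in> edges t" using t' by simp
  qed
  show "nbc_set E r F"
    unfolding nbc_set_def
  proof (intro conjI notI FE)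
    assume "\<exists>C c. cycle_edges E C \<and> c \<in> C \<and> (\<forall>e\<in>C. (e, c) \<in> r) \<and> C - {c} \<subseteq> F"
    then obtain C c where C: "cycle_edges E C" "c \<in> C" "\<forall>e\<in>C. (e, c) \<in> r" "C - {c} \<subseteq> F" by blast
    have CE: "C \<subseteq> E" using C(1) by (simp add: cycle_edges_def)
    have "\<exists>x\<in>c. True" using E C(2) CE unfolding simple_edges_def by blast
    then obtain x where x: "x \<in> c" by blast
    then have "x \<in> {1..N}" using simple_edges_subset[OF E] C(2) CE by blast
    then obtain t where t: "t \<in> set ts" "x \<in> verts t" using part unfolding partition_on_def by blast
    have inv: "x \<in> verts t \<longleftrightarrow> y \<in> verts t" if "y \<in> \<Union>C" for y
    proof (rule cycle_invariant[OF C(1,2)])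
      fix a b assume "{a, b} \<in> C - {c}"
      then obtain t' where t': "t' \<in> set ts" "{a, b} \<in> edges t'" using C(4) unfolding F_def by blast
      then have ab: "a \<in> verts t'" "b \<in> verts t'" using edge_verts[OF t'] by blast+
      show "a \<in> verts t \<longleftrightarrow> b \<in> verts t"
        using partition_on_unique[OF part, of "verts t" "verts t'"] t(1) t'(1) ab by blast
    qed (use x C(2) that in auto)
    have "C - {c} \<subseteq> edges t"
    proof
      fix e assume e: "e \<in> C - {c}"
      then have "e \<subseteq> verts t" using inv t(2) by blast
      then show "e \<in> edges t" using e C(4) edges[OF t(1)] by blast
    qed
    then show False
      using forest_triple_tree(1)[OF ts t(1)] C(1-3) unfolding nbc_tree_def by blast
  qed
qed

text \<open>A forest triple amounts to an NBC set together with an independent choice of composition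
  and mark on each component, since \<open>P\<close> tests every tree triple by itself. The product
  of sums is then the distributive law.\<close>

lemma sum_forest_triples:
  fixes w :: "tree_triple \<Rightarrow> 'b::comm_ring_1"
  shows "(\<Sum>ts | is_forest_triple N E r ts \<and> (\<forall>t\<in>set ts. P t). \<Prod>t\<in>set ts. w t) =
    (\<Sum>F | nbc_set E r F. \<Prod>B\<in>components {1..N} F. \<Sum>t\<in>block_triples P F B. w t)"
proof -
  let ?V = "{1..N}"
  let ?lt = "\<lambda>t t' :: tree_triple. Min (verts t) < Min (verts t')"
  let ?S = "SIGMA F:{F. nbc_set E r F}. PiE (components ?V F) (block_triples P F)"
  define j where "j ts = (\<Union> (edges ` set ts),
    \<lambda>B\<in>verts ` set ts. THE t. t \<in> set ts \<and> verts t = B)" for ts :: "tree_triple list"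
  \<comment> \<open>On the pairs in \<open>?S\<close> the choice is determined: disjoint nonempty
    blocks have different minima, so there is exactly one sorted list.\<close>
  define i where "i Fg = (SOME ts. set ts = snd Fg ` components ?V (fst Fg) \<and> sorted_wrt ?lt ts)"
    for Fg :: "nat set set \<times> (nat set \<Rightarrow> tree_triple)"
  have finE: "finite E"
    by (rule finite_subset[of _ "Pow ?V"]) (use simple_edges_subset[OF E] in auto)
  have fin_nbc: "finite {F. nbc_set E r F}"
    by (rule finite_subset[of _ "Pow E"]) (auto simp: nbc_set_def finE)
  have fin_comp: "finite (components ?V F)" for F by (simp add: components_def)
  have fin_block: "finite (block_triples P F B)" for F B
  proof -
    have "block_triples P F B \<subseteq> (\<lambda>(\<alpha>, m). \<lparr>verts = B, edges = {e \<in> F. e \<subseteq> B}, parts = \<alpha>, mark = m\<rparr>) `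
        (SIGMA \<alpha>:{\<alpha>. composition (card B) \<alpha>}. {..hd \<alpha>})"
    proof
      fix t assume "t \<in> block_triples P F B"
      then show "t \<in> (\<lambda>(\<alpha>, m). \<lparr>verts = B, edges = {e \<in> F. e \<subseteq> B}, parts = \<alpha>, mark = m\<rparr>) `
        (SIGMA \<alpha>:{\<alpha>. composition (card B) \<alpha>}. {..hd \<alpha>})"
        by (intro image_eqI[of _ _ "(parts t, mark t)"]) (auto simp: block_triples_def)
    qed
    then show ?thesis by (rule finite_subset) (intro finite_imageI finite_SigmaI finite_compositions finite_atMost)
  qed
  have pick: "(THE t'. t' \<in> S \<and> verts t' = verts t) = t" if "inj_on verts S" "t \<in> S" for S t
    using that by (intro the_equality) (auto dest: inj_onD)
  have i_props: "set (i (F, g)) = g ` components ?V F" "sorted_wrt ?lt (i (F, g))"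
      "inj_on verts (g ` components ?V F)" "verts ` g ` components ?V F = components ?V F"
      "is_forest_triple N E r (i (F, g))" "\<forall>t\<in>set (i (F, g)). P t"
      "\<Union> (edges ` g ` components ?V F) = F"
    if "(F, g) \<in> ?S" for F g
  proof -
    let ?C = "components ?V F"
    have F: "nbc_set E r F" and g: "\<And>B. B \<in> ?C \<Longrightarrow> g B \<in> block_triples P F B"
      using that by auto
    have verts_g: "verts (g B) = B" if "B \<in> ?C" for B
      using g[OF that] by (simp add: block_triples_def)
    have FV: "simple_edges ?V F" using F E by (auto simp: nbc_set_def simple_edges_def)
    have part: "partition_on ?V ?C"
      by (rule partition_on_components) (rule simple_edges_subset[OF FV])
    show inj: "inj_on verts (g ` ?C)" by (rule inj_onI) (use verts_g in auto)
    show vg: "verts ` g ` ?C = ?C" using verts_g by (auto simp: image_image)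
    have Min_in: "Min B \<in> B" if "B \<in> ?C" for B
    proof (rule Min_in)
      have "B \<subseteq> ?V" using that part unfolding partition_on_def by blast
      then show "finite B" by (rule finite_subset) simp
      show "B \<noteq> {}" using that part unfolding partition_on_def by blast
    qed
    have inj_Min: "inj_on (\<lambda>t. Min (verts t)) (g ` ?C)"
    proof (rule inj_onI)
      fix t t' assume t: "t \<in> g ` ?C" "t' \<in> g ` ?C" "Min (verts t) = Min (verts t')"
      have "verts t = verts t'"
      proof -
        have in_C: "verts t \<in> ?C" "verts t' \<in> ?C" using t(1,2) vg by blast+
        then have "Min (verts t) \<in> verts t" "Min (verts t) \<in> verts t'"
          using Min_in[OF in_C(1)] Min_in[OF in_C(2)] t(3) by simp_all
        then show ?thesis by (rule partition_on_unique[OF part in_C])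
      qed
      then show "t = t'" by (rule inj_onD[OF inj _ t(1,2)])
    qed
    obtain xs where "set xs = g ` ?C" "sorted_wrt ?lt xs"
      by (rule strict_sorted_key_exists[OF finite_imageI[OF fin_comp] inj_Min])
    then have "\<exists>ts. set ts = g ` ?C \<and> sorted_wrt ?lt ts" by blast
    from someI_ex[OF this] have "set (i (F, g)) = g ` ?C \<and> sorted_wrt ?lt (i (F, g))"
      unfolding i_def fst_conv snd_conv .
    then show i: "set (i (F, g)) = g ` ?C" "sorted_wrt ?lt (i (F, g))" by simp_all
    have "is_tree_triple N E r (g B)" if "B \<in> ?C" for B
      using g[OF that] nbc_tree_component[OF E r F that]
      unfolding is_tree_triple_def block_triples_def by simp
    then show "is_forest_triple N E r (i (F, g))"
      unfolding is_forest_triple_def set_map using i vg part by simp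
    show "\<forall>t\<in>set (i (F, g)). P t" using g i(1) by (auto simp: block_triples_def)
    have "edges (g B) = {e \<in> F. e \<subseteq> B}" if "B \<in> ?C" for B
      using g[OF that] by (simp add: block_triples_def)
    moreover have "\<exists>B\<in>?C. e \<subseteq> B" if "e \<in> F" for e
      by (rule edge_in_component[OF FV that])
    ultimately show "\<Union> (edges ` g ` ?C) = F" by auto
  qed
  have "(\<Sum>ts | is_forest_triple N E r ts \<and> (\<forall>t\<in>set ts. P t). \<Prod>t\<in>set ts. w t) =
      (\<Sum>(F, g)\<in>?S. \<Prod>B\<in>components ?V F. w (g B))"
  proof (rule sum.reindex_bij_witness[where i = i and j = j])
    fix ts assume "ts \<in> {ts. is_forest_triple N E r ts \<and> (\<forall>t\<in>set ts. P t)}"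
    then have ts: "is_forest_triple N E r ts" and P: "\<And>t. t \<in> set ts \<Longrightarrow> P t" by auto
    note edges = forest_triple_edges[OF ts] and inj = forest_triple_distinct(2)[OF ts]
    let ?F = "\<Union> (edges ` set ts)" and ?g = "\<lambda>B\<in>verts ` set ts. THE t. t \<in> set ts \<and> verts t = B"
    have g: "?g (verts t) = t" if "t \<in> set ts" for t
      using pick[OF inj that] that by simp
    have mem: "t \<in> block_triples P ?F (verts t)" if "t \<in> set ts" for t
      using forest_triple_tree(3)[OF ts that] edges(2)[OF that] P[OF that]
      by (simp add: block_triples_def is_tree_triple_def)
    have "?g \<in> PiE (verts ` set ts) (block_triples P ?F)"
    proof (rule PiE_I)
      fix B assume "B \<in> verts ` set ts"
      then obtain t where "t \<in> set ts" "B = verts t" by blast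
      then show "?g B \<in> block_triples P ?F B" using g mem by simp
    qed simp
    then show jS: "j ts \<in> ?S" using edges(1,3) by (simp add: j_def)
    have g_img: "?g ` verts ` set ts = set ts"
      unfolding image_image using g by (simp cong: image_cong)
    have mem_S: "(?F, ?g) \<in> ?S" using jS unfolding j_def .
    show "i (j ts) = ts"
    proof (rule strict_sorted_key_unique[where f = "\<lambda>t. Min (verts t)"])
      show "sorted_wrt ?lt (i (j ts))" unfolding j_def by (rule i_props(2)[OF mem_S])
      show "sorted_wrt ?lt ts" using ts by (simp add: is_forest_triple_def)
      show "set (i (j ts)) = set ts" unfolding j_def i_props(1)[OF mem_S] edges(1) g_img ..
    qed
    have "(\<Prod>B\<in>verts ` set ts. w (?g B)) = (\<Prod>t\<in>set ts. w (?g (verts t)))"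
      unfolding prod.reindex[OF inj] comp_def ..
    also have "\<dots> = (\<Prod>t\<in>set ts. w t)" by (rule prod.cong[OF refl]) (simp only: g)
    finally show "(case j ts of (F, g) \<Rightarrow> \<Prod>B\<in>components ?V F. w (g B)) = (\<Prod>t\<in>set ts. w t)"
      unfolding j_def prod.case edges(1) .
  next
    fix Fg assume "Fg \<in> ?S"
    then obtain F g where Fg: "Fg = (F, g)" "(F, g) \<in> ?S" by (cases Fg) auto
    note ip = i_props[OF Fg(2)]
    show "i Fg \<in> {ts. is_forest_triple N E r ts \<and> (\<forall>t\<in>set ts. P t)}"
      using ip(5,6) Fg(1) by simp
    have gP: "g \<in> PiE (components ?V F) (block_triples P F)" using Fg(2) by simp
    have "(\<lambda>B\<in>components ?V F. THE t. t \<in> g ` components ?V F \<and> verts t = B) = g"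
    proof (rule ext)
      fix B
      show "(\<lambda>B\<in>components ?V F. THE t. t \<in> g ` components ?V F \<and> verts t = B) B = g B"
      proof (cases "B \<in> components ?V F")
        case True
        from PiE_mem[OF gP True] have "verts (g B) = B" by (simp add: block_triples_def)
        with pick[OF ip(3) imageI[OF True]]
        have "(THE t. t \<in> g ` components ?V F \<and> verts t = B) = g B" by (simp only:)
        then show ?thesis by (simp only: restrict_apply if_P[OF True])
      next
        case False
        then show ?thesis using PiE_arb[OF gP False] by simp
      qed
    qed
    then show "j (i Fg) = Fg"
      unfolding j_def Fg(1) ip(1) ip(4) ip(7) by (simp only:)
  qed
  also have "\<dots> = (\<Sum>F | nbc_set E r F. \<Sum>g\<in>PiE (components ?V F) (block_triples P F).
      \<Prod>B\<in>components ?V F. w (g B))"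
    by (rule sum.Sigma[symmetric]) (simp_all only: fin_nbc fin_comp fin_block finite_PiE ball_simps simp_thms)
  also have "\<dots> = (\<Sum>F | nbc_set E r F. \<Prod>B\<in>components ?V F. \<Sum>t\<in>block_triples P F B. w t)"
    by (intro sum.cong refl prod_sum_PiE[symmetric] fin_comp fin_block)
  finally show ?thesis .
qed

end

section \<open>The diagonal of the matrix\<close>

text \<open>The part that \<open>ft_type'\<close> discards belongs to the tree with vertex 1.
  Charging the loss to this tree makes the weight of a forest triple multiplicative.\<close>

definition triple_weight :: "tree_triple \<Rightarrow> pseries" where
  "triple_weight t = (- 1) ^ (length (parts t) - 1) *
     elem_part (mset (if 1 \<in> verts t then tl (parts t) else parts t))"

lemma ft_sign_conv_prod:
  assumes "distinct ts"
  shows "ft_sign ts = (\<Prod>t\<in>set ts. (- 1) ^ (length (parts t) - 1))"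
  using assms by (induction ts) (simp_all add: ft_sign_def power_add)

lemma elem_part_ft_type:
  assumes "distinct ts"
  shows "elem_part (ft_type ts) = (\<Prod>t\<in>set ts. elem_part (mset (parts t)))"
  using assms by (induction ts) (simp_all add: ft_type_def elem_part_plus)

lemma forest_triple_inj_vertex:
  assumes "is_forest_triple N E r ts" "t \<in> set ts" "t' \<in> set ts" "v \<in> verts t" "v \<in> verts t'"
  shows "t = t'"
proof -
  have part: "partition_on {1..N} (verts ` set ts)"
    using assms(1) by (simp add: is_forest_triple_def)
  have "verts t = verts t'"
    by (rule partition_on_unique[OF part _ _ assms(4,5)]) (use assms in auto)
  then show ?thesis
    by (rule inj_onD[OF forest_triple_distinct(2)[OF assms(1)] _ assms(2,3)])
qed

lemma forest_triple_ex_vertex: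
  assumes "is_forest_triple N E r ts" "v \<in> {1..N}"
  shows "\<exists>t\<in>set ts. v \<in> verts t"
proof -
  have "\<Union> (verts ` set ts) = {1..N}"
    using assms(1) by (simp add: is_forest_triple_def partition_on_def)
  then show ?thesis using assms(2) by blast
qed

lemma forest_triple_weight:
  assumes ts: "is_forest_triple N E r ts" and N: "N \<ge> 1"
  shows "ft_sign ts * elem_part (ft_type' ts) = (\<Prod>t\<in>set ts. triple_weight t)"
proof -
  obtain t where t: "t \<in> set ts" "1 \<in> verts t"
    using forest_triple_ex_vertex[OF ts, of 1] N by auto
  then obtain t0 ts' where ts_eq: "ts = t0 # ts'" by (cases ts) auto
  have sub: "verts u \<subseteq> {1..N}" "verts u \<noteq> {}" if "u \<in> set ts" for u
    using ts that by (auto simp: is_forest_triple_def is_tree_triple_def nbc_tree_def subtree_def)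
  \<comment> \<open>\<open>ft_type'\<close> refers to the head of the list. If the tree with 1 were
    not the head, the head would have minimum 0, outside the vertex set.\<close>
  have "t = t0"
  proof (rule ccontr)
    assume "t \<noteq> t0"
    then have "t \<in> set ts'" using t ts_eq by simp
    then have "Min (verts t0) < Min (verts t)"
      using ts ts_eq by (simp add: is_forest_triple_def)
    also have "Min (verts t) \<le> 1"
      using t sub[OF t(1)] by (intro Min_le finite_subset[of "verts t" "{1..N}"]) auto
    finally have "Min (verts t0) = 0" by simp
    moreover have "Min (verts t0) \<in> verts t0"
      using sub[of t0] ts_eq by (intro Min_in finite_subset[of "verts t0" "{1..N}"]) auto
    moreover have "verts t0 \<subseteq> {1..N}" using sub ts_eq by simp
    ultimately show False by auto
  qed
  then have t0: "1 \<in> verts t0" using t by simp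
  have dist: "distinct ts" by (rule forest_triple_distinct(1)[OF ts])
  then have t0_notin: "t0 \<notin> set ts'" "distinct ts'" using ts_eq by auto
  have others: "1 \<notin> verts u" if "u \<in> set ts'" for u
    using forest_triple_inj_vertex[OF ts, of u t0 1] that t0 t0_notin ts_eq by auto
  have "is_tree_triple N E r t0" using ts ts_eq by (simp add: is_forest_triple_def)
  then have "composition (card (verts t0)) (parts t0)" by (simp add: is_tree_triple_def)
  moreover have "card (verts t0) > 0"
    using sub[of t0] ts_eq by (auto simp: card_gt_0_iff intro: finite_subset)
  ultimately have "parts t0 \<noteq> []" by auto
  then have "mset (parts t0) = add_mset (hd (parts t0)) (mset (tl (parts t0)))"
    by (cases "parts t0") simp_all
  then have "ft_type' ts = mset (tl (parts t0)) + ft_type ts'"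
    by (simp add: ft_type'_def ft_type_def ts_eq)
  then have type': "elem_part (ft_type' ts) =
      elem_part (mset (tl (parts t0))) * (\<Prod>t\<in>set ts'. elem_part (mset (parts t)))"
    by (simp add: elem_part_plus elem_part_ft_type t0_notin)
  have prod': "(\<Prod>t\<in>set ts'. triple_weight t) =
      (\<Prod>t\<in>set ts'. (- 1) ^ (length (parts t) - 1)) * (\<Prod>t\<in>set ts'. elem_part (mset (parts t)))"
    unfolding prod.distrib[symmetric] triple_weight_def
    by (rule prod.cong[OF refl]) (use others in simp)
  have "(\<Prod>t\<in>set ts. triple_weight t) = triple_weight t0 * (\<Prod>t\<in>set ts'. triple_weight t)"
    unfolding ts_eq using t0_notin by simp
  also have "\<dots> = ft_sign ts * elem_part (ft_type' ts)"
    unfolding prod' type' ft_sign_conv_prod[OF dist] unfolding ts_eq triple_weight_def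
    using t0 t0_notin by (simp add: mult_ac)
  finally show ?thesis ..
qed

text \<open>Exactly one tree contains a given vertex, so the existential conditions of
  \<open>FT\<close> can be imposed on every tree as implications. This is the form that splits over
  the components.\<close>

definition FT_cond :: "nat \<Rightarrow> nat \<Rightarrow> nat \<Rightarrow> tree_triple \<Rightarrow> bool" where
  "FT_cond n i j t \<longleftrightarrow> (1 \<in> verts t \<longrightarrow> hd (parts t) = i \<and> mark t = 1) \<and>
     (n \<in> verts t \<longrightarrow> {n..n + j - 1} \<subseteq> verts t \<and> j \<le> last (parts t))"

lemma FT_eq:
  assumes "n \<ge> 1" "j \<ge> 1"
  shows "FT n E r i j = {ts. is_forest_triple (n + j - 1) (plus_edges n E (path_edges j)) r ts \<and>
    (\<forall>t\<in>set ts. FT_cond n i j t)}"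
proof -
  have "(\<exists>t\<in>set ts. 1 \<in> verts t \<and> hd (parts t) = i \<and> mark t = 1) \<and>
      (\<exists>t'\<in>set ts. n \<in> verts t' \<and> {n..n + j - 1} \<subseteq> verts t' \<and> j \<le> last (parts t')) \<longleftrightarrow>
      (\<forall>t\<in>set ts. FT_cond n i j t)"
    if ts: "is_forest_triple (n + j - 1) (plus_edges n E (path_edges j)) r ts" for ts
  proof -
    have range: "1 \<in> {1..n + j - 1}" "n \<in> {1..n + j - 1}" using assms by auto
    have ex_all: "(\<exists>t\<in>set ts. v \<in> verts t \<and> Q t) \<longleftrightarrow> (\<forall>t\<in>set ts. v \<in> verts t \<longrightarrow> Q t)"
      if v: "v \<in> {1..n + j - 1}" for v Q
    proof -
      obtain t where t: "t \<in> set ts" "v \<in> verts t"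
        using forest_triple_ex_vertex[OF ts v] by blast
      have "u = t" if "u \<in> set ts" "v \<in> verts u" for u
        by (rule forest_triple_inj_vertex[OF ts that(1) t(1) that(2) t(2)])
      then show ?thesis using t by blast
    qed
    show ?thesis
      unfolding ex_all[OF range(1)] ex_all[OF range(2)] FT_cond_def by blast
  qed
  then show ?thesis unfolding FT_def by blast
qed

text \<open>The factor \<open>of_nat\<close> counts the possible marks of the tree.\<close>

definition block_weight :: "nat \<Rightarrow> nat \<Rightarrow> nat set \<Rightarrow> pseries" where
  "block_weight n k B = (\<Sum>\<alpha> | composition (card B) \<alpha>.
     if (1 \<in> B \<longrightarrow> hd \<alpha> = k) \<and> (n \<in> B \<longrightarrow> {n..n + k - 1} \<subseteq> B \<and> k \<le> last \<alpha>)
     then of_nat (if 1 \<in> B then 1 else hd \<alpha>) *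
       ((- 1) ^ (length \<alpha> - 1) * elem_part (mset (if 1 \<in> B then tl \<alpha> else \<alpha>)))
     else 0)"

lemma sum_block_triples:
  assumes "finite B" "B \<noteq> {}"
  shows "(\<Sum>t\<in>block_triples (FT_cond n k k) F B. triple_weight t) = block_weight n k B"
proof -
  define cond where "cond \<alpha> \<longleftrightarrow> (1 \<in> B \<longrightarrow> hd \<alpha> = k) \<and> (n \<in> B \<longrightarrow> {n..n + k - 1} \<subseteq> B \<and> k \<le> last \<alpha>)" for \<alpha>
  define M where "M \<alpha> = {m \<in> {1..hd \<alpha>}. 1 \<in> B \<longrightarrow> m = 1}" for \<alpha> :: "nat list"
  define w where "w \<alpha> = (- 1) ^ (length \<alpha> - 1) * elem_part (mset (if 1 \<in> B then tl \<alpha> else \<alpha>))" for \<alpha>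
  have "(\<Sum>t\<in>block_triples (FT_cond n k k) F B. triple_weight t) =
      (\<Sum>(\<alpha>, m)\<in>(SIGMA \<alpha>:{\<alpha>. composition (card B) \<alpha> \<and> cond \<alpha>}. M \<alpha>). w \<alpha>)"
    by (rule sum.reindex_bij_witness
        [where i = "\<lambda>(\<alpha>, m). \<lparr>verts = B, edges = {e \<in> F. e \<subseteq> B}, parts = \<alpha>, mark = m\<rparr>"
          and j = "\<lambda>t. (parts t, mark t)"])
       (auto simp: block_triples_def FT_cond_def cond_def M_def w_def triple_weight_def)
  also have "\<dots> = (\<Sum>\<alpha> | composition (card B) \<alpha> \<and> cond \<alpha>. \<Sum>m\<in>M \<alpha>. w \<alpha>)"
    by (rule sum.Sigma[symmetric]) (simp_all add: M_def)
  also have "\<dots> = (\<Sum>\<alpha> | composition (card B) \<alpha> \<and> cond \<alpha>. of_nat (if 1 \<in> B then 1 else hd \<alpha>) * w \<alpha>)"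
  proof (rule sum.cong)
    fix \<alpha> assume "\<alpha> \<in> {\<alpha>. composition (card B) \<alpha> \<and> cond \<alpha>}"
    then obtain a \<beta> where "\<alpha> = a # \<beta>" "a \<ge> 1"
      using assms by (cases \<alpha>) (auto simp: composition_Cons)
    \<comment> \<open>\<open>a \<ge> 1\<close> makes the mark 1 available when it is
      prescribed.\<close>
    then have "M \<alpha> = (if 1 \<in> B then {1} else {1..hd \<alpha>})" by (auto simp: M_def)
    then show "(\<Sum>m\<in>M \<alpha>. w \<alpha>) = of_nat (if 1 \<in> B then 1 else hd \<alpha>) * w \<alpha>" by simp
  qed simp
  also have "\<dots> = (\<Sum>\<alpha>\<in>{\<alpha> \<in> {\<alpha>. composition (card B) \<alpha>}. cond \<alpha>}. of_nat (if 1 \<in> B then 1 else hd \<alpha>) * w \<alpha>)"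
    by (simp only: mem_Collect_eq)
  also have "\<dots> = block_weight n k B"
    unfolding block_weight_def sum.inter_filter[OF finite_compositions] cond_def w_def ..
  finally show ?thesis .
qed

section \<open>The diagonal entry as a sum over all edge sets of G + P_k\<close>

lemma simple_edges_graph_on:
  assumes "graph_on n E"
  shows "simple_edges {1..n} E"
  unfolding simple_edges_def
proof
  fix e assume "e \<in> E"
  then obtain u v where "e = {u, v}" "1 \<le> u" "u < v" "v \<le> n"
    using assms unfolding graph_on_def by blast
  then show "\<exists>u v. u \<in> {1..n} \<and> v \<in> {1..n} \<and> u \<noteq> v \<and> e = {u, v}"
    by (intro exI[of _ u] exI[of _ v]) auto
qed

lemma plus_path_edges:
  assumes "n \<ge> 1"
  shows "plus_edges n E (path_edges j) = E \<union> (\<lambda>i. {n + i - 1, n + i}) ` {1..<j}"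
proof -
  have "{{i + n - 1, i' + n - 1} | i i'. {i, i'} \<in> path_edges j} = (\<lambda>i. {n + i - 1, n + i}) ` {1..<j}"
    (is "?L = ?R")
  proof (intro equalityI subsetI)
    fix e assume "e \<in> ?L"
    then obtain a b i where "e = {a + n - 1, b + n - 1}" "{a, b} = {i, i + 1}" "1 \<le> i" "i < j"
      unfolding path_edges_def by auto
    then have "e = {n + i - 1, n + i}" using assms by (auto simp: doubleton_eq_iff)
    then show "e \<in> ?R" using \<open>1 \<le> i\<close> \<open>i < j\<close> by auto
  next
    fix e assume "e \<in> ?R"
    then obtain i where i: "1 \<le> i" "i < j" "e = {n + i - 1, n + i}" by auto
    then have "{i, i + 1} \<in> path_edges j" unfolding path_edges_def by blast
    moreover have "e = {i + n - 1, (i + 1) + n - 1}" using i assms by (simp add: add.commute)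
    ultimately show "e \<in> ?L" by blast
  qed
  then show ?thesis unfolding plus_edges_def by simp
qed

lemma simple_edges_plus_path:
  assumes "n \<ge> 1" "graph_on n E" "j \<ge> 1"
  shows "simple_edges {1..n + j - 1} (plus_edges n E (path_edges j))"
  unfolding simple_edges_def plus_path_edges[OF assms(1)]
proof
  fix e assume "e \<in> E \<union> (\<lambda>i. {n + i - 1, n + i}) ` {1..<j}"
  then show "\<exists>u v. u \<in> {1..n + j - 1} \<and> v \<in> {1..n + j - 1} \<and> u \<noteq> v \<and> e = {u, v}"
  proof
    assume "e \<in> E"
    then obtain u v where "e = {u, v}" "1 \<le> u" "u < v" "v \<le> n"
      using assms(2) unfolding graph_on_def by blast
    then show ?thesis using assms by (intro exI[of _ u] exI[of _ v]) auto
  next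
    assume "e \<in> (\<lambda>i. {n + i - 1, n + i}) ` {1..<j}"
    then obtain i where "1 \<le> i" "i < j" "e = {n + i - 1, n + i}" by auto
    then show ?thesis using assms by (intro exI[of _ "n + i - 1"] exI[of _ "n + i"]) auto
  qed
qed

text \<open>The factor supplies the sign for Whitney's sum: over the components of an NBC set
  \<open>F\<close> it multiplies to \<open>(- 1) ^ card F\<close>, so a second such power
  compensates it.\<close>

definition signed_block :: "nat \<Rightarrow> nat \<Rightarrow> nat set \<Rightarrow> pseries" where
  "signed_block n k B = (- 1) ^ (card B - 1) * block_weight n k B"

lemma minus_one_power_mult_self: "(- 1) ^ k * (- 1) ^ k = (1 :: 'a :: comm_ring_1)"
  by (simp flip: power_mult_distrib)

lemma F_mat_conv_sum_subsets:
  assumes "n \<ge> 1" "graph_on n E" "k \<ge> 1"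
    and ord: "linear_order_on (plus_edges n E (path_edges k)) (ord k)"
  shows "F_mat n E ord k k = (\<Sum>A\<in>Pow (plus_edges n E (path_edges k)).
    (- 1) ^ card A * (\<Prod>B\<in>components {1..n + k - 1} A. signed_block n k B))"
proof -
  let ?E = "plus_edges n E (path_edges k)" and ?V = "{1..n + k - 1}"
  note simple = simple_edges_plus_path[OF assms(1-3)]
  have finE: "finite ?E"
    by (rule finite_subset[of _ "Pow ?V"]) (use simple_edges_subset[OF simple] in auto)
  \<comment> \<open>The product expressed through the relation alone, as \<open>sum_nbc_sets\<close>
    requires.\<close>
  define h where "h R = (\<Prod>B\<in>(\<lambda>v. R `` {v}) ` ?V. signed_block n k B)" for R :: "nat rel"
  have h: "(\<Prod>B\<in>components ?V A. signed_block n k B) = h (connectivity A)" for A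
    unfolding h_def components_def ..
  have "F_mat n E ord k k = (\<Sum>ts\<in>FT n E (ord k) k k. \<Prod>t\<in>set ts. triple_weight t)"
    unfolding F_mat_def
  proof (rule sum.cong[OF refl])
    fix ts assume "ts \<in> FT n E (ord k) k k"
    then have "is_forest_triple (n + k - 1) ?E (ord k) ts" by (simp add: FT_def)
    then show "ft_sign ts * elem_part (ft_type' ts) = (\<Prod>t\<in>set ts. triple_weight t)"
      by (rule forest_triple_weight) (use assms in simp)
  qed
  also have "\<dots> = (\<Sum>F | nbc_set ?E (ord k) F. \<Prod>B\<in>components ?V F.
      \<Sum>t\<in>block_triples (FT_cond n k k) F B. triple_weight t)"
    unfolding FT_eq[OF assms(1,3)] by (rule sum_forest_triples[OF simple ord])
  also have "\<dots> = (\<Sum>F | nbc_set ?E (ord k) F. (- 1) ^ card F * h (connectivity F))"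
  proof (rule sum.cong[OF refl])
    fix F assume "F \<in> {F. nbc_set ?E (ord k) F}"
    then have F: "nbc_set ?E (ord k) F" by simp
    have FE: "F \<subseteq> ?E" using F by (simp add: nbc_set_def)
    have finF: "finite F" by (rule finite_subset[OF FE finE])
    have "simple_edges ?V F" using simple FE unfolding simple_edges_def by blast
    then have part: "partition_on ?V (components ?V F)"
      by (intro partition_on_components) (rule simple_edges_subset)
    have block: "finite B" "B \<noteq> {}" if "B \<in> components ?V F" for B
    proof -
      have "B \<subseteq> ?V" using that part unfolding partition_on_def by blast
      then show "finite B" by (rule finite_subset) simp
      show "B \<noteq> {}" using that part unfolding partition_on_def by blast
    qed
    have fin: "finite (components ?V F)" by (simp add: components_def)
    \<comment> \<open>The edges of a forest are counted by |B| - 1 summed over its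
      components.\<close>
    have "card ?V = (\<Sum>B\<in>components ?V F. card B)"
      by (rule product_partition[OF part block(1)])
    also have "\<dots> = (\<Sum>B\<in>components ?V F. (card B - 1) + 1)"
    proof (rule sum.cong[OF refl])
      fix B assume "B \<in> components ?V F"
      then show "card B = card B - 1 + 1" using block[of B] by (simp add: Suc_le_eq card_gt_0_iff)
    qed
    also have "\<dots> = (\<Sum>B\<in>components ?V F. card B - 1) + card (components ?V F)"
      by (simp only: sum.distrib card_eq_sum)
    finally have "(\<Sum>B\<in>components ?V F. card B - 1) = card F"
      using card_components_nbc_set[OF simple _ ord F finF] by simp
    then have sgn: "(\<Prod>B\<in>components ?V F. (- 1) ^ (card B - 1)) = ((- 1) ^ card F :: pseries)"
      by (simp flip: power_sum)
    have "(\<Prod>B\<in>components ?V F. \<Sum>t\<in>block_triples (FT_cond n k k) F B. triple_weight t) =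
        (\<Prod>B\<in>components ?V F. block_weight n k B)"
      by (rule prod.cong[OF refl], rule sum_block_triples, erule block(1), erule block(2))
    also have "\<dots> = (- 1) ^ card F * (\<Prod>B\<in>components ?V F. signed_block n k B)"
      unfolding signed_block_def prod.distrib sgn mult.assoc[symmetric] minus_one_power_mult_self by simp
    finally show "(\<Prod>B\<in>components ?V F. \<Sum>t\<in>block_triples (FT_cond n k k) F B. triple_weight t) =
        (- 1) ^ card F * h (connectivity F)" unfolding h .
  qed
  also have "\<dots> = (\<Sum>A\<in>Pow ?E. (- 1) ^ card A * h (connectivity A))"
    by (rule sum_nbc_sets[OF finE simple ord])
  finally show ?thesis unfolding h .
qed

section \<open>Reduction to edge sets of G\<close>

definition extend_path :: "nat \<Rightarrow> nat \<Rightarrow> nat set \<Rightarrow> nat set" where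
  "extend_path n k B = (if n \<in> B then B \<union> {n..n + k - 1} else B)"

definition path_part :: "nat \<Rightarrow> nat \<Rightarrow> nat set set" where
  "path_part n k = (\<lambda>i. {n + i - 1, n + i}) ` {1..<k}"

lemma components_block:
  assumes "simple_edges {1..n :: nat} A" "B \<in> components {1..n} A"
  shows "B \<subseteq> {1..n}" "finite B" "B \<noteq> {}"
proof -
  have part: "partition_on {1..n} (components {1..n} A)"
    by (rule partition_on_components) (rule simple_edges_subset[OF assms(1)])
  then show "B \<subseteq> {1..n}" "B \<noteq> {}" using assms(2) unfolding partition_on_def by blast+
  then show "finite B" using finite_subset[of B "{1..n}"] by simp
qed

text \<open>The path meets [n] only in n, so it enlarges one component and leaves the others alone;
  intersecting with \<open>{1..n}\<close> recovers the original component.\<close>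

lemma components_with_path:
  assumes n: "n \<ge> 1" and k: "k \<ge> 1" and A: "simple_edges {1..n} A"
  shows "components {1..n + k - 1} (A \<union> path_part n k) = extend_path n k ` components {1..n} A"
    and "inj_on (extend_path n k) (components {1..n} A)"
proof -
  let ?C = "components {1..n} A" and ?ext = "extend_path n k" and ?A = "A \<union> path_part n k"
  have part: "partition_on {1..n} ?C"
    by (rule partition_on_components) (rule simple_edges_subset[OF A])
  note block = components_block[OF A]
  have ext_Int: "?ext B \<inter> {1..n} = B" if "B \<in> ?C" for B
    using block(1)[OF that] by (auto simp: extend_path_def)
  then show "inj_on ?ext ?C" by (rule inj_on_inverseI[where g = "\<lambda>B. B \<inter> {1..n}"])
  have un: "\<Union>?C = {1..n}" using part by (simp add: partition_on_def)
  moreover have "n \<in> {1..n}" using n by simp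
  ultimately obtain B0 where B0: "B0 \<in> ?C" "n \<in> B0" by blast
  show "components {1..n + k - 1} ?A = ?ext ` ?C"
  proof (rule components_eqI)
    show "partition_on {1..n + k - 1} (?ext ` ?C)"
    proof (rule partition_onI)
      show "\<Union> (?ext ` ?C) = {1..n + k - 1}"
      proof (intro equalityI subsetI)
        fix x assume "x \<in> \<Union> (?ext ` ?C)"
        then obtain B where "B \<in> ?C" "x \<in> ?ext B" by blast
        moreover have "?ext B \<subseteq> B \<union> {n..n + k - 1}" by (auto simp: extend_path_def)
        moreover have "B \<subseteq> {1..n}" by (rule block(1)) fact
        ultimately have "x \<in> {1..n} \<union> {n..n + k - 1}" by blast
        then show "x \<in> {1..n + k - 1}" using n k by auto
      next
        fix x assume x: "x \<in> {1..n + k - 1}"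
        show "x \<in> \<Union> (?ext ` ?C)"
        proof (cases "x \<le> n")
          case True
          then have "x \<in> \<Union>?C" using x un by simp
          then obtain B where "B \<in> ?C" "x \<in> B" by blast
          moreover have "B \<subseteq> ?ext B" by (auto simp: extend_path_def)
          ultimately show ?thesis by blast
        next
          case False
          then have "x \<in> ?ext B0" using x B0 by (simp add: extend_path_def)
          then show ?thesis using B0(1) by blast
        qed
      qed
      show "{} \<notin> ?ext ` ?C"
      proof
        assume "{} \<in> ?ext ` ?C"
        then obtain B where "B \<in> ?C" "?ext B = {}" by auto
        then show False using ext_Int[of B] block(3)[of B] by simp
      qed
      fix p q assume "p \<in> ?ext ` ?C" "q \<in> ?ext ` ?C" "p \<noteq> q"
      then obtain B B' where B: "B \<in> ?C" "B' \<in> ?C" "p = ?ext B" "q = ?ext B'" "B \<noteq> B'" by blast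
      have disj: "x \<notin> B'" if "x \<in> B" for x
        using partition_on_unique[OF part B(1,2) that] B(5) by blast
      show "disjnt p q"
        unfolding disjnt_iff
      proof (intro allI notI)
        fix x assume x: "x \<in> p \<and> x \<in> q"
        show False
        proof (cases "x \<le> n")
          case True
          then have "x \<in> {n..n + k - 1} \<Longrightarrow> x = n" by simp
          then have "x \<in> B" "x \<in> B'"
            using x unfolding B(3,4) extend_path_def by (auto split: if_splits)
          then show False using disj by blast
        next
          case False
          then have "x \<notin> B" "x \<notin> B'"
            using block(1)[OF B(1)] block(1)[OF B(2)] by auto
          then have "n \<in> B" "n \<in> B'"
            using x unfolding B(3,4) extend_path_def by (auto split: if_splits)
          then show False using disj by blast
        qed
      qed
    qed
  next
    fix e assume "e \<in> ?A"
    then show "\<exists>B\<in>?ext ` ?C. e \<subseteq> B"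
    proof
      assume "e \<in> A"
      then obtain B where "B \<in> ?C" "e \<subseteq> B" using edge_in_component[OF A] by blast
      moreover have "B \<subseteq> ?ext B" by (auto simp: extend_path_def)
      ultimately show ?thesis by blast
    next
      assume "e \<in> path_part n k"
      then obtain i where "1 \<le> i" "i < k" "e = {n + i - 1, n + i}" by (auto simp: path_part_def)
      then have "e \<subseteq> {n..n + k - 1}" by auto
      then have "e \<subseteq> ?ext B0" using B0(2) by (auto simp: extend_path_def)
      then show ?thesis using B0(1) by blast
    qed
  next
    fix B u v assume B: "B \<in> ?ext ` ?C" and uv: "u \<in> B" "v \<in> B"
    then obtain B' where B': "B' \<in> ?C" "B = ?ext B'" by blast
    have sub: "connectivity A \<subseteq> connectivity ?A" by (rule connectivity_mono) simp
    have in_B': "(x, y) \<in> connectivity ?A" if "x \<in> B'" "y \<in> B'" for x y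
      using components_eq_class[OF B'(1) that(1)] that(2) sub by blast
    show "(u, v) \<in> connectivity ?A"
    proof (cases "n \<in> B'")
      case False
      then show ?thesis using in_B' uv B'(2) by (simp add: extend_path_def)
    next
      case True
      have path: "(n, n + i) \<in> connectivity ?A" if "i < k" for i
        using that
      proof (induction i)
        case (Suc i)
        have "{n + Suc i - 1, n + Suc i} \<in> path_part n k"
          unfolding path_part_def by (rule imageI) (use Suc.prems in simp)
        then have "{n + i, n + Suc i} \<in> ?A" by simp
        then have "(n + i, n + Suc i) \<in> connectivity ?A" by (rule connectivity_edge)
        then show ?case by (rule connectivity_trans[rotated]) (use Suc in simp)
      qed simp
      have from_n: "(n, x) \<in> connectivity ?A" if "x \<in> B" for x
      proof (cases "x \<in> B'")
        case True
        then show ?thesis using in_B'[OF \<open>n \<in> B'\<close>] by simp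
      next
        case False
        then have "x \<in> {n..n + k - 1}" using that B'(2) \<open>n \<in> B'\<close> by (simp add: extend_path_def)
        then have "x - n < k" "n + (x - n) = x" using k by auto
        then show ?thesis using path[of "x - n"] by simp
      qed
      show ?thesis by (rule connectivity_trans[OF connectivity_sym[OF from_n[OF uv(1)]] from_n[OF uv(2)]])
    qed
  qed
qed

text \<open>Path edges are bridges: without one of them the component of n misses a path vertex, and
  no composition of this block satisfies the condition in \<open>block_weight\<close>.\<close>

lemma signed_block_broken_path:
  assumes n: "n \<ge> 1" and k: "k \<ge> 1" and E: "simple_edges {1..n} E"
    and A: "A \<subseteq> E \<union> path_part n k" "\<not> path_part n k \<subseteq> A"
  shows "(\<Prod>B\<in>components {1..n + k - 1} A. signed_block n k B) = 0"
proof (rule prod_zero)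
  show "finite (components {1..n + k - 1} A)" by (simp add: components_def)
  let ?B = "connectivity A `` {n}"
  obtain e where e: "e \<in> path_part n k" "e \<notin> A" using A(2) by blast
  then obtain i where i: "1 \<le> i" "i < k" "{n + i - 1, n + i} \<notin> A"
    unfolding path_part_def by fastforce
  have "(n, n + i) \<notin> connectivity A"
  proof
    assume "(n, n + i) \<in> connectivity A"
    \<comment> \<open>Only the missing edge could cross the threshold \<open>n + i\<close>, as the
      edges of G stay at or below n.\<close>
    then have "(n \<ge> n + i) = (n + i \<ge> n + i)"
    proof (rule connectivity_invariant[where g = "\<lambda>x. x \<ge> n + i"])
      fix a b assume ab: "{a, b} \<in> A"
      then consider "{a, b} \<in> E" | "{a, b} \<in> path_part n k" using A(1) by blast
      then show "(n + i \<le> a) = (n + i \<le> b)"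
      proof cases
        case 1
        from simple_edges_subset[OF E this] have "a \<le> n" "b \<le> n" by simp_all
        then show ?thesis using i(1) by simp
      next
        case 2
        then obtain j where "1 \<le> j" and "{a, b} = {n + j - 1, n + j}" by (auto simp: path_part_def)
        moreover from this have "j \<noteq> i" using ab i(3) by metis
        ultimately consider "a = n + j - 1" "b = n + j" "j \<noteq> i" | "a = n + j" "b = n + j - 1" "j \<noteq> i"
          by (auto simp: doubleton_eq_iff)
        then show ?thesis using \<open>1 \<le> j\<close> by cases auto
      qed
    qed
    then show False using i(1) by simp
  qed
  then have "n + i \<notin> ?B" by simp
  moreover have "n + i \<in> {n..n + k - 1}" using i(2) by simp
  ultimately have "\<not> {n..n + k - 1} \<subseteq> ?B" by blast
  moreover have "n \<in> ?B" by simp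
  ultimately have "signed_block n k ?B = 0"
    unfolding signed_block_def block_weight_def by simp
  moreover have "?B \<in> components {1..n + k - 1} A"
    unfolding components_def by (rule imageI) (use n k in simp)
  ultimately show "\<exists>B\<in>components {1..n + k - 1} A. signed_block n k B = 0" by blast
qed

text \<open>
  The sign is that of \<open>B\<close> and not of its extension, because the $k-1$ path edges are no longer counted
  in the sign of the edge set.
\<close>

definition path_block :: "nat \<Rightarrow> nat \<Rightarrow> nat set \<Rightarrow> pseries" where
  "path_block n k B = (- 1) ^ (card B - 1) * block_weight n k (extend_path n k B)"

lemma card_extend_path:
  assumes "B \<subseteq> {1..n}" "n \<in> B" "k \<ge> 1"
  shows "card (extend_path n k B) = card B + (k - 1)"
proof -
  have "{n..n + k - 1} = insert n {n + 1..n + k - 1}" using assms(3) by auto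
  then have "extend_path n k B = B \<union> {n + 1..n + k - 1}"
    using assms(2) by (auto simp: extend_path_def)
  moreover have "finite B" using finite_subset[OF assms(1)] by simp
  moreover have "B \<inter> {n + 1..n + k - 1} = {}" using assms(1) by auto
  ultimately show ?thesis by (simp add: card_Un_disjoint)
qed

text \<open>The extra sign comes from the one component with n, which gains \<open>k - 1\<close>
  vertices while \<open>path_block\<close> keeps the exponent of the smaller block.\<close>

lemma prod_signed_block_with_path:
  assumes n: "n \<ge> 1" and k: "k \<ge> 1" and A: "simple_edges {1..n} A"
  shows "(\<Prod>B\<in>components {1..n + k - 1} (A \<union> path_part n k). signed_block n k B) =
    (- 1) ^ (k - 1) * (\<Prod>B\<in>components {1..n} A. path_block n k B)"
proof -
  let ?C = "components {1..n} A" and ?W = "connectivity A `` {n}"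
  have W: "?W \<in> ?C" unfolding components_def by (rule imageI) (use n in simp)
  have W_iff: "B = ?W" if "B \<in> ?C" "n \<in> B" for B by (rule components_eq_class[OF that])
  have "(\<Prod>B\<in>components {1..n + k - 1} (A \<union> path_part n k). signed_block n k B) =
      (\<Prod>B\<in>?C. signed_block n k (extend_path n k B))"
    unfolding components_with_path(1)[OF assms] prod.reindex[OF components_with_path(2)[OF assms]] comp_def ..
  also have "\<dots> = (\<Prod>B\<in>?C. (if B = ?W then (- 1) ^ (k - 1) else 1) * path_block n k B)"
  proof (rule prod.cong[OF refl])
    fix B assume B: "B \<in> ?C"
    note block = components_block[OF A B]
    show "signed_block n k (extend_path n k B) = (if B = ?W then (- 1) ^ (k - 1) else 1) * path_block n k B"
    proof (cases "n \<in> B")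
      case True
      have "card B \<ge> 1" using block by (simp add: Suc_le_eq card_gt_0_iff)
      then have "card (extend_path n k B) - 1 = (k - 1) + (card B - 1)"
        using card_extend_path[OF block(1) True k] by simp
      then show ?thesis
        using W_iff[OF B True] by (simp add: signed_block_def path_block_def power_add mult.assoc)
    next
      case False
      then have "B \<noteq> ?W" by auto
      then show ?thesis using False by (simp add: signed_block_def path_block_def extend_path_def)
    qed
  qed
  also have "\<dots> = (- 1) ^ (k - 1) * (\<Prod>B\<in>?C. path_block n k B)"
  proof -
    have "finite ?C" by (simp add: components_def)
    then have "(\<Prod>B\<in>?C. if B = ?W then (- 1) ^ (k - 1) else 1) = ((- 1) ^ (k - 1) :: pseries)"
      using W by (simp add: prod.delta)
    then show ?thesis by (simp only: prod.distrib)
  qed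
  finally show ?thesis .
qed

text \<open>Edge sets that lack a path edge vanish, and the others correspond to subsets of
  \<open>E\<close>. The range of summation thereby becomes independent of \<open>k\<close>.\<close>

lemma F_mat_diagonal:
  assumes n: "n \<ge> 1" and E: "graph_on n E" and k: "k \<ge> 1"
    and ord: "linear_order_on (plus_edges n E (path_edges k)) (ord k)"
  shows "F_mat n E ord k k =
    (\<Sum>A\<in>Pow E. (- 1) ^ card A * (\<Prod>B\<in>components {1..n} A. path_block n k B))"
proof -
  let ?P = "path_part n k"
  define h where "h A = (- 1) ^ card A * (\<Prod>B\<in>components {1..n + k - 1} A. signed_block n k B)" for A
  note simple = simple_edges_graph_on[OF E]
  have finE: "finite E"
    by (rule finite_subset[of _ "Pow {1..n}"]) (use simple_edges_subset[OF simple] in auto)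
  have finP: "finite ?P" by (simp add: path_part_def)
  have disj: "E \<inter> ?P = {}"
  proof (rule ccontr)
    assume "E \<inter> ?P \<noteq> {}"
    then obtain i where "1 \<le> i" "{n + i - 1, n + i} \<in> E" by (auto simp: path_part_def)
    then show False using simple_edges_subset[OF simple, of "{n + i - 1, n + i}"] by auto
  qed
  have inj: "inj_on (\<lambda>A. A \<union> ?P) (Pow E)"
    by (rule inj_onI) (use disj in blast)
  have "F_mat n E ord k k = (\<Sum>A\<in>Pow (E \<union> ?P). h A)"
    using F_mat_conv_sum_subsets[of n E k ord, OF n E k ord]
    unfolding plus_path_edges[OF n] path_part_def h_def .
  also have "\<dots> = (\<Sum>A\<in>(\<lambda>A. A \<union> ?P) ` Pow E. h A)"
  proof (rule sum.mono_neutral_right)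
    show "finite (Pow (E \<union> ?P))" using finE finP by simp
    show "(\<lambda>A. A \<union> ?P) ` Pow E \<subseteq> Pow (E \<union> ?P)" by blast
    show "\<forall>A\<in>Pow (E \<union> ?P) - (\<lambda>A. A \<union> ?P) ` Pow E. h A = 0"
    proof
      fix A assume A: "A \<in> Pow (E \<union> ?P) - (\<lambda>A. A \<union> ?P) ` Pow E"
      have "\<not> ?P \<subseteq> A"
      proof
        assume "?P \<subseteq> A"
        then have "A = (A \<inter> E) \<union> ?P" using A by blast
        moreover have "A \<inter> E \<in> Pow E" by blast
        ultimately show False using A by blast
      qed
      then show "h A = 0"
        using signed_block_broken_path[OF n k simple, of A] A unfolding h_def by simp
    qed
  qed
  also have "\<dots> = (\<Sum>A\<in>Pow E. h (A \<union> ?P))"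
    unfolding sum.reindex[OF inj] comp_def ..
  also have "\<dots> = (\<Sum>A\<in>Pow E. (- 1) ^ card A * (\<Prod>B\<in>components {1..n} A. path_block n k B))"
  proof (rule sum.cong[OF refl])
    fix A assume "A \<in> Pow E"
    then have A: "A \<subseteq> E" by simp
    have "simple_edges {1..n} A" using simple A unfolding simple_edges_def by blast
    note prod = prod_signed_block_with_path[OF n k this]
    have "inj_on (\<lambda>i. {n + i - 1, n + i}) {1..<k}"
      by (rule inj_onI) (auto simp: doubleton_eq_iff)
    then have "card ?P = k - 1" by (simp add: path_part_def card_image)
    moreover have "card (A \<union> ?P) = card A + card ?P"
      using A disj finP finite_subset[OF A finE] by (intro card_Un_disjoint) auto
    ultimately have sgn: "(- 1) ^ card (A \<union> ?P) = (- 1) ^ card A * ((- 1) ^ (k - 1) :: pseries)"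
      by (simp add: power_add)
    \<comment> \<open>The sign of the \<open>k - 1\<close> path edges cancels against the sign of
      the enlarged block.\<close>
    have "h (A \<union> ?P) = (- 1) ^ card A * (((- 1) ^ (k - 1) * (- 1) ^ (k - 1)) *
        (\<Prod>B\<in>components {1..n} A. path_block n k B))"
      unfolding h_def prod sgn by (simp only: mult.assoc)
    then show "h (A \<union> ?P) = (- 1) ^ card A * (\<Prod>B\<in>components {1..n} A. path_block n k B)"
      unfolding minus_one_power_mult_self by simp
  qed
  finally show ?thesis .
qed

text \<open>The four cases are the four composition sums. In the first, the sign of the block
  cancels the one in \<open>signed_power_sum\<close> and \<open>k\<close> disappears; in the last, 1
  and n are distinct, which gives the required \<open>card B \<ge> 2\<close>.\<close>

lemma path_block_eq:
  assumes n: "n \<ge> 2" and k: "k \<ge> 1" and B: "B \<subseteq> {1..n}" "B \<noteq> {}"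
  shows "1 \<notin> B \<Longrightarrow> n \<notin> B \<Longrightarrow> path_block n k B = power_sum (card B)"
    and "1 \<in> B \<Longrightarrow> n \<notin> B \<Longrightarrow> path_block n k B =
      (- 1) ^ (card B - 1) * (if k \<le> card B then composition_sum (card B - k) else 0)"
    and "1 \<notin> B \<Longrightarrow> n \<in> B \<Longrightarrow> path_block n k B =
      (- 1) ^ (card B - 1) * (\<Sum>m<k. elem m * signed_power_sum (card B + k - 1 - m))"
    and "1 \<in> B \<Longrightarrow> n \<in> B \<Longrightarrow> path_block n k B =
      (- 1) ^ (card B - 1) * - (\<Sum>m=k..card B - 1. elem m * composition_sum (card B - 1 - m))"
proof -
  have finB: "finite B" using finite_subset[OF B(1)] by simp
  then have b: "card B \<ge> 1" using B(2) by (simp add: Suc_le_eq card_gt_0_iff)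
  have ext1: "1 \<in> extend_path n k B \<longleftrightarrow> 1 \<in> B" using n by (auto simp: extend_path_def)
  have extn: "n \<in> extend_path n k B \<longleftrightarrow> n \<in> B" by (auto simp: extend_path_def)
  show "path_block n k B = power_sum (card B)" if "1 \<notin> B" "n \<notin> B"
  proof -
    have "path_block n k B = (- 1) ^ (card B - 1) * signed_power_sum (card B)"
      unfolding path_block_def block_weight_def ext1 extn sum_hd_compositions[OF b, symmetric]
      using that by (simp add: extend_path_def)
    also have "\<dots> = ((- 1) ^ (card B - 1) * (- 1) ^ (card B - 1)) * power_sum (card B)"
      using b by (simp add: signed_power_sum_def mult.assoc)
    finally show ?thesis unfolding minus_one_power_mult_self by simp
  qed
  show "path_block n k B = (- 1) ^ (card B - 1) * (if k \<le> card B then composition_sum (card B - k) else 0)"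
    if "1 \<in> B" "n \<notin> B"
    unfolding path_block_def block_weight_def ext1 extn sum_compositions_hd_eq[OF k b, symmetric]
    using that by (simp add: extend_path_def cong: if_cong)
  have sub: "{n..n + k - 1} \<subseteq> extend_path n k B" if "n \<in> B" using that by (auto simp: extend_path_def)
  have card: "card (extend_path n k B) = card B + k - 1" if "n \<in> B"
    using card_extend_path[OF B(1) that k] k by simp
  show "path_block n k B = (- 1) ^ (card B - 1) * (\<Sum>m<k. elem m * signed_power_sum (card B + k - 1 - m))"
    if "1 \<notin> B" "n \<in> B"
    unfolding path_block_def block_weight_def ext1 extn card[OF that(2)]
      sum_compositions_last_ge[OF k b, symmetric]
    using that sub by (simp cong: if_cong)
  show "path_block n k B = (- 1) ^ (card B - 1) * - (\<Sum>m=k..card B - 1. elem m * composition_sum (card B - 1 - m))"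
    if "1 \<in> B" "n \<in> B"
  proof -
    have "card {1, n} \<le> card B" by (rule card_mono[OF finB]) (use that in simp)
    then have "card B \<ge> 2" using n by simp
    then show ?thesis
      unfolding path_block_def block_weight_def ext1 extn card[OF that(2)]
      using that sub sum_compositions_hd_eq_last_ge[OF k, of "card B"] by (simp cong: if_cong)
  qed
qed

section \<open>The trace\<close>

text \<open>
  Adding the edge $\{1,n\}$ and then discarding the vertex $n$ gives the components that arise from
  identifying $1$ and $n$.
\<close>

definition merged_prod :: "nat \<Rightarrow> nat set set \<Rightarrow> pseries" where
  "merged_prod n A = (\<Prod>B\<in>components {1..n} (insert {1, n} A). power_sum (card (B - {n})))"

lemma signed_power_sum_sign: "k \<ge> 1 \<Longrightarrow> (- 1) ^ (k - 1) * signed_power_sum k = power_sum k"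
  by (simp add: signed_power_sum_def mult.assoc[symmetric] minus_one_power_mult_self)

section \<open>The contribution of a fixed edge set of G\<close>

context
  fixes n :: nat and A :: "nat set set"
  assumes n: "n \<ge> 2" and A: "simple_edges {1..n} A"
begin

private abbreviation "C \<equiv> components {1..n} A"
private abbreviation "U \<equiv> connectivity A `` {1}"
private abbreviation "W \<equiv> connectivity A `` {n}"

private lemma UW: "U \<in> C" "W \<in> C" "1 \<in> U" "n \<in> W"
  using n unfolding components_def by auto

private lemma finC: "finite C"
  by (simp add: components_def)

private lemma class_U: "B \<in> C \<Longrightarrow> 1 \<in> B \<Longrightarrow> B = U"
  by (rule components_eq_class)

private lemma class_W: "B \<in> C \<Longrightarrow> n \<in> B \<Longrightarrow> B = W"
  by (rule components_eq_class)

text \<open>Here \<open>B - {n}\<close> equals \<open>B\<close>; it is written this way to match the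
  factors of \<open>merged_prod\<close>.\<close>

private lemma path_block_other:
  assumes "B \<in> C - {U, W}" "k \<ge> 1"
  shows "path_block n k B = power_sum (card (B - {n}))"
proof -
  have B: "B \<in> C" "1 \<notin> B" "n \<notin> B" using assms class_U class_W by blast+
  then have "path_block n k B = power_sum (card B)"
    using path_block_eq(1)[OF n assms(2)] components_block[OF A] by simp
  then show ?thesis using B(3) by simp
qed

private lemma prod_others:
  assumes "k \<ge> 1"
  shows "(\<Prod>B\<in>C - {U, W}. path_block n k B) = (\<Prod>B\<in>C - {U, W}. power_sum (card (B - {n})))"
  by (rule prod.cong[OF refl]) (rule path_block_other[OF _ assms])

private lemma card_ge_1: "B \<in> C \<Longrightarrow> card B \<ge> 1"
  using components_block[OF A] by (simp add: Suc_le_eq card_gt_0_iff)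

private lemma prod_same:
  assumes "U = W" "k \<ge> 1"
  shows "(\<Prod>B\<in>C. path_block n k B) =
    (- 1) ^ (card U - 1) * - (\<Sum>m=k..card U - 1. elem m * composition_sum (card U - 1 - m)) *
    (\<Prod>B\<in>C - {U, W}. power_sum (card (B - {n})))"
proof -
  have "(\<Prod>B\<in>C. path_block n k B) = path_block n k U * (\<Prod>B\<in>C - {U, W}. path_block n k B)"
    using prod.remove[OF finC UW(1)] assms(1) by simp
  moreover have "n \<in> U" using UW(4) assms(1) by simp
  ultimately show ?thesis
    unfolding prod_others[OF assms(2)]
    using path_block_eq(4)[OF n assms(2) components_block(1,3)[OF A UW(1)] UW(3)] by simp
qed

private lemma prod_distinct:
  assumes "U \<noteq> W" "k \<ge> 1"
  shows "(\<Prod>B\<in>C. path_block n k B) =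
    (- 1) ^ (card U - 1) * (- 1) ^ (card W - 1) *
    ((if k \<le> card U then composition_sum (card U - k) else 0) *
     (\<Sum>m<k. elem m * signed_power_sum (card W + k - 1 - m))) *
    (\<Prod>B\<in>C - {U, W}. power_sum (card (B - {n})))"
proof -
  have remove_W: "C - {U} - {W} = C - {U, W}" "W \<in> C - {U}" "finite (C - {U})"
    using UW(2) assms(1) finC by blast+
  have "(\<Prod>B\<in>C. path_block n k B) =
      path_block n k U * (path_block n k W * (\<Prod>B\<in>C - {U, W}. path_block n k B))"
    unfolding prod.remove[OF finC UW(1)] prod.remove[OF remove_W(3,2)] remove_W(1) ..
  moreover have "n \<notin> U" using class_W[OF UW(1)] assms(1) by blast
  moreover have "1 \<notin> W" using class_U[OF UW(2)] assms(1) by blast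
  ultimately show ?thesis
    unfolding prod_others[OF assms(2)]
    using path_block_eq(2)[OF n assms(2) components_block(1,3)[OF A UW(1)] UW(3)]
      path_block_eq(3)[OF n assms(2) components_block(1,3)[OF A UW(2)] _ UW(4)]
    by (simp only: mult_ac simp_thms)
qed

text \<open>If 1 and n are connected, the sum from \<open>k\<close> to \<open>card U - 1\<close> is
  empty. If not, \<open>U\<close> omits n and is too small to have \<open>k\<close> as a
  part.\<close>

lemma prod_path_block_eq_0:
  assumes "k \<ge> n"
  shows "(\<Prod>B\<in>components {1..n} A. path_block n k B) = 0"
proof -
  have k: "k \<ge> 1" using assms n by simp
  show ?thesis
  proof (cases "U = W")
    case True
    have "card U \<le> card {1..n}" by (rule card_mono) (use components_block[OF A UW(1)] in simp_all)
    then have "{k..card U - 1} = {}" using assms n by auto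
    then show ?thesis unfolding prod_same[OF True k] by simp
  next
    case False
    then have "n \<notin> U" using class_W[OF UW(1)] by blast
    then have "U \<subseteq> {1..n} - {n}" using components_block(1)[OF A UW(1)] by blast
    then have "card U \<le> card ({1..n} - {n})" by (intro card_mono) simp_all
    also have "\<dots> = n - 1" using n by simp
    finally have "\<not> k \<le> card U" using assms n by simp
    then show ?thesis unfolding prod_distinct[OF False k] by simp
  qed
qed

text \<open>Only the factors at 1 and n vary with k, so \<open>trace_sum_same\<close> or
  \<open>trace_sum_distinct\<close> applies. The resulting index is the size of the merged block
  without n: |U| - 1 if 1 and n are already connected, |U| + |W| - 1 if the edge
  \<open>{1, n}\<close> unites two blocks.\<close>

lemma sum_prod_path_block:
  "(\<Sum>k=1..n - 1. \<Prod>B\<in>components {1..n} A. path_block n k B) = merged_prod n A"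
proof (cases "U = W")
  case True
  let ?c = "card U"
  have conn: "(1, n) \<in> connectivity A" using True by (simp only: connectivity_class_eq_iff)
  have "card {1, n} \<le> ?c"
    by (rule card_mono) (use components_block[OF A UW(1)] UW True in auto)
  then have c: "?c \<ge> 2" using n by simp
  have "?c \<le> card {1..n}" by (rule card_mono) (use components_block[OF A UW(1)] in simp_all)
  then have c_le: "?c \<le> Suc (n - 1)" using n by simp
  have "(\<Sum>k=1..n - 1. \<Prod>B\<in>C. path_block n k B) =
      (\<Sum>k=1..n - 1. (- 1) ^ (?c - 1) * - (\<Sum>m=k..?c - 1. elem m * composition_sum (?c - 1 - m)) *
        (\<Prod>B\<in>C - {U, W}. power_sum (card (B - {n}))))"
    by (rule sum.cong[OF refl], rule prod_same[OF True]) simp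
  also have "\<dots> = (- 1) ^ (?c - 1) * (\<Sum>k=1..n - 1. - (\<Sum>m=k..?c - 1. elem m * composition_sum (?c - 1 - m))) *
        (\<Prod>B\<in>C - {U, W}. power_sum (card (B - {n})))"
    by (simp only: sum_distrib_left sum_distrib_right)
  also have "\<dots> = ((- 1) ^ (?c - 1) * - signed_power_sum (?c - 1)) *
        (\<Prod>B\<in>C - {U, W}. power_sum (card (B - {n})))"
    unfolding trace_sum_same[OF c_le] ..
  \<comment> \<open>As \<open>?c - 1\<close> is positive, the sign inside
    \<open>signed_power_sum (?c - 1)\<close> has exponent \<open>?c - 2\<close>; the explicit minus
    sign makes up the difference.\<close>
  also have "(- 1) ^ (?c - 1) * - signed_power_sum (?c - 1) = power_sum (?c - 1)"
  proof -
    obtain d where d: "?c - 1 = Suc d" using c by (cases "?c - 1") auto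
    show ?thesis unfolding d using signed_power_sum_sign[of "Suc d"] by simp
  qed
  also have "?c - 1 = card (U - {n})"
    using UW(4) True components_block(2)[OF A UW(1)] by simp
  also have "power_sum (card (U - {n})) * (\<Prod>B\<in>C - {U, W}. power_sum (card (B - {n}))) =
      (\<Prod>B\<in>C. power_sum (card (B - {n})))"
    using prod.remove[OF finC UW(1), of "\<lambda>B. power_sum (card (B - {n}))"] True by simp
  also have "\<dots> = merged_prod n A"
    unfolding merged_prod_def components_def connectivity_insert[OF conn] ..
  finally show ?thesis .
next
  case False
  let ?a = "card U" and ?b = "card W"
  have nU: "n \<notin> U" using class_W[OF UW(1)] False by blast
  have oneW: "1 \<notin> W" using class_U[OF UW(2)] False by blast
  have a: "?a \<ge> 1" and b: "?b \<ge> 1" using card_ge_1 UW by simp_all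
  have "U \<subseteq> {1..n} - {n}" using components_block(1)[OF A UW(1)] nU by blast
  then have "?a \<le> card ({1..n} - {n})" by (intro card_mono) simp_all
  then have a_le: "?a \<le> n - 1" using n by simp
  have "(\<Sum>k=1..n - 1. \<Prod>B\<in>C. path_block n k B) =
      (\<Sum>k=1..n - 1. (- 1) ^ (?a - 1) * (- 1) ^ (?b - 1) *
        ((if k \<le> ?a then composition_sum (?a - k) else 0) *
         (\<Sum>m<k. elem m * signed_power_sum (?b + k - 1 - m))) *
        (\<Prod>B\<in>C - {U, W}. power_sum (card (B - {n}))))"
    by (rule sum.cong[OF refl], rule prod_distinct[OF False]) simp
  also have "\<dots> = (- 1) ^ (?a - 1) * (- 1) ^ (?b - 1) *
      (\<Sum>k=1..n - 1. (if k \<le> ?a then composition_sum (?a - k) else 0) *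
         (\<Sum>m<k. elem m * signed_power_sum (?b + k - 1 - m))) *
        (\<Prod>B\<in>C - {U, W}. power_sum (card (B - {n})))"
    unfolding sum_distrib_left sum_distrib_right ..
  also have "\<dots> = ((- 1) ^ (?a - 1) * (- 1) ^ (?b - 1) * signed_power_sum (?a + ?b - 1)) *
        (\<Prod>B\<in>C - {U, W}. power_sum (card (B - {n})))"
    unfolding trace_sum_distinct[OF a a_le b] ..
  also have "(- 1) ^ (?a - 1) * (- 1) ^ (?b - 1) * signed_power_sum (?a + ?b - 1) = power_sum (?a + ?b - 1)"
  proof -
    have "?a - 1 + (?b - 1) = (?a + ?b - 1) - 1" using a b by simp
    then show ?thesis
      using signed_power_sum_sign[of "?a + ?b - 1"] a b unfolding power_add[symmetric] by simp
  qed
  also have "?a + ?b - 1 = card (U \<union> W - {n})"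
  proof -
    have "U \<inter> W = {}"
    proof (rule ccontr)
      assume "U \<inter> W \<noteq> {}"
      then obtain x where x: "x \<in> U" "x \<in> W" by blast
      have "U = connectivity A `` {x}" "W = connectivity A `` {x}"
        by (rule components_eq_class[OF UW(1) x(1)], rule components_eq_class[OF UW(2) x(2)])
      then show False using False by (simp only:)
    qed
    then have "card (U \<union> W) = ?a + ?b"
      by (rule card_Un_disjoint[OF components_block(2)[OF A UW(1)] components_block(2)[OF A UW(2)]])
    then show ?thesis
      using UW(4) components_block(2)[OF A UW(1)] components_block(2)[OF A UW(2)] by simp
  qed
  also have "power_sum (card (U \<union> W - {n})) * (\<Prod>B\<in>C - {U, W}. power_sum (card (B - {n}))) =
      (\<Prod>B\<in>insert (U \<union> W) (C - {U, W}). power_sum (card (B - {n})))"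
  proof -
    have "U \<union> W \<notin> C - {U, W}"
    proof
      assume *: "U \<union> W \<in> C - {U, W}"
      then have "U \<union> W = U" by (intro class_U) (use UW(3) in auto)
      then show False using * by simp
    qed
    then show ?thesis using finC by simp
  qed
  also have "\<dots> = merged_prod n A"
    unfolding merged_prod_def using n by (subst components_insert[OF _ _ A]) simp_all
  finally show ?thesis .
qed

end

section \<open>Colourings\<close>

text \<open>Expansion of the product of the factors -1 + 1 over the elements with \<open>q\<close>,
  which is nonzero only when it is empty.\<close>

lemma sum_subsets_sign:
  assumes "finite E"
  shows "(\<Sum>A\<in>Pow E. if \<forall>e\<in>A. q e then (- 1) ^ card A else 0) =
    (if \<forall>e\<in>E. \<not> q e then 1 else 0 :: 'b :: comm_ring_1)"
proof -
  let ?Q = "{e \<in> E. q e}"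
  have fin: "finite ?Q" using assms by simp
  have "(\<Sum>A\<in>Pow E. if \<forall>e\<in>A. q e then (- 1) ^ card A else 0) =
      (\<Sum>A | A \<in> Pow E \<and> (\<forall>e\<in>A. q e). (- 1) ^ card A :: 'b)"
    by (rule sum.mono_neutral_cong_right) (use assms in auto)
  also have "{A. A \<in> Pow E \<and> (\<forall>e\<in>A. q e)} = Pow ?Q" by auto
  also have "(\<Sum>A\<in>Pow ?Q. (- 1) ^ card A) = (\<Prod>e\<in>?Q. (- 1) + (1 :: 'b))"
    unfolding prod_add[OF fin] by simp
  also have "\<dots> = (if \<forall>e\<in>E. \<not> q e then 1 else 0)"
  proof (cases "\<forall>e\<in>E. \<not> q e")
    case True
    then have "?Q = {}" by blast
    then show ?thesis unfolding if_P[OF True] by (simp only: prod.empty)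
  next
    case False
    then have "card ?Q \<noteq> 0" using fin by auto
    then show ?thesis unfolding if_not_P[OF False] by (simp add: power_0_left)
  qed
  finally show ?thesis .
qed

text \<open>Colourings of $G^\circ$ correspond to the colourings of $G$ in which $1$ and $n$ agree.\<close>

definition close_colouring :: "nat \<Rightarrow> (nat \<Rightarrow> nat) \<Rightarrow> nat \<Rightarrow> nat" where
  "close_colouring n \<kappa> = \<kappa>(n := \<kappa> 1)"

text \<open>An edge \<open>{i, n}\<close> becomes \<open>{i, 1}\<close>, and n copies the colour of
  1. If \<open>{1, n}\<close> is an edge, both sides are false: the loop forbids every colouring,
  and the edge is always monochromatic.\<close>

lemma proper_circ_iff:
  assumes n: "n \<ge> 2" and E: "simple_edges {1..n} E"
  shows "(\<forall>u v. {u, v} \<in># circ_edges n E \<longrightarrow> \<kappa> u \<noteq> \<kappa> v) \<longleftrightarrow>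
    (\<forall>e\<in>E. \<not> (\<forall>u\<in>e. \<forall>v\<in>e. close_colouring n \<kappa> u = close_colouring n \<kappa> v))"
    (is "?L \<longleftrightarrow> ?R")
proof -
  have finE: "finite E"
    by (rule finite_subset[of _ "Pow {1..n}"]) (use simple_edges_subset[OF E] in auto)
  have "{i. {i, n} \<in> E} \<subseteq> {1..n}"
  proof
    fix i assume "i \<in> {i. {i, n} \<in> E}"
    then have "{i, n} \<in> E" by simp
    from simple_edges_subset[OF E this] show "i \<in> {1..n}" by simp
  qed
  then have finI: "finite {i. {i, n} \<in> E}" by (rule finite_subset) simp
  have mem: "e \<in># circ_edges n E \<longleftrightarrow>
      (e \<in> E \<and> (\<exists>i j. e = {i, j} \<and> 1 \<le> i \<and> i < j \<and> j \<le> n - 1)) \<or> (\<exists>i. {i, n} \<in> E \<and> e = {i, 1})" for e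
    unfolding circ_edges_def using finE finI by auto
  show ?thesis
  proof
    assume L: ?L
    show ?R
    proof
      fix e assume e: "e \<in> E"
      then obtain u v where uv: "u \<in> {1..n}" "v \<in> {1..n}" "u < v" "e = {u, v}"
        using E unfolding simple_edges_def by (metis insert_commute linorder_neqE_nat)
      have "close_colouring n \<kappa> u \<noteq> close_colouring n \<kappa> v"
      proof (cases "v = n")
        case True
        then have "{u, 1} \<in># circ_edges n E" using mem e uv by blast
        then have "\<kappa> u \<noteq> \<kappa> 1" using L by blast
        then show ?thesis using True uv(3) by (simp add: close_colouring_def)
      next
        case False
        then have "1 \<le> u \<and> u < v \<and> v \<le> n - 1" using uv by auto
        then have "{u, v} \<in># circ_edges n E" using mem[of "{u, v}"] e uv(4) by blast
        then have "\<kappa> u \<noteq> \<kappa> v" using L by blast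
        then show ?thesis using False uv by (simp add: close_colouring_def)
      qed
      then show "\<not> (\<forall>u\<in>e. \<forall>v\<in>e. close_colouring n \<kappa> u = close_colouring n \<kappa> v)"
        using uv(4) by blast
    qed
  next
    assume R: ?R
    have neq: "close_colouring n \<kappa> a \<noteq> close_colouring n \<kappa> b" if "{a, b} \<in> E" for a b
      using R that by fastforce
    show ?L
    proof (intro allI impI)
      fix u v assume "{u, v} \<in># circ_edges n E"
      then consider i j where "{u, v} \<in> E" "{u, v} = {i, j}" "i \<le> n - 1" "j \<le> n - 1" "i < j"
        | i where "{i, n} \<in> E" "{u, v} = {i, 1}"
        unfolding mem by fastforce
      then show "\<kappa> u \<noteq> \<kappa> v"
      proof cases
        case 1
        then have "u \<noteq> n" "v \<noteq> n" using n by (auto simp: doubleton_eq_iff)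
        then show ?thesis using neq[OF 1(1)] by (simp add: close_colouring_def)
      next
        case 2
        have "card {i, n} = 2" using E 2(1) unfolding simple_edges_def by (metis card_2_iff)
        then have "i \<noteq> n" by auto
        then have "\<kappa> i \<noteq> \<kappa> 1" using neq[OF 2(1)] by (simp add: close_colouring_def)
        then show ?thesis using 2(2) by (auto simp: doubleton_eq_iff)
      qed
    qed
  qed
qed

text \<open>For a monomial supported in \<open>D\<close>, the colourings producing it take values in
  \<open>D\<close>; positivity removes 0. Only finitely many colourings remain, so the series is a
  finite sum of monomials.\<close>

lemma truncate_chrom_sym:
  assumes D: "finite D"
  shows "truncate D (chrom_sym N M) =
    (\<Sum>\<kappa> | \<kappa> \<in> {1..N} \<rightarrow>\<^sub>E D - {0} \<and> (\<forall>u v. {u, v} \<in># M \<longrightarrow> \<kappa> u \<noteq> \<kappa> v).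
      \<Prod>v\<in>{1..N}. monomial {#\<kappa> v#})"
proof (rule pseries_eqI)
  fix m
  let ?K = "{\<kappa>. \<kappa> \<in> {1..N} \<rightarrow>\<^sub>E D - {0} \<and> (\<forall>u v. {u, v} \<in># M \<longrightarrow> \<kappa> u \<noteq> \<kappa> v)}"
  let ?im = "\<lambda>\<kappa>. image_mset \<kappa> (mset_set {1..N})"
  have "finite ({1..N} \<rightarrow>\<^sub>E D - {0})" using D by (intro finite_PiE) simp_all
  then have finK: "finite ?K" by simp
  have "(\<Sum>\<kappa>\<in>?K. \<Prod>v\<in>{1..N}. monomial {#\<kappa> v#}) = (\<Sum>\<kappa>\<in>?K. monomial (?im \<kappa>))"
    by (simp only: prod_monomial finite_atLeastAtMost)
  then have "coeff (\<Sum>\<kappa>\<in>?K. \<Prod>v\<in>{1..N}. monomial {#\<kappa> v#}) m = int (card {\<kappa> \<in> ?K. ?im \<kappa> = m})"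
    using coeff_sum_monomial[OF finK] by simp
  also have "\<dots> = coeff (truncate D (chrom_sym N M)) m"
  proof (cases "set_mset m \<subseteq> D")
    case True
    have "\<kappa> \<in> {1..N} \<rightarrow>\<^sub>E D - {0} \<longleftrightarrow> \<kappa> \<in> {1..N} \<rightarrow>\<^sub>E {1..}" if "?im \<kappa> = m" for \<kappa>
    proof -
      have "\<kappa> ` {1..N} \<subseteq> D" using True that by auto
      then have "\<kappa> v \<in> D - {0} \<longleftrightarrow> \<kappa> v \<in> {1..}" if "v \<in> {1..N}" for v
        using that by (auto simp: Suc_le_eq intro: gr0I)
      then show ?thesis unfolding PiE_iff by blast
    qed
    then have "{\<kappa> \<in> ?K. ?im \<kappa> = m} = {\<kappa> \<in> proper_colourings N M. ?im \<kappa> = m}"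
      unfolding proper_colourings_def by blast
    then show ?thesis using True by (simp add: chrom_sym_def)
  next
    case False
    have "?im \<kappa> \<noteq> m" if "\<kappa> \<in> ?K" for \<kappa>
    proof
      assume "?im \<kappa> = m"
      then have "set_mset m = \<kappa> ` {1..N}" by auto
      also have "\<dots> \<subseteq> D" using that by (auto simp: PiE_iff)
      finally show False using False by simp
    qed
    then have "{\<kappa> \<in> ?K. ?im \<kappa> = m} = {}" by blast
    then show ?thesis using False by (simp only: coeff_truncate card.empty) simp
  qed
  finally show "coeff (truncate D (chrom_sym N M)) m =
      coeff (\<Sum>\<kappa>\<in>?K. \<Prod>v\<in>{1..N}. monomial {#\<kappa> v#}) m" ..
qed

text \<open>Since n copies the colour of 1, these colourings are free choices of one colour per
  component after the edge \<open>{1, n}\<close> is added. The vertex n carries no variable and is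
  left out of the exponent.\<close>

lemma sum_constant_colourings:
  fixes x :: "nat \<Rightarrow> 'b::comm_ring_1"
  assumes n: "n \<ge> 2" and A: "simple_edges {1..n} A" and D: "finite D"
  shows "(\<Sum>\<kappa> | \<kappa> \<in> {1..n - 1} \<rightarrow>\<^sub>E D \<and>
        (\<forall>e\<in>A. \<forall>u\<in>e. \<forall>v\<in>e. close_colouring n \<kappa> u = close_colouring n \<kappa> v).
      \<Prod>v\<in>{1..n - 1}. x (\<kappa> v)) =
    (\<Prod>B\<in>components {1..n} (insert {1, n} A). \<Sum>c\<in>D. x c ^ card (B - {n}))"
proof -
  let ?A = "insert {1, n} A" and ?V = "{1..n}"
  let ?C = "components ?V ?A"
  let ?K = "{\<kappa>. \<kappa> \<in> {1..n - 1} \<rightarrow>\<^sub>E D \<and>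
        (\<forall>e\<in>A. \<forall>u\<in>e. \<forall>v\<in>e. close_colouring n \<kappa> u = close_colouring n \<kappa> v)}"
  define cls where "cls v = connectivity ?A `` {v}" for v
  define j where "j \<kappa> = (\<lambda>B\<in>?C. close_colouring n \<kappa> (SOME v. v \<in> B))" for \<kappa>
  define i where "i g = (\<lambda>v\<in>{1..n - 1}. g (cls v))" for g :: "nat set \<Rightarrow> nat"
  have simple: "simple_edges ?V ?A"
    unfolding simple_edges_def
  proof
    fix e assume "e \<in> ?A"
    then show "\<exists>u v. u \<in> ?V \<and> v \<in> ?V \<and> u \<noteq> v \<and> e = {u, v}"
    proof
      assume "e = {1, n}"
      then show ?thesis using n by (intro exI[of _ 1] exI[of _ n]) auto
    next
      assume "e \<in> A"
      then show ?thesis using A unfolding simple_edges_def by blast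
    qed
  qed
  have part: "partition_on ?V ?C"
    by (rule partition_on_components) (rule simple_edges_subset[OF simple])
  note block = components_block[OF simple]
  have cls_in: "cls v \<in> ?C" if "v \<in> ?V" for v
    unfolding cls_def components_def by (rule imageI[OF that])
  have cls_eq: "cls v = B" if "B \<in> ?C" "v \<in> B" for B v
    unfolding cls_def using components_eq_class[OF that] ..
  have cls_edge: "cls u = cls v" if "{u, v} \<in> ?A" for u v
    unfolding cls_def connectivity_class_eq_iff by (rule connectivity_edge[OF that])
  have K_PiE: "\<kappa> \<in> {1..n - 1} \<rightarrow>\<^sub>E D" if "\<kappa> \<in> ?K" for \<kappa>
    using that unfolding mem_Collect_eq by (rule conjunct1)
  have K_const: "close_colouring n \<kappa> u = close_colouring n \<kappa> v"
    if "\<kappa> \<in> ?K" "e \<in> A" "u \<in> e" "v \<in> e" for \<kappa> e u v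
  proof -
    have "\<forall>e\<in>A. \<forall>u\<in>e. \<forall>v\<in>e. close_colouring n \<kappa> u = close_colouring n \<kappa> v"
      using that(1) unfolding mem_Collect_eq by (rule conjunct2)
    from bspec[OF bspec[OF bspec[OF this that(2)] that(3)] that(4)] show ?thesis .
  qed
  have const: "close_colouring n \<kappa> u = close_colouring n \<kappa> v" if "\<kappa> \<in> ?K" "cls u = cls v" for \<kappa> u v
  proof (rule connectivity_invariant[where A = ?A and g = "close_colouring n \<kappa>"])
    show "(u, v) \<in> connectivity ?A" using that(2) unfolding cls_def connectivity_class_eq_iff .
    fix a b assume ab: "{a, b} \<in> ?A"
    show "close_colouring n \<kappa> a = close_colouring n \<kappa> b"
    proof (cases "{a, b} = {1, n}")
      case True
      then show ?thesis using n by (auto simp: doubleton_eq_iff close_colouring_def)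
    next
      case False
      then have abA: "{a, b} \<in> A" using ab by simp
      show ?thesis by (rule K_const[OF that(1) abA]) simp_all
    qed
  qed
  have some_in: "(SOME v. v \<in> B) \<in> B" if "B \<in> ?C" for B
    using block(3)[OF that] by (simp add: some_in_eq)
  have j_cls: "j \<kappa> B = close_colouring n \<kappa> v" if "\<kappa> \<in> ?K" "B \<in> ?C" "v \<in> B" for \<kappa> B v
  proof -
    have "cls (SOME w. w \<in> B) = cls v"
      using cls_eq[OF that(2) some_in[OF that(2)]] cls_eq[OF that(2,3)] by simp
    then have "close_colouring n \<kappa> (SOME w. w \<in> B) = close_colouring n \<kappa> v"
      by (rule const[OF that(1)])
    then show ?thesis by (simp only: j_def restrict_apply if_P[OF that(2)])
  qed
  have close_i: "close_colouring n (i g) v = g (cls v)" if "v \<in> ?V" for g v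
  proof (cases "v = n")
    case True
    have "cls 1 = cls n" by (rule cls_edge) simp
    moreover have "1 \<in> {1..n - 1}" using n by auto
    ultimately show ?thesis using True n by (simp add: close_colouring_def i_def)
  next
    case False
    then have "v \<in> {1..n - 1}" using that by auto
    then show ?thesis using False by (simp add: close_colouring_def i_def)
  qed
  have close_mem: "close_colouring n \<kappa> v \<in> D" if "\<kappa> \<in> ?K" "v \<in> ?V" for \<kappa> v
  proof -
    note \<kappa> = K_PiE[OF that(1)]
    show ?thesis
    proof (cases "v = n")
      case True
      have "\<kappa> 1 \<in> D" by (rule PiE_mem[OF \<kappa>]) (use n in simp)
      then show ?thesis using True by (simp add: close_colouring_def)
    next
      case False
      then have "\<kappa> v \<in> D" by (intro PiE_mem[OF \<kappa>]) (use that(2) in auto)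
      then show ?thesis using False by (simp add: close_colouring_def)
    qed
  qed
  have "(\<Sum>\<kappa>\<in>?K. \<Prod>v\<in>{1..n - 1}. x (\<kappa> v)) =
      (\<Sum>g\<in>PiE ?C (\<lambda>_. D). \<Prod>B\<in>?C. x (g B) ^ card (B - {n}))"
  proof (rule sum.reindex_bij_witness[where i = i and j = j])
    fix \<kappa> assume \<kappa>: "\<kappa> \<in> ?K"
    show "i (j \<kappa>) = \<kappa>"
    proof
      fix v
      show "i (j \<kappa>) v = \<kappa> v"
      proof (cases "v \<in> {1..n - 1}")
        case True
        then have v: "v \<in> ?V" "v \<noteq> n" by auto
        have "j \<kappa> (cls v) = close_colouring n \<kappa> v"
          by (rule j_cls[OF \<kappa> cls_in[OF v(1)]]) (simp add: cls_def)
        then show ?thesis using True v(2) by (simp add: i_def close_colouring_def)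
      next
        case False
        from PiE_arb[OF K_PiE[OF \<kappa>] False] show ?thesis by (simp only: i_def restrict_apply if_not_P[OF False])
      qed
    qed
    show "j \<kappa> \<in> PiE ?C (\<lambda>_. D)"
    proof (rule PiE_I)
      fix B assume B: "B \<in> ?C"
      have "(SOME v. v \<in> B) \<in> ?V" using some_in[OF B] block(1)[OF B] by blast
      then have "close_colouring n \<kappa> (SOME v. v \<in> B) \<in> D" by (rule close_mem[OF \<kappa>])
      then show "j \<kappa> B \<in> D" by (simp only: j_def restrict_apply if_P[OF B])
    qed (simp add: j_def)
    \<comment> \<open>The value 1 at n extends the product to all of \<open>?V\<close>, where it can
      be regrouped by components.\<close>
    let ?g = "\<lambda>v. if v = n then 1 else x (\<kappa> v)"
    have "(\<Prod>v\<in>{1..n - 1}. x (\<kappa> v)) = (\<Prod>v\<in>?V. ?g v)"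
      using n by (intro prod.mono_neutral_cong_left) auto
    also have "\<dots> = (\<Prod>v\<in>\<Union>?C. ?g v)" using part by (simp add: partition_on_def)
    also have "\<dots> = (\<Prod>B\<in>?C. \<Prod>v\<in>B. ?g v)"
      unfolding comp_def[symmetric]
      by (subst prod.Union_disjoint_sets) (use part block(2) in \<open>auto simp: partition_on_def comp_def\<close>)
    also have "\<dots> = (\<Prod>B\<in>?C. x (j \<kappa> B) ^ card (B - {n}))"
    proof (rule prod.cong[OF refl])
      fix B assume B: "B \<in> ?C"
      have "(\<Prod>v\<in>B. ?g v) = (\<Prod>v\<in>B - {n}. ?g v)"
        by (rule prod.mono_neutral_right) (use block(2)[OF B] in auto)
      also have "\<dots> = (\<Prod>v\<in>B - {n}. x (j \<kappa> B))"
      proof (rule prod.cong[OF refl])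
        fix v assume v: "v \<in> B - {n}"
        then have "j \<kappa> B = close_colouring n \<kappa> v" by (intro j_cls[OF \<kappa> B]) simp
        then show "?g v = x (j \<kappa> B)" using v by (simp add: close_colouring_def)
      qed
      finally show "(\<Prod>v\<in>B. ?g v) = x (j \<kappa> B) ^ card (B - {n})" by simp
    qed
    finally show "(\<Prod>B\<in>?C. x (j \<kappa> B) ^ card (B - {n})) = (\<Prod>v\<in>{1..n - 1}. x (\<kappa> v))" ..
  next
    fix g assume g: "g \<in> PiE ?C (\<lambda>_. D)"
    show "j (i g) = g"
    proof
      fix B
      show "j (i g) B = g B"
      proof (cases "B \<in> ?C")
        case True
        have "(SOME v. v \<in> B) \<in> ?V" using some_in[OF True] block(1)[OF True] by blast
        from close_i[OF this] show ?thesis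
          using True cls_eq[OF True some_in[OF True]] by (simp add: j_def)
      next
        case False
        then show ?thesis using PiE_arb[OF g False] by (simp add: j_def)
      qed
    qed
    have "i g \<in> {1..n - 1} \<rightarrow>\<^sub>E D"
    proof (rule PiE_I)
      fix v assume v: "v \<in> {1..n - 1}"
      then have "v \<in> ?V" by auto
      from PiE_mem[OF g cls_in[OF this]] show "i g v \<in> D" using v by (simp add: i_def)
    next
      fix v assume "v \<notin> {1..n - 1}"
      then show "i g v = undefined" by (simp only: i_def restrict_apply if_False)
    qed
    moreover have "close_colouring n (i g) u = close_colouring n (i g) v"
      if e: "e \<in> A" "u \<in> e" "v \<in> e" for e u v
    proof -
      have uv: "u \<in> ?V" "v \<in> ?V" using simple_edges_subset[OF A e(1)] e(2,3) by blast+
      have "e \<in> ?A" using e(1) by simp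
      then obtain B where B: "B \<in> ?C" "e \<subseteq> B" using edge_in_component[OF simple] by blast
      then have "cls u = cls v"
        using cls_eq[OF B(1) subsetD[OF B(2) e(2)]] cls_eq[OF B(1) subsetD[OF B(2) e(3)]] by simp
      then show ?thesis unfolding close_i[OF uv(1)] close_i[OF uv(2)] by simp
    qed
    ultimately show "i g \<in> ?K" by blast
  qed
  also have "\<dots> = (\<Prod>B\<in>?C. \<Sum>c\<in>D. x c ^ card (B - {n}))"
    by (rule prod_sum_PiE[symmetric]) (simp_all add: D components_def)
  finally show ?thesis .
qed

text \<open>Inclusion-exclusion runs over the edges of G, which remain distinct even where they
  become parallel after 1 and n are identified.\<close>

lemma chrom_sym_circ:
  assumes n: "n \<ge> 2" and E: "simple_edges {1..n} E"
  shows "chrom_sym (n - 1) (circ_edges n E) = (\<Sum>A\<in>Pow E. (- 1) ^ card A * merged_prod n A)"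
proof (rule pseries_eqI_truncate)
  fix D :: "nat set" assume D: "finite D"
  let ?x = "\<lambda>c. monomial {#c#}"
  let ?K = "{1..n - 1} \<rightarrow>\<^sub>E D - {0}"
  define mono where "mono \<kappa> e \<longleftrightarrow> (\<forall>u\<in>e. \<forall>v\<in>e. close_colouring n \<kappa> u = close_colouring n \<kappa> v)" for \<kappa> e
  define X where "X \<kappa> = (\<Prod>v\<in>{1..n - 1}. ?x (\<kappa> v))" for \<kappa>
  have finE: "finite E"
    by (rule finite_subset[of _ "Pow {1..n}"]) (use simple_edges_subset[OF E] in auto)
  have finK: "finite ?K" using D by (intro finite_PiE) simp_all
  have "truncate D (chrom_sym (n - 1) (circ_edges n E)) =
      (\<Sum>\<kappa> | \<kappa> \<in> ?K \<and> (\<forall>e\<in>E. \<not> mono \<kappa> e). X \<kappa>)"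
    unfolding truncate_chrom_sym[OF D] proper_circ_iff[OF n E] mono_def X_def ..
  also have "\<dots> = (\<Sum>\<kappa>\<in>?K. (if \<forall>e\<in>E. \<not> mono \<kappa> e then 1 else 0) * X \<kappa>)"
    using finK by (intro sum.mono_neutral_cong_left) auto
  also have "\<dots> = (\<Sum>\<kappa>\<in>?K. \<Sum>A\<in>Pow E. (if \<forall>e\<in>A. mono \<kappa> e then (- 1) ^ card A else 0) * X \<kappa>)"
    unfolding sum_subsets_sign[OF finE, symmetric] sum_distrib_right ..
  also have "\<dots> = (\<Sum>A\<in>Pow E. \<Sum>\<kappa>\<in>?K. (if \<forall>e\<in>A. mono \<kappa> e then (- 1) ^ card A else 0) * X \<kappa>)"
    by (rule sum.swap)
  also have "\<dots> = (\<Sum>A\<in>Pow E. (- 1) ^ card A * truncate D (merged_prod n A))"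
  proof (rule sum.cong[OF refl])
    fix A assume "A \<in> Pow E"
    then have A: "simple_edges {1..n} A" using E unfolding simple_edges_def by blast
    have "(\<Sum>\<kappa>\<in>?K. (if \<forall>e\<in>A. mono \<kappa> e then (- 1) ^ card A else 0) * X \<kappa>) =
        (\<Sum>\<kappa> | \<kappa> \<in> ?K \<and> (\<forall>e\<in>A. mono \<kappa> e). (- 1) ^ card A * X \<kappa>)"
      using finK by (intro sum.mono_neutral_cong_right) auto
    also have "\<dots> = (- 1) ^ card A * (\<Prod>B\<in>components {1..n} (insert {1, n} A).
        \<Sum>c\<in>D - {0}. ?x c ^ card (B - {n}))"
      unfolding sum_distrib_left[symmetric] X_def mono_def
      using sum_constant_colourings[OF n A, of "D - {0}" ?x] D by simp
    also have "(\<Prod>B\<in>components {1..n} (insert {1, n} A). \<Sum>c\<in>D - {0}. ?x c ^ card (B - {n})) =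
        truncate D (merged_prod n A)"
      unfolding merged_prod_def truncate_prod
    proof (rule prod.cong[OF refl])
      fix B assume B: "B \<in> components {1..n} (insert {1, n} A)"
      then obtain v where v: "v \<in> {1..n}" "B = connectivity (insert {1, n} A) `` {v}"
        by (auto simp: components_def)
      \<comment> \<open>The edge \<open>{1, n}\<close> prevents n from forming a block by itself, so
        the exponent is positive, as \<open>truncate_power_sum\<close> requires.\<close>
      have "B - {n} \<noteq> {}"
      proof (cases "v = n")
        case True
        have "(n, 1) \<in> connectivity (insert {1, n} A)"
          by (rule connectivity_edge) (simp add: insert_commute)
        then have "1 \<in> B - {n}" using v(2) True n by simp
        then show ?thesis by blast
      next
        case False
        then have "v \<in> B - {n}" using v(2) by simp
        then show ?thesis by blast
      qed
      moreover have "B \<subseteq> {1..n}"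
      proof -
        have "e \<subseteq> {1..n}" if "e \<in> insert {1, n} A" for e
          using that simple_edges_subset[OF A] n by auto
        from partition_on_components[OF this] show ?thesis
          using B unfolding partition_on_def by blast
      qed
      then have "finite (B - {n})" using finite_subset[of B "{1..n}"] by simp
      ultimately have "card (B - {n}) \<ge> 1" by (simp add: Suc_le_eq card_gt_0_iff)
      then show "(\<Sum>c\<in>D - {0}. ?x c ^ card (B - {n})) = truncate D (power_sum (card (B - {n})))"
        by (rule truncate_power_sum[OF D, symmetric])
    qed
    finally show "(\<Sum>\<kappa>\<in>?K. (if \<forall>e\<in>A. mono \<kappa> e then (- 1) ^ card A else 0) * X \<kappa>) =
        (- 1) ^ card A * truncate D (merged_prod n A)" .
  qed
  also have "\<dots> = truncate D (\<Sum>A\<in>Pow E. (- 1) ^ card A * merged_prod n A)"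
    by (simp only: truncate_sum truncate_mult truncate_power truncate_minus truncate_one)
  finally show "truncate D (chrom_sym (n - 1) (circ_edges n E)) =
      truncate D (\<Sum>A\<in>Pow E. (- 1) ^ card A * merged_prod n A)" .
qed

theorem theorem5p3:
  fixes n :: nat and E :: "nat set set" and ord :: "nat \<Rightarrow> nat set rel"
  assumes "n \<ge> 2"
    and "graph_on n E"
    and "\<And>j. j \<ge> 1 \<Longrightarrow> linear_order_on (plus_edges n E (path_edges j)) (ord j)"
  shows "trace_defined (F_mat n E ord)
       \<and> chrom_sym (n - 1) (circ_edges n E) = inf_trace (F_mat n E ord)
       \<and> inf_trace (F_mat n E ord) = (\<Sum>k = 1..n - 1. F_mat n E ord k k)"
proof -
  note simple = simple_edges_graph_on[OF assms(2)]
  have sub: "simple_edges {1..n} A" if "A \<in> Pow E" for A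
    using simple that unfolding simple_edges_def by blast
  have n1: "n \<ge> 1" using assms(1) by simp
  have F: "F_mat n E ord k k =
      (\<Sum>A\<in>Pow E. (- 1) ^ card A * (\<Prod>B\<in>components {1..n} A. path_block n k B))" if "k \<ge> 1" for k
    by (rule F_mat_diagonal[where ord = ord, OF n1 assms(2) that assms(3)[OF that]])
  have zero: "F_mat n E ord k k = 0" if "k \<ge> n" for k
  proof -
    have "k \<ge> 1" using that n1 by simp
    show ?thesis
      unfolding F[OF \<open>k \<ge> 1\<close>]
      by (rule sum.neutral, rule ballI) (simp only: prod_path_block_eq_0[OF assms(1) sub that] mult_zero_right)
  qed
  let ?S = "{k. 1 \<le> k \<and> F_mat n E ord k k \<noteq> 0}"
  have S: "?S \<subseteq> {1..n - 1}"
  proof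
    fix k assume "k \<in> ?S"
    then have "1 \<le> k" "\<not> k \<ge> n" using zero by auto
    then show "k \<in> {1..n - 1}" by simp
  qed
  have fin: "trace_defined (F_mat n E ord)"
    unfolding trace_defined_def by (rule finite_subset[OF S]) simp
  have tr: "inf_trace (F_mat n E ord) = (\<Sum>k=1..n - 1. F_mat n E ord k k)"
    unfolding inf_trace_def by (rule sum.mono_neutral_left[OF _ S]) auto
  have "(\<Sum>k=1..n - 1. F_mat n E ord k k) =
      (\<Sum>k=1..n - 1. \<Sum>A\<in>Pow E. (- 1) ^ card A * (\<Prod>B\<in>components {1..n} A. path_block n k B))"
    by (rule sum.cong[OF refl], rule F) simp
  \<comment> \<open>The exchange is possible because \<open>Pow E\<close> is the same index set for
    every k.\<close>
  also have "\<dots> = (\<Sum>A\<in>Pow E. \<Sum>k=1..n - 1. (- 1) ^ card A * (\<Prod>B\<in>components {1..n} A. path_block n k B))"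
    by (rule sum.swap)
  also have "\<dots> = (\<Sum>A\<in>Pow E. (- 1) ^ card A * merged_prod n A)"
    unfolding sum_distrib_left[symmetric]
    by (rule sum.cong[OF refl]) (simp only: sum_prod_path_block[OF assms(1) sub])
  also have "\<dots> = chrom_sym (n - 1) (circ_edges n E)"
    by (rule chrom_sym_circ[OF assms(1) simple, symmetric])
  finally show ?thesis using fin tr by simp
qed

end
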